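(* Let $\mathfrak g\in\{D_N^{(1)},B_N^{(1)},C_N^{(1)},A_{2N-1}^{(2)},D_{N+1}^{(2)},A_{2N}^{(2)}\}$ and let $\bar D_{a;n}=\bar D_{a;n}^{(\mathfrak g)}(\Lambda)$ be the solution of the opposite quantum Q-system of type $\mathfrak g$ with initial data $\bar D_{a;0}=\Lambda^{\omega_a^*}$, $\bar D_{a;1}=\Lambda^{\omega_a^*}T^{\omega_a}$. There exists an element $g=g^{(\mathfrak g)}$ in a completion of the quantum torus $\mathbb T_\Lambda$ such that for all $n\in\mathbb Z$: $$\bar D_{a;n}=q^{-\frac n2\Lambda_{a,a}^{(\mathfrak g)}}\,g^n\,\bar D_{a;0}\,g^{-n}\quad(a\text{ long}),\qquad \bar D_{a;2n+i}=q^{-n\Lambda_{a,a}^{(\mathfrak g)}}\,g^n\,\bar D_{a;i}\,g^{-n},\ i=0,1\quad(a\text{ short}).$$ These elements are $$g^{(D_N^{(1)})}=g_Tg_\Lambda\Big(\tfrac1{\Lambda_{N-1}\Lambda_N};q\Big)_\infty^{-1},\qquad g^{(B_N^{(1)})}=\Big(g_T^{1/2}\big(\tfrac1{\Lambda_N^2};q\big)_\infty^{-1}\Big)^2g_\Lambda,\qquad g^{(C_N^{(1)})}=(g_Tg_\Lambda)^2\Big(\tfrac1{\Lambda_N};q\Big)_\infty^{-1},$$ $$g^{(A_{2N-1}^{(2)})}=g_Tg_\Lambda\Big(\tfrac1{\Lambda_N^2};q^2\Big)_\infty^{-1},\qquad g^{(D_{N+1}^{(2)})}=g_Tg_\Lambda\Big(\tfrac1{\Lambda_N};q^{1/2}\Big)_\infty^{-1},$$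 $$g^{(A_{2N}^{(2)})}=g_Tg_\Lambda\Big(\tfrac{q^{1/2}}{\Lambda_N};q\Big)_\infty^{-1}g_Tg_\Lambda\Big(\tfrac1{\Lambda_N};q\Big)_\infty^{-1},$$ where $g_T=\prod_{a=1}^Ne^{\frac{(\log T_a)^2}{2\log q}}$ and $g_\Lambda=\prod_{a=1}^{N-1}\big(\tfrac{\Lambda_{a+1}}{\Lambda_a};q\big)_\infty^{-1}$.
   Context: $(u;p)_\infty=\prod_{n\ge0}(1-p^nu)$, $|q|<1$. **Quantum torus.** $\mathbb T_\Lambda$ is generated by invertible $\Lambda_i,T_i$, $i\in[1,N]$, with $T_i\Lambda_j=q^{\delta_{ij}}\Lambda_jT_i$, all other pairs commuting; roots of generators are allowed, e.g. $T_i^{u}\Lambda_j^{v}=q^{uv\delta_{ij}}\Lambda_j^vT_i^u$ for rational $u,v$. In the completion, power series in the monomials $\Lambda^{-\alpha_i^*}$ are allowed, and $g_T^{y}=\prod_ae^{y(\log T_a)^2/(2\log q)}$ ($y\in\mathbb Q$) commutes with all $T_b$ and satisfies $g_T^{y}\Lambda_b^z=q^{yz^2/2}\Lambda_b^zT_b^{yz}g_T^y$. **Root data.** $[1,N]=\{1,\dots,N\}$; $e_1,\dots,e_N$ is the standard basis of $\mathbb R^N$, $\cdot$ the standard scalar product, $y^v=\prod_i y_i^{v_i}$ for $v=\sum v_ie_i$. Each $\mathfrak g$ has a pair $(R,R^* )$ of finite types: $D_N^{(1)}:(D_N,D_N)$; $B_N^{(1)}:(B_N,C_N)$; $C_N^{(1)}:(C_N,B_N)$;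 $A_{2N-1}^{(2)}:(C_N,C_N)$; $D_{N+1}^{(2)}:(B_N,B_N)$; $A_{2N}^{(2)}:(BC_N,BC_N)$. Fundamental weights: $C_N$ and $BC_N$: $\omega_i=e_1+\dots+e_i$ for all $i$; $B_N$: $\omega_i=e_1+\dots+e_i$ ($i<N$), $\omega_N=\frac12\sum_k e_k$; $D_N$: $\omega_i=e_1+\dots+e_i$ ($i\le N-2$), $\omega_{N-1}=\omega_N-e_N$, $\omega_N=\frac12\sum_ke_k$. Simple roots: $\alpha_i=e_i-e_{i+1}$ ($i<N$), and $\alpha_N=e_N$ for $B_N$, $BC_N$; $2e_N$ for $C_N$; $e_{N-1}+e_N$ for $D_N$. $\omega_a,\alpha_a$ refer to $R$ and $\omega_a^*,\alpha_a^*$ to $R^*$. $\Lambda_{a,b}=\Lambda_{a,b}^{(\mathfrak g)}:=\omega_a^*\cdot\omega_b$ (numbers, not to be confused with the generators $\Lambda_i$). A label $a\in[1,N]$ is *short* in the cases: $a=N$ for $B_N^{(1)}$; $a\in[1,N-1]$ for $C_N^{(1)}$; all $a$ for $A_{2N}^{(2)}$; all other labels are *long*. $t_a=2$ for $a$ short, $t_a=1$ for $a$ long. **Quantum Q-system of type $\mathfrak g$** for $\{\mathcal Q_{a;n}:a\in[1,N],n\in\mathbb Z\}$ (convention $\mathcal Q_{0;n}=1$). Commutation: $\mathcal Q_{a;t_ak+i}\mathcal Q_{b;t_bk+j}=q^{\Lambda_{a,b}j-\Lambda_{b,a}i}\mathcal Q_{b;t_bk+j}\mathcal Q_{a;t_ak+i}$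 for $i,j\in\{0,1\}$, $k\in\mathbb Z$, $a,b\in[1,N]$. Evolution, for all $n\in\mathbb Z$: with $\bar N_{\mathfrak g}=N-3$ for $D_N^{(1)}$, $N-2$ for $B_N^{(1)},C_N^{(1)},D_{N+1}^{(2)}$, $N-1$ for $A_{2N}^{(2)},A_{2N-1}^{(2)}$: $q^a\mathcal Q_{a;n+1}\mathcal Q_{a;n-1}=\mathcal Q_{a;n}^2-\mathcal Q_{a+1;n}\mathcal Q_{a-1;n}$ for $a\in[1,\bar N_{\mathfrak g}]$, and in addition: - $D_N^{(1)}$: $q^{N-2}\mathcal Q_{N-2;n+1}\mathcal Q_{N-2;n-1}=\mathcal Q_{N-2;n}^2-q^{-\frac{(N-2)n}4}\mathcal Q_{N-3;n}\mathcal Q_{N-1;n}\mathcal Q_{N;n}$; and for $b=N-1,N$: $q^{\frac N4}\mathcal Q_{b;n+1}\mathcal Q_{b;n-1}=\mathcal Q_{b;n}^2-q^{\frac{(N-4)n}4}\mathcal Q_{N-2;n}$. - $B_N^{(1)}$: $q^{N-1}\mathcal Q_{N-1;n+1}\mathcal Q_{N-1;n-1}=\mathcal Q_{N-1;n}^2-\mathcal Q_{N-2;n}\mathcal Q_{N;2n}$; $q^{\frac N2}\mathcal Q_{N;2n+1}\mathcal Q_{N;2n-1}=\mathcal Q_{N;2n}^2-q^{-n}\mathcal Q_{N-1;n}^2$; $q^{\frac N2}\mathcal Q_{N;2n+2}\mathcal Q_{N;2n}=\mathcal Q_{N;2n+1}^2-q^{\frac N2-n-1}\mathcal Q_{N-1;n+1}\mathcal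 Q_{N-1;n}$. - $C_N^{(1)}$: $q^{N-1}\mathcal Q_{N-1;2n+1}\mathcal Q_{N-1;2n-1}=\mathcal Q_{N-1;2n}^2-q^{-\frac{Nn}2}\mathcal Q_{N-2;2n}\mathcal Q_{N;n}^2$; $q^{N-1}\mathcal Q_{N-1;2n+2}\mathcal Q_{N-1;2n}=\mathcal Q_{N-1;2n+1}^2-q^{-\frac{Nn}2}\mathcal Q_{N-2;2n+1}\mathcal Q_{N;n+1}\mathcal Q_{N;n}$; $q^{\frac N2}\mathcal Q_{N;n+1}\mathcal Q_{N;n-1}=\mathcal Q_{N;n}^2-q^{\frac{(N-2)n}2}\mathcal Q_{N-1;2n}$. - $D_{N+1}^{(2)}$: $q^{N-1}\mathcal Q_{N-1;n+1}\mathcal Q_{N-1;n-1}=\mathcal Q_{N-1;n}^2-q^{-\frac{Nn}4}\mathcal Q_{N-2;n}\mathcal Q_{N;n}^2$; $q^{\frac N4}\mathcal Q_{N;n+1}\mathcal Q_{N;n-1}=\mathcal Q_{N;n}^2-q^{\frac{(N-2)n}4}\mathcal Q_{N-1;n}$. - $A_{2N-1}^{(2)}$: $q^N\mathcal Q_{N;n+1}\mathcal Q_{N;n-1}=\mathcal Q_{N;n}^2-q^{-n}\mathcal Q_{N-1;n}^2$. - $A_{2N}^{(2)}$: $q^N\mathcal Q_{N;2n+1}\mathcal Q_{N;2n-1}=\mathcal Q_{N;2n}^2-q^{-n}\mathcal Q_{N-1;2n}\mathcal Q_{N;2n}$; $q^N\mathcal Q_{N;2n+2}\mathcal Q_{N;2n}=\mathcal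 Q_{N;2n+1}^2-q^{-n}\mathcal Q_{N-1;2n+1}\mathcal Q_{N;2n+1}$. The *opposite* quantum Q-system is the set of relations obtained by reversing the order of all products. Being a two-step recursion, it determines all $\bar D_{a;n}$ from the initial data $\bar D_{a;0}$, $\bar D_{a;1}$. *)

theory Defs
  imports Complex_Main "HOL-Algebra.Module"
begin

datatype affine_type =
    D1      \<comment> \<open>\<open>D\<^sub>N\<^sup>(\<^sup>1\<^sup>)\<close>\<close>
  | B1      \<comment> \<open>\<open>B\<^sub>N\<^sup>(\<^sup>1\<^sup>)\<close>\<close>
  | C1      \<comment> \<open>\<open>C\<^sub>N\<^sup>(\<^sup>1\<^sup>)\<close>\<close>
  | A2odd   \<comment> \<open>\<open>A\<^sub>2\<^sub>N\<^sub>-\<^sub>1\<^sup>(\<^sup>2\<^sup>)\<close>\<close>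
  | D2      \<comment> \<open>\<open>D\<^sub>N\<^sub>+\<^sub>1\<^sup>(\<^sup>2\<^sup>)\<close>\<close>
  | A2even  \<comment> \<open>\<open>A\<^sub>2\<^sub>N\<^sup>(\<^sup>2\<^sup>)\<close>\<close>

datatype finite_type = FinB | FinC | FinD | FinBC

text \<open>The ranks for which every label occurring in the Q-system lies in \<open>{0..N}\<close>
  and every evolution equation is attached to a label in \<open>{1..N}\<close>.\<close>

fun admissible_rank :: "affine_type \<Rightarrow> nat \<Rightarrow> bool" where
  "admissible_rank D1 N = (3 \<le> N)"
| "admissible_rank B1 N = (2 \<le> N)"
| "admissible_rank C1 N = (2 \<le> N)"
| "admissible_rank D2 N = (2 \<le> N)"
| "admissible_rank A2odd N = (1 \<le> N)"
| "admissible_rank A2even N = (1 \<le> N)"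

fun type_R :: "affine_type \<Rightarrow> finite_type" where
  "type_R D1 = FinD" | "type_R B1 = FinB" | "type_R C1 = FinC"
| "type_R A2odd = FinC" | "type_R D2 = FinB" | "type_R A2even = FinBC"

fun type_R_star :: "affine_type \<Rightarrow> finite_type" where
  "type_R_star D1 = FinD" | "type_R_star B1 = FinC" | "type_R_star C1 = FinB"
| "type_R_star A2odd = FinC" | "type_R_star D2 = FinB" | "type_R_star A2even = FinBC"

text \<open>Rational vectors \<open>\<Sum>i. v i * e\<^sub>i\<close>, with coordinates indexed by \<open>{1..N}\<close> and \<open>0\<close> elsewhere.\<close>

type_synonym wt = "nat \<Rightarrow> rat"

definition e_vec :: "nat \<Rightarrow> wt" where
  "e_vec i = (\<lambda>j. if j = i then 1 else 0)"

definition e_sum :: "nat \<Rightarrow> wt" where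
  "e_sum a = (\<lambda>j. if j \<in> {1..a} then 1 else 0)"

definition dot :: "nat \<Rightarrow> wt \<Rightarrow> wt \<Rightarrow> rat" where
  "dot N v w = (\<Sum>i=1..N. v i * w i)"

fun fund_wt :: "finite_type \<Rightarrow> nat \<Rightarrow> nat \<Rightarrow> wt" where
  "fund_wt FinC N a = e_sum a"
| "fund_wt FinBC N a = e_sum a"
| "fund_wt FinB N a = (if a < N then e_sum a else (\<lambda>j. e_sum N j / 2))"
| "fund_wt FinD N a =
     (if a + 2 \<le> N then e_sum a
      else if a + 1 = N then (\<lambda>j. e_sum N j / 2 - e_vec N j)
      else (\<lambda>j. e_sum N j / 2))"

fun simple_root :: "finite_type \<Rightarrow> nat \<Rightarrow> nat \<Rightarrow> wt" where
  "simple_root FinC N a =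
     (if a < N then (\<lambda>j. e_vec a j - e_vec (a + 1) j) else (\<lambda>j. 2 * e_vec N j))"
| "simple_root FinB N a =
     (if a < N then (\<lambda>j. e_vec a j - e_vec (a + 1) j) else e_vec N)"
| "simple_root FinBC N a =
     (if a < N then (\<lambda>j. e_vec a j - e_vec (a + 1) j) else e_vec N)"
| "simple_root FinD N a =
     (if a < N then (\<lambda>j. e_vec a j - e_vec (a + 1) j)
      else (\<lambda>j. e_vec (N - 1) j + e_vec N j))"

abbreviation omega :: "affine_type \<Rightarrow> nat \<Rightarrow> nat \<Rightarrow> wt" where
  "omega ty N a \<equiv> fund_wt (type_R ty) N a"

abbreviation omega_star :: "affine_type \<Rightarrow> nat \<Rightarrow> nat \<Rightarrow> wt" where
  "omega_star ty N a \<equiv> fund_wt (type_R_star ty) N a"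

definition Lam_num :: "affine_type \<Rightarrow> nat \<Rightarrow> nat \<Rightarrow> nat \<Rightarrow> rat" where
  "Lam_num ty N a b = dot N (omega_star ty N a) (omega ty N b)"

definition short :: "affine_type \<Rightarrow> nat \<Rightarrow> nat \<Rightarrow> bool" where
  "short ty N a \<longleftrightarrow> ty = B1 \<and> a = N \<or> ty = C1 \<and> 1 \<le> a \<and> a < N \<or> ty = A2even"

definition t_lab :: "affine_type \<Rightarrow> nat \<Rightarrow> nat \<Rightarrow> int" where
  "t_lab ty N a = (if short ty N a then 2 else 1)"

text \<open>Throughout \<open>h = log q\<close>, so that all rational powers of \<open>q\<close> are fixed consistently;
  \<open>0 < |q| < 1\<close> means \<open>Re h < 0\<close>.\<close>

definition qpow :: "complex \<Rightarrow> rat \<Rightarrow> complex" where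
  "qpow h r = exp (of_rat r * h)"

text \<open>An element is a formal series \<open>\<Sum>v. \<Lambda>\<^sup>v f\<^sub>v\<close>, whose coefficient \<open>f\<^sub>v\<close>, written to the
  right of \<open>\<Lambda>\<^sup>v\<close>, is a function of \<open>t = (log T\<^sub>1, \<dots>, log T\<^sub>N)\<close>.
  Since \<open>T\<^sub>i \<Lambda>\<^sub>j = q\<^bsup>\<delta>\<^esup> \<Lambda>\<^sub>j T\<^sub>i\<close>, moving a coefficient past \<open>\<Lambda>\<^sup>w\<close> gives
  \<open>f(t) \<Lambda>\<^sup>w = \<Lambda>\<^sup>w f(t + h w)\<close>.\<close>

type_synonym qelt = "wt \<Rightarrow> (nat \<Rightarrow> complex) \<Rightarrow> complex"

text \<open>The function of \<open>t\<close> that represents \<open>T\<^sup>u g\<^sub>T\<^sup>y\<close>, where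
  \<open>g\<^sub>T\<^sup>y = (\<Prod>a. exp (y (log T\<^sub>a)\<^sup>2 / (2 log q)))\<close>.\<close>

definition T_fun :: "complex \<Rightarrow> nat \<Rightarrow> wt \<Rightarrow> rat \<Rightarrow> (nat \<Rightarrow> complex) \<Rightarrow> complex" where
  "T_fun h N u y = (\<lambda>t. (\<Prod>a=1..N. exp (of_rat (u a) * t a)) *
                         (\<Prod>a=1..N. exp (of_rat y * (t a)\<^sup>2 / (2 * h))))"

definition T_funs :: "complex \<Rightarrow> nat \<Rightarrow> ((nat \<Rightarrow> complex) \<Rightarrow> complex) set" where
  "T_funs h N = {f. \<exists>S c. finite S \<and> f = (\<lambda>t. \<Sum>(u, y)\<in>S. c u y * T_fun h N u y t)}"

definition cone :: "affine_type \<Rightarrow> nat \<Rightarrow> wt \<Rightarrow> wt set" where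
  "cone ty N \<mu> = {\<lambda>j. \<mu> j - (\<Sum>i=1..N. of_nat (k i) * simple_root (type_R_star ty) N i j)
                   | k :: nat \<Rightarrow> nat. True}"

definition qtorus_carrier :: "complex \<Rightarrow> affine_type \<Rightarrow> nat \<Rightarrow> qelt set" where
  "qtorus_carrier h ty N =
     {F. (\<forall>v. F v \<in> T_funs h N) \<and>
         (\<exists>S. finite S \<and> (\<forall>\<mu>\<in>S. \<forall>j. j \<notin> {1..N} \<longrightarrow> \<mu> j = 0) \<and>
              {v. F v \<noteq> (\<lambda>_. 0)} \<subseteq> (\<Union>\<mu>\<in>S. cone ty N \<mu>))}"

text \<open>\<open>\<Lambda>\<^sup>v T\<^sup>u g\<^sub>T\<^sup>y\<close>\<close>

definition monom_elt :: "complex \<Rightarrow> nat \<Rightarrow> wt \<Rightarrow> wt \<Rightarrow> rat \<Rightarrow> qelt" where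
  "monom_elt h N v u y = (\<lambda>w t. if w = v then T_fun h N u y t else 0)"

text \<open>The index set of the sum in \<open>mult\<close> is finite for factors in the carrier.\<close>

definition qtorus :: "complex \<Rightarrow> affine_type \<Rightarrow> nat \<Rightarrow> (complex, qelt) module" where
  "qtorus h ty N =
    \<lparr> carrier = qtorus_carrier h ty N,
      mult = (\<lambda>F G v t.
        \<Sum>w | F (\<lambda>i. v i - w i) \<noteq> (\<lambda>_. 0) \<and> G w \<noteq> (\<lambda>_. 0).
          F (\<lambda>i. v i - w i) (\<lambda>i. t i + of_rat (w i) * h) * G w t),
      one = (\<lambda>v t. if v = (\<lambda>_. 0) then 1 else 0),
      zero = (\<lambda>v t. 0),
      add = (\<lambda>F G v t. F v t + G v t),
      smult = (\<lambda>c F v t. c * F v t) \<rparr>"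

definition Lam_pow :: "complex \<Rightarrow> nat \<Rightarrow> wt \<Rightarrow> qelt" where
  "Lam_pow h N v = monom_elt h N v (\<lambda>_. 0) 0"

definition T_pow :: "complex \<Rightarrow> nat \<Rightarrow> wt \<Rightarrow> qelt" where
  "T_pow h N u = monom_elt h N (\<lambda>_. 0) u 0"

definition gT_pow :: "complex \<Rightarrow> nat \<Rightarrow> rat \<Rightarrow> qelt" where
  "gT_pow h N y = monom_elt h N (\<lambda>_. 0) (\<lambda>_. 0) y"

text \<open>The relations of the quantum torus and of \<open>g\<^sub>T\<^sup>y\<close> hold for these series:
  \<open>T\<^sup>u g\<^sub>T\<^sup>y \<Lambda>\<^sup>z = q\<^bsup>u\<cdot>z + y z\<cdot>z/2\<^esup> \<Lambda>\<^sup>z T\<^bsup>u + y z\<^esup> g\<^sub>T\<^sup>y\<close>.\<close>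

lemma T_fun_shift:
  assumes "h \<noteq> 0"
  shows "T_fun h N u y (\<lambda>i. t i + of_rat (z i) * h) =
    qpow h (dot N u z + y * dot N z z / 2) * T_fun h N (\<lambda>j. u j + y * z j) y t"
proof -
  have alg: "U * (x + Z * h) + Y * (x + Z * h)\<^sup>2 / (2 * h) =
      (U * Z + Y * (Z * Z) / 2) * h + ((U + Y * Z) * x + Y * x\<^sup>2 / (2 * h))" for U Z Y x :: complex
    using assms by (simp add: power2_eq_square field_simps)
  have *: "exp (of_rat (u a) * (t a + of_rat (z a) * h)) *
      exp (of_rat y * (t a + of_rat (z a) * h)\<^sup>2 / (2 * h)) =
      exp (of_rat (u a * z a + y * (z a * z a) / 2) * h) *
      (exp (of_rat (u a + y * z a) * t a) * exp (of_rat y * (t a)\<^sup>2 / (2 * h)))" for a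
    by (simp only: exp_add[symmetric] of_rat_add of_rat_mult of_rat_divide of_rat_numeral_eq alg)
  have sum: "dot N u z + y * dot N z z / 2 = (\<Sum>a=1..N. u a * z a + y * (z a * z a) / 2)"
    by (simp add: dot_def sum.distrib sum_distrib_left sum_divide_distrib)
  have "qpow h (dot N u z + y * dot N z z / 2) =
      (\<Prod>a=1..N. exp (of_rat (u a * z a + y * (z a * z a) / 2) * h))"
    unfolding qpow_def sum of_rat_sum sum_distrib_right by (rule exp_sum) simp
  then show ?thesis
    unfolding T_fun_def prod.distrib[symmetric] by (simp only: * prod.distrib)
qed

lemma gT_T_Lam_relation:
  assumes "h \<noteq> 0"
  shows "monom_elt h N (\<lambda>_. 0) u y \<otimes>\<^bsub>qtorus h ty N\<^esub> Lam_pow h N z =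
    qpow h (dot N u z + y * dot N z z / 2) \<odot>\<^bsub>qtorus h ty N\<^esub>
      monom_elt h N z (\<lambda>j. u j + y * z j) y"
proof -
  have nz: "T_fun h N u' y' \<noteq> (\<lambda>_. 0)" for u' y'
  proof
    assume "T_fun h N u' y' = (\<lambda>_. 0)"
    then have "T_fun h N u' y' (\<lambda>_. 0) = 0" by (rule fun_cong)
    then show False by (simp add: T_fun_def)
  qed
  have supp: "monom_elt h N v' u' y' w \<noteq> (\<lambda>_. 0) \<longleftrightarrow> w = v'" for v' u' y' w
    using nz[of u' y'] by (cases "w = v'") (simp_all add: monom_elt_def)
  have diff: "(\<lambda>i. v i - w i) = (\<lambda>_. 0) \<longleftrightarrow> v = w" for v w :: wt
    by (simp add: fun_eq_iff)
  have *: "{w. monom_elt h N (\<lambda>_. 0) u y (\<lambda>i. v i - w i) \<noteq> (\<lambda>_. 0) \<and>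
      monom_elt h N z (\<lambda>_. 0) 0 w \<noteq> (\<lambda>_. 0)} = (if v = z then {z} else {})" for v
    unfolding supp diff by auto
  have eq: "(monom_elt h N (\<lambda>_. 0) u y \<otimes>\<^bsub>qtorus h ty N\<^esub> Lam_pow h N z) v t =
    (if v = z then T_fun h N u y (\<lambda>i. t i + of_rat (z i) * h) else 0)" for v t
    unfolding qtorus_def Lam_pow_def monoid.simps * by (simp add: monom_elt_def T_fun_def)
  show ?thesis
    by (intro ext, unfold eq T_fun_shift[OF assms]) (simp add: qtorus_def monom_elt_def)
qed

text \<open>\<open>(x; p)\<^sub>\<infinity>\<close>, the infinite product being the coefficientwise limit of the finite ones.\<close>

primrec qpoch_fin :: "(complex, qelt) module \<Rightarrow> qelt \<Rightarrow> complex \<Rightarrow> nat \<Rightarrow> qelt" where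
  "qpoch_fin M x p 0 = \<one>\<^bsub>M\<^esub>"
| "qpoch_fin M x p (Suc m) =
     qpoch_fin M x p m \<otimes>\<^bsub>M\<^esub> (\<one>\<^bsub>M\<^esub> \<ominus>\<^bsub>M\<^esub> (p ^ m) \<odot>\<^bsub>M\<^esub> x)"

definition qpoch :: "(complex, qelt) module \<Rightarrow> qelt \<Rightarrow> complex \<Rightarrow> qelt" where
  "qpoch M x p = (\<lambda>v t. lim (\<lambda>m. qpoch_fin M x p m v t))"

text \<open>\<open>q\<^sup>c Q\<^sub>a\<^sub>;\<^sub>m\<^sub>+\<^sub>1 Q\<^sub>a\<^sub>;\<^sub>m\<^sub>-\<^sub>1 = Q\<^sub>a\<^sub>;\<^sub>m\<^sup>2 - q\<^sup>d X\<close>\<close>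

definition q_rel :: "complex \<Rightarrow> (complex, 'b) module \<Rightarrow> (nat \<Rightarrow> int \<Rightarrow> 'b) \<Rightarrow>
    rat \<Rightarrow> nat \<Rightarrow> int \<Rightarrow> rat \<Rightarrow> 'b \<Rightarrow> bool" where
  "q_rel h M Q c a m d X \<longleftrightarrow>
     qpow h c \<odot>\<^bsub>M\<^esub> (Q a (m + 1) \<otimes>\<^bsub>M\<^esub> Q a (m - 1)) =
     Q a m [^]\<^bsub>M\<^esub> (2::nat) \<ominus>\<^bsub>M\<^esub> qpow h d \<odot>\<^bsub>M\<^esub> X"

fun N_bar :: "affine_type \<Rightarrow> nat \<Rightarrow> nat" where
  "N_bar D1 N = N - 3"
| "N_bar B1 N = N - 2"
| "N_bar C1 N = N - 2"
| "N_bar D2 N = N - 2"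
| "N_bar A2even N = N - 1"
| "N_bar A2odd N = N - 1"

fun boundary_rel :: "affine_type \<Rightarrow> complex \<Rightarrow> nat \<Rightarrow> (complex, 'b) module \<Rightarrow>
    (nat \<Rightarrow> int \<Rightarrow> 'b) \<Rightarrow> int \<Rightarrow> bool" where
  "boundary_rel D1 h N M Q n \<longleftrightarrow>
     q_rel h M Q (of_nat N - 2) (N - 2) n (- ((of_nat N - 2) * of_int n / 4))
       (Q (N - 3) n \<otimes>\<^bsub>M\<^esub> Q (N - 1) n \<otimes>\<^bsub>M\<^esub> Q N n) \<and>
     (\<forall>b\<in>{N - 1, N}.
        q_rel h M Q (of_nat N / 4) b n ((of_nat N - 4) * of_int n / 4) (Q (N - 2) n))"
| "boundary_rel B1 h N M Q n \<longleftrightarrow>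
     q_rel h M Q (of_nat N - 1) (N - 1) n 0 (Q (N - 2) n \<otimes>\<^bsub>M\<^esub> Q N (2 * n)) \<and>
     q_rel h M Q (of_nat N / 2) N (2 * n) (- of_int n) (Q (N - 1) n [^]\<^bsub>M\<^esub> (2::nat)) \<and>
     q_rel h M Q (of_nat N / 2) N (2 * n + 1) (of_nat N / 2 - of_int n - 1)
       (Q (N - 1) (n + 1) \<otimes>\<^bsub>M\<^esub> Q (N - 1) n)"
| "boundary_rel C1 h N M Q n \<longleftrightarrow>
     q_rel h M Q (of_nat N - 1) (N - 1) (2 * n) (- (of_nat N * of_int n / 2))
       (Q (N - 2) (2 * n) \<otimes>\<^bsub>M\<^esub> Q N n [^]\<^bsub>M\<^esub> (2::nat)) \<and>
     q_rel h M Q (of_nat N - 1) (N - 1) (2 * n + 1) (- (of_nat N * of_int n / 2))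
       (Q (N - 2) (2 * n + 1) \<otimes>\<^bsub>M\<^esub> Q N (n + 1) \<otimes>\<^bsub>M\<^esub> Q N n) \<and>
     q_rel h M Q (of_nat N / 2) N n ((of_nat N - 2) * of_int n / 2) (Q (N - 1) (2 * n))"
| "boundary_rel D2 h N M Q n \<longleftrightarrow>
     q_rel h M Q (of_nat N - 1) (N - 1) n (- (of_nat N * of_int n / 4))
       (Q (N - 2) n \<otimes>\<^bsub>M\<^esub> Q N n [^]\<^bsub>M\<^esub> (2::nat)) \<and>
     q_rel h M Q (of_nat N / 4) N n ((of_nat N - 2) * of_int n / 4) (Q (N - 1) n)"
| "boundary_rel A2odd h N M Q n \<longleftrightarrow>
     q_rel h M Q (of_nat N) N n (- of_int n) (Q (N - 1) n [^]\<^bsub>M\<^esub> (2::nat))"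
| "boundary_rel A2even h N M Q n \<longleftrightarrow>
     q_rel h M Q (of_nat N) N (2 * n) (- of_int n)
       (Q (N - 1) (2 * n) \<otimes>\<^bsub>M\<^esub> Q N (2 * n)) \<and>
     q_rel h M Q (of_nat N) N (2 * n + 1) (- of_int n)
       (Q (N - 1) (2 * n + 1) \<otimes>\<^bsub>M\<^esub> Q N (2 * n + 1))"

definition Q_system :: "affine_type \<Rightarrow> complex \<Rightarrow> nat \<Rightarrow> (complex, 'b) module \<Rightarrow>
    (nat \<Rightarrow> int \<Rightarrow> 'b) \<Rightarrow> bool" where
  "Q_system ty h N M Q \<longleftrightarrow>
     (\<forall>a\<in>{1..N}. \<forall>n. Q a n \<in> carrier M) \<and>
     (\<forall>n. Q 0 n = \<one>\<^bsub>M\<^esub>) \<and>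
     (\<forall>a\<in>{1..N}. \<forall>b\<in>{1..N}. \<forall>k. \<forall>i\<in>{0, 1}. \<forall>j\<in>{0, 1}.
        Q a (t_lab ty N a * k + i) \<otimes>\<^bsub>M\<^esub> Q b (t_lab ty N b * k + j) =
        qpow h (Lam_num ty N a b * of_int j - Lam_num ty N b a * of_int i) \<odot>\<^bsub>M\<^esub>
          (Q b (t_lab ty N b * k + j) \<otimes>\<^bsub>M\<^esub> Q a (t_lab ty N a * k + i))) \<and>
     (\<forall>a\<in>{1..N_bar ty N}. \<forall>n.
        q_rel h M Q (of_nat a) a n 0 (Q (a + 1) n \<otimes>\<^bsub>M\<^esub> Q (a - 1) n)) \<and>
     (\<forall>n. boundary_rel ty h N M Q n)"

definition opposite :: "('a, 'b) module \<Rightarrow> ('a, 'b) module" where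
  "opposite M = M\<lparr>mult := (\<lambda>x y. y \<otimes>\<^bsub>M\<^esub> x)\<rparr>"

definition D_bar_solution :: "affine_type \<Rightarrow> complex \<Rightarrow> nat \<Rightarrow> (nat \<Rightarrow> int \<Rightarrow> qelt) \<Rightarrow> bool" where
  "D_bar_solution ty h N D \<longleftrightarrow>
     Q_system ty h N (opposite (qtorus h ty N)) D \<and>
     (\<forall>a\<in>{1..N}.
        D a 0 = Lam_pow h N (omega_star ty N a) \<and>
        D a 1 = Lam_pow h N (omega_star ty N a) \<otimes>\<^bsub>qtorus h ty N\<^esub> T_pow h N (omega ty N a))"

definition g_Lam :: "affine_type \<Rightarrow> complex \<Rightarrow> nat \<Rightarrow> qelt" where
  "g_Lam ty h N = (let M = qtorus h ty N in
     foldr (\<lambda>a y. inv\<^bsub>M\<^esub> (qpoch M (Lam_pow h N (\<lambda>j. e_vec (a + 1) j - e_vec a j)) (qpow h 1))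
                    \<otimes>\<^bsub>M\<^esub> y)
       [1..<N] \<one>\<^bsub>M\<^esub>)"

definition g_elt :: "affine_type \<Rightarrow> complex \<Rightarrow> nat \<Rightarrow> qelt" where
  "g_elt ty h N = (let M = qtorus h ty N; gT = gT_pow h N 1; gL = g_Lam ty h N in
     case ty of
       D1 \<Rightarrow> gT \<otimes>\<^bsub>M\<^esub> gL \<otimes>\<^bsub>M\<^esub>
         inv\<^bsub>M\<^esub> (qpoch M (Lam_pow h N (\<lambda>j. - e_vec (N - 1) j - e_vec N j)) (qpow h 1))
     | B1 \<Rightarrow> (gT_pow h N (1/2) \<otimes>\<^bsub>M\<^esub>
         inv\<^bsub>M\<^esub> (qpoch M (Lam_pow h N (\<lambda>j. - 2 * e_vec N j)) (qpow h 1))) [^]\<^bsub>M\<^esub> (2::nat)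
         \<otimes>\<^bsub>M\<^esub> gL
     | C1 \<Rightarrow> (gT \<otimes>\<^bsub>M\<^esub> gL) [^]\<^bsub>M\<^esub> (2::nat) \<otimes>\<^bsub>M\<^esub>
         inv\<^bsub>M\<^esub> (qpoch M (Lam_pow h N (\<lambda>j. - e_vec N j)) (qpow h 1))
     | A2odd \<Rightarrow> gT \<otimes>\<^bsub>M\<^esub> gL \<otimes>\<^bsub>M\<^esub>
         inv\<^bsub>M\<^esub> (qpoch M (Lam_pow h N (\<lambda>j. - 2 * e_vec N j)) (qpow h 2))
     | D2 \<Rightarrow> gT \<otimes>\<^bsub>M\<^esub> gL \<otimes>\<^bsub>M\<^esub>
         inv\<^bsub>M\<^esub> (qpoch M (Lam_pow h N (\<lambda>j. - e_vec N j)) (qpow h (1/2)))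
     | A2even \<Rightarrow> gT \<otimes>\<^bsub>M\<^esub> gL \<otimes>\<^bsub>M\<^esub>
         inv\<^bsub>M\<^esub> (qpoch M (qpow h (1/2) \<odot>\<^bsub>M\<^esub> Lam_pow h N (\<lambda>j. - e_vec N j)) (qpow h 1)) \<otimes>\<^bsub>M\<^esub>
         gT \<otimes>\<^bsub>M\<^esub> gL \<otimes>\<^bsub>M\<^esub>
         inv\<^bsub>M\<^esub> (qpoch M (Lam_pow h N (\<lambda>j. - e_vec N j)) (qpow h 1)))"

end

theory Submission
  imports Defs "HOL-Library.Function_Algebras" "HOL-Computational_Algebra.Formal_Power_Series"
begin

text \<open>Conjugation by \<open>g\<^sub>T\<close> sends
  \<open>\<Lambda>\<^sup>z\<close> to a multiple of \<open>\<Lambda>\<^sup>z T\<^sup>z\<close>. The inverse \<open>q\<close>-Pochhammer factors of \<open>g\<close> commute with all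
  \<open>\<Lambda>\<^sup>z\<close>, but the one attached to the simple root \<open>\<alpha>\<^sub>a\<^sup>*\<close> fails to commute with \<open>T\<^bsup>\<omega>\<^sub>a\<^esup>\<close> exactly by the
  factor \<open>1 - \<Lambda>\<^bsup>-\<alpha>\<^sub>a\<^sup>*\<^esup>\<close>, because of the functional equation of \<open>(x; p)\<^sub>\<infinity>\<close>. Hence the conjugates of
  \<open>\<Lambda>\<^bsup>\<omega>\<^sub>a\<^sup>*\<^esup>\<close> satisfy the evolution equation at time \<open>0\<close>, whose right-hand side is
  \<open>\<Lambda>\<^bsup>2\<omega>\<^sub>a\<^sup>*\<^esup> (1 - \<Lambda>\<^bsup>-\<alpha>\<^sub>a\<^sup>*\<^esup>)\<close>, and conjugation by powers of \<open>g\<close> transports it to all times. These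
  conjugates are units, so the two-step recursion has no other solution.\<close>

section \<open>Conjugation in complex algebras\<close>

text \<open>Conjugation by g_T^y turns \<Lambda>^z into \<Lambda>^z T^(yz) up to a scalar, so it
  performs the step T^(\<omega> a) on \<Lambda>^(\<omega>s a) only when \<omega> a = y (\<omega>s
  a). This fixes the shape of g. The ratio y is 1 except at the last label of B1, where it is 1/2,
  and of C1, where it is 2. In these two types g therefore contains two equal steps, and the labels
  with the smaller ratio move twice while the others move once. The base of each Pochhammer factor
  is q to the pairing of \<omega> a with \<alpha> a, so that T^(\<omega> a) shifts its argument by
  exactly one linear factor; hence q^2 in A2odd and q^(1/2) in D2. The n-dependent powers of q in
  the Q-system need no mechanism of their own: each product occurring there is an orbit under g with
  its own exponential rate, and the powers are differences of rates. The obstacle is that the orbits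
  are infinite series. Supports in finitely many cones of negative roots keep products finite, and
  each Pochhammer factor involves a single monomial, so its limit can be taken among power series in
  one variable.\<close>

lemma qpow_add: "qpow h (a + b) = qpow h a * qpow h b"
  by (simp add: qpow_def of_rat_add distrib_right exp_add)

lemma qpow_nonzero [simp]: "qpow h a \<noteq> 0"
  by (simp add: qpow_def)

lemma qpow_0 [simp]: "qpow h 0 = 1"
  by (simp add: qpow_def)

lemma qpow_mult_eqI: "a + b = c \<Longrightarrow> qpow h a * qpow h b = qpow h c"
  by (simp flip: qpow_add)

text \<open>Units form a group even when the monoid does not, so the group laws for integer
  exponents become available for powers of \<open>g\<close> once these are computed in
  \<open>units_of G\<close>.\<close>

lemma (in monoid) int_pow_units_of:
  assumes "g \<in> Units G"
  shows "g [^] (n::int) = g [^]\<^bsub>units_of G\<^esub> n"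
proof -
  have nat: "g [^] (k::nat) = g [^]\<^bsub>units_of G\<^esub> k" for k
    by (induction k) (simp_all add: units_of_one units_of_mult)
  interpret U: group "units_of G" by (rule units_group)
  have "g [^]\<^bsub>units_of G\<^esub> (k::nat) \<in> Units G" for k
    using U.nat_pow_closed[of g k] assms by (simp add: units_of_carrier)
  then show ?thesis
    by (simp only: int_pow_def2 nat units_of_inv)
qed

lemma (in monoid) Units_int_pow_closed:
  "g \<in> Units G \<Longrightarrow> g [^] (n::int) \<in> Units G"
  using group.int_pow_closed[OF units_group, of g n]
  by (simp add: int_pow_units_of units_of_carrier)

lemma (in monoid) Units_int_pow_mult:
  "g \<in> Units G \<Longrightarrow> g [^] (m + n :: int) = g [^] m \<otimes> g [^] n"
  using group.int_pow_mult[OF units_group, of g m n]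
  by (simp add: int_pow_units_of units_of_carrier units_of_mult)

lemma (in monoid) Units_int_pow_1: "g \<in> Units G \<Longrightarrow> g [^] (1::int) = g"
  using group.int_pow_1[OF units_group, of g] by (simp add: int_pow_units_of units_of_carrier)

lemma (in monoid) Units_int_pow_neg:
  "g \<in> Units G \<Longrightarrow> g [^] (- n :: int) = inv (g [^] n)"
  using group.int_pow_neg[OF units_group, of g n] Units_int_pow_closed[of g n]
  by (simp add: int_pow_units_of units_of_carrier units_of_inv)

text \<open>The algebra is noncommutative and its scalars are the whole type \<open>complex\<close>,
  so compatibility is imposed on \<open>smult\<close> directly instead of through a ring of
  scalars.\<close>

locale complex_algebra = ring M for M :: "(complex, 'b) module" (structure) +
  assumes smult_closed [simp, intro]: "x \<in> carrier M \<Longrightarrow> c \<odot> x \<in> carrier M"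
    and smult_one [simp]: "x \<in> carrier M \<Longrightarrow> 1 \<odot> x = x"
    and smult_smult: "x \<in> carrier M \<Longrightarrow> c \<odot> (d \<odot> x) = (c * d) \<odot> x"
    and smult_add: "x \<in> carrier M \<Longrightarrow> y \<in> carrier M \<Longrightarrow> c \<odot> (x \<oplus> y) = c \<odot> x \<oplus> c \<odot> y"
    and mult_smult_left: "x \<in> carrier M \<Longrightarrow> y \<in> carrier M \<Longrightarrow> (c \<odot> x) \<otimes> y = c \<odot> (x \<otimes> y)"
    and mult_smult_right: "x \<in> carrier M \<Longrightarrow> y \<in> carrier M \<Longrightarrow> x \<otimes> (c \<odot> y) = c \<odot> (x \<otimes> y)"
begin

lemmas smult_simps = smult_smult mult_smult_left mult_smult_right

text \<open>Apply \<open>mult_smult_right\<close> to zero times c zero: the left side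
  vanishes.\<close>

lemma smult_zero: "c \<odot> \<zero> = \<zero>"
  using mult_smult_right[of \<zero> \<zero> c] by (simp add: smult_closed)

lemma smult_uminus: "x \<in> carrier M \<Longrightarrow> c \<odot> (\<ominus> x) = \<ominus> (c \<odot> x)"
  using smult_add[of x "\<ominus> x" c] minus_equality[of "c \<odot> (\<ominus> x)" "c \<odot> x"]
  by (simp add: r_neg smult_zero a_comm)

lemma smult_minus:
  "x \<in> carrier M \<Longrightarrow> y \<in> carrier M \<Longrightarrow> c \<odot> (x \<ominus> y) = c \<odot> x \<ominus> c \<odot> y"
  by (simp add: a_minus_def smult_add smult_uminus)

lemma mult_minus_left:
  "\<lbrakk>x \<in> carrier M; y \<in> carrier M; z \<in> carrier M\<rbrakk> \<Longrightarrow> (x \<ominus> y) \<otimes> z = x \<otimes> z \<ominus> y \<otimes> z"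
  by (simp add: a_minus_def l_distr l_minus)

lemma mult_minus_right:
  "\<lbrakk>x \<in> carrier M; y \<in> carrier M; z \<in> carrier M\<rbrakk> \<Longrightarrow> z \<otimes> (x \<ominus> y) = z \<otimes> x \<ominus> z \<otimes> y"
  by (simp add: a_minus_def r_distr r_minus)

section \<open>Inner automorphisms\<close>

definition conjug :: "'b \<Rightarrow> 'b \<Rightarrow> 'b" where
  "conjug g y = g \<otimes> y \<otimes> inv g"

lemma conjug_closed [simp]: "g \<in> Units M \<Longrightarrow> y \<in> carrier M \<Longrightarrow> conjug g y \<in> carrier M"
  by (simp add: conjug_def Units_closed)

lemma conjug_mult:
  assumes "g \<in> Units M" "x \<in> carrier M" "y \<in> carrier M"
  shows "conjug g (x \<otimes> y) = conjug g x \<otimes> conjug g y"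
proof -
  have "conjug g x \<otimes> conjug g y = g \<otimes> x \<otimes> (inv g \<otimes> g) \<otimes> y \<otimes> inv g"
    using assms unfolding conjug_def by (simp add: m_assoc Units_closed del: Units_l_inv)
  with assms show ?thesis by (simp add: conjug_def m_assoc Units_closed)
qed

lemma conjug_smult: "\<lbrakk>g \<in> Units M; x \<in> carrier M\<rbrakk> \<Longrightarrow> conjug g (c \<odot> x) = c \<odot> conjug g x"
  by (simp add: conjug_def smult_simps Units_closed)

lemma conjug_minus:
  "\<lbrakk>g \<in> Units M; x \<in> carrier M; y \<in> carrier M\<rbrakk> \<Longrightarrow> conjug g (x \<ominus> y) = conjug g x \<ominus> conjug g y"
  by (simp add: conjug_def Units_closed mult_minus_left mult_minus_right)

lemma conjug_one [simp]: "g \<in> Units M \<Longrightarrow> conjug g \<one> = \<one>"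
  by (simp add: conjug_def Units_closed)

lemma one_conjug [simp]: "y \<in> carrier M \<Longrightarrow> conjug \<one> y = y"
  by (simp add: conjug_def)

lemma inv_Units_mult:
  "\<lbrakk>f \<in> Units M; g \<in> Units M\<rbrakk> \<Longrightarrow> inv (f \<otimes> g) = inv g \<otimes> inv f"
  using group.inv_mult_group[OF units_group, of f g]
  by (simp add: units_of_carrier units_of_mult units_of_inv)

lemma conjug_conjug:
  "\<lbrakk>f \<in> Units M; g \<in> Units M; y \<in> carrier M\<rbrakk> \<Longrightarrow> conjug (f \<otimes> g) y = conjug f (conjug g y)"
  by (simp add: conjug_def inv_Units_mult m_assoc Units_closed)

lemma conjug_inv_conjug [simp]:
  "\<lbrakk>g \<in> Units M; y \<in> carrier M\<rbrakk> \<Longrightarrow> conjug (inv g) (conjug g y) = y"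
  "\<lbrakk>g \<in> Units M; y \<in> carrier M\<rbrakk> \<Longrightarrow> conjug g (conjug (inv g) y) = y"
  by (simp_all flip: conjug_conjug)

text \<open>Conjugates are computed below through intertwining relations, in which no inverse
  occurs.\<close>

lemma conjug_eq_iff:
  assumes "g \<in> Units M" "x \<in> carrier M" "y \<in> carrier M"
  shows "conjug g x = y \<longleftrightarrow> g \<otimes> x = y \<otimes> g"
proof
  assume "g \<otimes> x = y \<otimes> g"
  then have "conjug g x = y \<otimes> (g \<otimes> inv g)"
    using assms unfolding conjug_def by (simp add: m_assoc Units_closed del: Units_r_inv)
  then show "conjug g x = y" using assms by simp
next
  assume "conjug g x = y"
  then have "y \<otimes> g = g \<otimes> x \<otimes> (inv g \<otimes> g)"
    using assms unfolding conjug_def by (auto simp add: m_assoc Units_closed simp del: Units_l_inv)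
  then show "g \<otimes> x = y \<otimes> g" using assms by (simp add: Units_closed)
qed

lemma conjug_commute:
  "\<lbrakk>g \<in> Units M; x \<in> carrier M; g \<otimes> x = x \<otimes> g\<rbrakk> \<Longrightarrow> conjug g x = x"
  by (simp add: conjug_eq_iff)

lemma conjug_inv_eq:
  "\<lbrakk>g \<in> Units M; x \<in> carrier M; y \<in> carrier M; conjug g x = y\<rbrakk> \<Longrightarrow> conjug (inv g) y = x"
  by auto

lemma conjug_Units:
  assumes "g \<in> Units M" "x \<in> Units M" shows "conjug g x \<in> Units M"
  using assms by (simp add: conjug_def)

lemma smult_Units:
  assumes "x \<in> Units M" "c \<noteq> 0" shows "c \<odot> x \<in> Units M"
proof -
  have "(1 / c) \<odot> inv x \<otimes> (c \<odot> x) = \<one>" "(c \<odot> x) \<otimes> ((1 / c) \<odot> inv x) = \<one>"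
    "(1 / c) \<odot> inv x \<in> carrier M" "c \<odot> x \<in> carrier M"
    using assms by (simp_all add: smult_simps Units_closed)
  then show ?thesis unfolding Units_def by blast
qed

lemma Units_cancel:
  assumes "x \<in> Units M" "y \<in> carrier M" "z \<in> carrier M"
  shows "x \<otimes> y = x \<otimes> z \<longleftrightarrow> y = z" "y \<otimes> x = z \<otimes> x \<longleftrightarrow> y = z"
proof -
  show "x \<otimes> y = x \<otimes> z \<longleftrightarrow> y = z"
    using assms by (rule Units_l_cancel)
  show "y \<otimes> x = z \<otimes> x \<longleftrightarrow> y = z"
  proof
    assume "y \<otimes> x = z \<otimes> x"
    then have "y \<otimes> x \<otimes> inv x = z \<otimes> x \<otimes> inv x" by simp
    then show "y = z" using assms by (simp add: m_assoc Units_closed)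
  qed simp
qed

lemma smult_cancel:
  assumes "c \<odot> x = c \<odot> y" "c \<noteq> 0" "x \<in> carrier M" "y \<in> carrier M"
  shows "x = y"
proof -
  have "(1 / c) \<odot> (c \<odot> x) = (1 / c) \<odot> (c \<odot> y)" using assms by simp
  then show ?thesis using assms(2-4) by (simp add: smult_smult)
qed

text \<open>Since S fixes T, the second conjugation by S only contributes another factor c T. This
  serves the types whose \<open>g\<close> contains the same step twice.\<close>

lemma square_step:
  assumes S: "S \<in> Units M" and car: "L \<in> carrier M" "T \<in> carrier M"
    and SL: "conjug S L = c \<odot> (L \<otimes> T)" and ST: "S \<otimes> T = T \<otimes> S"
  shows "conjug (S \<otimes> S) L = (c * c) \<odot> (L \<otimes> (T \<otimes> T))"
proof -
  have "conjug S T = T" using S ST car by (simp add: conjug_commute)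
  then show ?thesis using S car
    by (simp add: conjug_conjug SL conjug_smult conjug_mult smult_simps m_assoc)
qed

text \<open>The mechanism of all evolution equations: \<open>S\<close> advances \<open>L\<close> by one time step, and the failure of
  \<open>S\<close> to commute with \<open>T\<close> produces the second term of the equation.\<close>

lemma step_relation:
  assumes S: "S \<in> Units M"
    and car: "L \<in> carrier M" "T \<in> carrier M" "x \<in> carrier M"
    and SL: "conjug S L = c \<odot> (L \<otimes> T)"
    and ST: "S \<otimes> T = T \<otimes> S \<otimes> (\<one> \<ominus> x)"
    and TL: "T \<otimes> L = (c * c) \<odot> (L \<otimes> T)"
    and xL: "x \<otimes> L = L \<otimes> x"
  shows "(c * c * c) \<odot> (conjug (inv S) L \<otimes> (L \<otimes> T)) = L \<otimes> L \<ominus> L \<otimes> L \<otimes> x"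
proof -
  have Sc: "S \<in> carrier M" using S by (rule Units_closed)
  have SL': "S \<otimes> L = c \<odot> (L \<otimes> (T \<otimes> S))"
    using SL S Sc car by (simp add: conjug_eq_iff smult_simps m_assoc)
  have SL'': "S \<otimes> (L \<otimes> z) = c \<odot> (L \<otimes> (T \<otimes> (S \<otimes> z)))" if "z \<in> carrier M" for z
    using that arg_cong[OF SL', of "\<lambda>u. u \<otimes> z"] Sc car by (simp add: smult_simps m_assoc)
  have TL'': "T \<otimes> (L \<otimes> z) = (c * c) \<odot> (L \<otimes> (T \<otimes> z))" if "z \<in> carrier M" for z
    using that arg_cong[OF TL, of "\<lambda>u. u \<otimes> z"] car by (simp add: smult_simps m_assoc)
  have SiL: "S \<otimes> (conjug (inv S) L \<otimes> z) = L \<otimes> (S \<otimes> z)" if "z \<in> carrier M" for z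
  proof -
    have "S \<otimes> conjug (inv S) L = L \<otimes> S"
      using S Sc car conjug_eq_iff[OF S, of "conjug (inv S) L" L] by simp
    then show ?thesis using that S Sc car by (metis conjug_closed Units_inv_Units m_assoc)
  qed
  have "L \<otimes> (\<one> \<ominus> x) = (\<one> \<ominus> x) \<otimes> L"
    using car xL by (simp add: mult_minus_left mult_minus_right)
  then have xL'': "S \<otimes> ((\<one> \<ominus> x) \<otimes> L) = c \<odot> (L \<otimes> (T \<otimes> (S \<otimes> (\<one> \<ominus> x))))"
    using SL''[of "\<one> \<ominus> x"] car by simp
  have ST': "S \<otimes> T = T \<otimes> (S \<otimes> (\<one> \<ominus> x))"
    using ST Sc car by (simp add: m_assoc)
  \<comment> \<open>Multiplying by the unit S lets S move to the right through the conjugate, L and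
    T. Both sides then take the normal form c^4 L L T T S (1 - x).\<close>
  have "S \<otimes> ((c * c * c) \<odot> (conjug (inv S) L \<otimes> (L \<otimes> T))) =
        (c * c * c * c) \<odot> (L \<otimes> (L \<otimes> (T \<otimes> (T \<otimes> (S \<otimes> (\<one> \<ominus> x))))))"
    using S Sc car by (simp add: smult_simps SiL SL'' ST')
  also have "\<dots> = S \<otimes> (L \<otimes> L \<otimes> (\<one> \<ominus> x))"
    using Sc car by (simp add: smult_simps m_assoc SL'' TL'' mult.assoc)
  finally have "(c * c * c) \<odot> (conjug (inv S) L \<otimes> (L \<otimes> T)) = L \<otimes> L \<otimes> (\<one> \<ominus> x)"
    using S car by (simp add: Units_cancel)
  then show ?thesis using car by (simp add: mult_minus_right)
qed

text \<open>The orbit of one element under conjugation by \<open>g\<close>, damped by a power of q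
  with constant rate \<xi> per period. Products of orbits are orbits and rates add, so a relation
  between them has to be checked at time 0 only.\<close>

definition evolves :: "complex \<Rightarrow> 'b \<Rightarrow> rat \<Rightarrow> (int \<Rightarrow> 'b) \<Rightarrow> bool" where
  "evolves h g \<xi> Y \<longleftrightarrow> Y 0 \<in> carrier M \<and>
     (\<forall>n. Y n = qpow h (- of_int n * \<xi>) \<odot> conjug (g [^] n) (Y 0))"

lemma evolves_closed: "evolves h g \<xi> Y \<Longrightarrow> Y 0 \<in> carrier M"
  unfolding evolves_def by blast

lemma evolvesD: "evolves h g \<xi> Y \<Longrightarrow> Y n = qpow h (- of_int n * \<xi>) \<odot> conjug (g [^] n) (Y 0)"
  unfolding evolves_def by blast

lemma evolves_mult:
  assumes g: "g \<in> Units M" and ev: "evolves h g \<xi> Y" "evolves h g \<eta> Z"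
  shows "evolves h g (\<xi> + \<eta>) (\<lambda>n. Y n \<otimes> Z n)"
  unfolding evolves_def
proof (intro conjI allI)
  have car: "g [^] (n::int) \<in> Units M" "Y 0 \<in> carrier M" "Z 0 \<in> carrier M" for n
    using g ev[THEN evolves_closed] by (simp_all add: Units_int_pow_closed)
  then show "Y 0 \<otimes> Z 0 \<in> carrier M" by simp
  fix n :: int
  have "Y n \<otimes> Z n = (qpow h (- of_int n * \<xi>) \<odot> conjug (g [^] n) (Y 0)) \<otimes>
      (qpow h (- of_int n * \<eta>) \<odot> conjug (g [^] n) (Z 0))"
    using evolvesD[OF ev(1), of n] evolvesD[OF ev(2), of n] by metis
  moreover have "qpow h (- of_int n * \<xi>) * qpow h (- of_int n * \<eta>) = qpow h (- of_int n * (\<xi> + \<eta>))"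
    by (rule qpow_mult_eqI) (simp add: algebra_simps)
  ultimately show "Y n \<otimes> Z n = qpow h (- of_int n * (\<xi> + \<eta>)) \<odot> conjug (g [^] n) (Y 0 \<otimes> Z 0)"
    using car by (simp add: smult_simps conjug_mult mult.commute)
qed

lemma evolves_one: "g \<in> Units M \<Longrightarrow> evolves h g 0 (\<lambda>_. \<one>)"
  by (simp add: evolves_def Units_int_pow_closed)

lemma evolves_commutation:
  assumes g: "g \<in> Units M" and ev: "evolves h g \<xi> Y" "evolves h g \<eta> Z"
    and rel: "Y 0 \<otimes> Z 0 = c \<odot> (Z 0 \<otimes> Y 0)"
  shows "Y n \<otimes> Z n = c \<odot> (Z n \<otimes> Y n)"
proof -
  have car: "g [^] n \<in> Units M" "Y 0 \<in> carrier M" "Z 0 \<in> carrier M"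
    using g ev[THEN evolves_closed] by (simp_all add: Units_int_pow_closed)
  have "Y n \<otimes> Z n = qpow h (- of_int n * (\<xi> + \<eta>)) \<odot> conjug (g [^] n) (Y 0 \<otimes> Z 0)"
    using evolvesD[OF evolves_mult[OF g ev]] .
  also have "\<dots> = c \<odot> (qpow h (- of_int n * (\<eta> + \<xi>)) \<odot> conjug (g [^] n) (Z 0 \<otimes> Y 0))"
    using car by (simp add: rel conjug_smult smult_simps ac_simps)
  also have "\<dots> = c \<odot> (Z n \<otimes> Y n)"
    using evolvesD[OF evolves_mult[OF g ev(2,1)], of n] by metis
  finally show ?thesis .
qed

text \<open>The product A B and the square of C both have rate 2 \<xi>, while X has rate \<eta>. The
  mismatch \<eta> - 2 \<xi> accumulates once per period and becomes the n-dependent exponent in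
  front of X.\<close>

lemma evolves_relation:
  assumes g: "g \<in> Units M"
    and ev: "evolves h g \<xi> A" "evolves h g \<xi> B" "evolves h g \<xi> C" "evolves h g \<eta> X"
    and rel: "qpow h c \<odot> (A 0 \<otimes> B 0) = C 0 \<otimes> C 0 \<ominus> qpow h d0 \<odot> X 0"
    and d: "d = d0 + of_int n * (\<eta> - 2 * \<xi>)"
  shows "qpow h c \<odot> (A n \<otimes> B n) = C n \<otimes> C n \<ominus> qpow h d \<odot> X n"
proof -
  define q where "q = qpow h (- of_int n * (\<xi> + \<xi>))"
  have car: "g [^] n \<in> Units M" "A 0 \<in> carrier M" "B 0 \<in> carrier M" "C 0 \<in> carrier M" "X 0 \<in> carrier M"
    using g ev[THEN evolves_closed] by (simp_all add: Units_int_pow_closed)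
  have AB: "A n \<otimes> B n = q \<odot> conjug (g [^] n) (A 0 \<otimes> B 0)"
    unfolding q_def by (rule evolvesD[OF evolves_mult[OF g ev(1,2)]])
  have CC: "C n \<otimes> C n = q \<odot> conjug (g [^] n) (C 0 \<otimes> C 0)"
    unfolding q_def by (rule evolvesD[OF evolves_mult[OF g ev(3,3)]])
  have "qpow h d * qpow h (- of_int n * \<eta>) = q * qpow h d0"
    unfolding q_def d by (simp flip: qpow_add add: algebra_simps)
  then have "qpow h d \<odot> X n = q \<odot> conjug (g [^] n) (qpow h d0 \<odot> X 0)"
    using car by (subst evolvesD[OF ev(4), of n]) (simp add: smult_simps conjug_smult)
  moreover have "qpow h c \<odot> (A n \<otimes> B n) = q \<odot> conjug (g [^] n) (qpow h c \<odot> (A 0 \<otimes> B 0))"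
    using car by (simp add: AB smult_simps conjug_smult mult.commute)
  ultimately show ?thesis
    unfolding rel CC using car by (simp add: smult_minus conjug_minus)
qed

section \<open>The opposite algebra and its two-step recursion\<close>

lemma opposite_simps [simp]:
  "carrier (opposite M) = carrier M" "smult (opposite M) = smult M"
  "one (opposite M) = one M" "zero (opposite M) = zero M" "add (opposite M) = add M"
  "x \<otimes>\<^bsub>opposite M\<^esub> y = y \<otimes> x" "a_minus (opposite M) = a_minus M"
  by (simp_all add: opposite_def a_minus_def[abs_def] a_inv_def)

lemma opposite_square [simp]:
  "x \<in> carrier M \<Longrightarrow> x [^]\<^bsub>opposite M\<^esub> (2::nat) = x \<otimes> x"
  by (simp add: nat_pow_def numeral_2_eq_2)

lemma q_rel_opposite:
  "Q a m \<in> carrier M \<Longrightarrow> q_rel h (opposite M) Q c a m d X \<longleftrightarrow>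
     qpow h c \<odot> (Q a (m - 1) \<otimes> Q a (m + 1)) = Q a m \<otimes> Q a m \<ominus> qpow h d \<odot> X"
  by (simp add: q_rel_def)

text \<open>Equal right-hand sides force equal products of the two outer terms. Agreement of one
  outer pair then gives agreement of the other by cancelling a unit on the left or on the right, so
  the recursion runs both ways in time.\<close>

lemma q_rel_opposite_determines:
  assumes "q_rel h (opposite M) Q c a m d X" "q_rel h (opposite M) R c a m d X"
    and "Q a m = R a m" "\<And>k. Q a k \<in> Units M" "\<And>k. R a k \<in> carrier M"
  shows "Q a (m - 1) = R a (m - 1) \<longleftrightarrow> Q a (m + 1) = R a (m + 1)"
proof -
  have "qpow h c \<odot> (Q a (m - 1) \<otimes> Q a (m + 1)) = qpow h c \<odot> (R a (m - 1) \<otimes> R a (m + 1))"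
    using assms by (simp add: q_rel_opposite)
  then have "Q a (m - 1) \<otimes> Q a (m + 1) = R a (m - 1) \<otimes> R a (m + 1)"
    by (rule smult_cancel) (use assms in auto)
  then show ?thesis using assms(4,5)
    by (metis Units_cancel Units_closed)
qed

end

section \<open>The completed quantum torus\<close>

lemma zero_fun_conv: "(\<lambda>_. 0) = 0"
  by (simp add: zero_fun_def)

lemma T_fun_mult: "T_fun h N u y t * T_fun h N u' y' t = T_fun h N (u + u') (y + y') t"
  by (simp add: T_fun_def of_rat_add distrib_right add_divide_distrib exp_add prod.distrib)

lemma T_fun_zero [simp]: "T_fun h N 0 0 = (\<lambda>_. 1)"
  by (simp add: T_fun_def)

lemma T_fun_nonzero [simp]: "T_fun h N u y t \<noteq> 0"
  by (simp add: T_fun_def)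

lemma T_funs_scaled_T_fun: "(\<lambda>t. c * T_fun h N u y t) \<in> T_funs h N"
  unfolding T_funs_def by (intro CollectI exI[of _ "{(u, y)}"] exI[of _ "\<lambda>_ _. c"]) simp

lemma T_funs_add:
  assumes "f \<in> T_funs h N" "g \<in> T_funs h N"
  shows "(\<lambda>t. f t + g t) \<in> T_funs h N"
proof -
  obtain S c where S: "finite S" "f = (\<lambda>t. \<Sum>(u, y)\<in>S. c u y * T_fun h N u y t)"
    using assms(1) by (auto simp: T_funs_def)
  obtain S' c' where S': "finite S'" "g = (\<lambda>t. \<Sum>(u, y)\<in>S'. c' u y * T_fun h N u y t)"
    using assms(2) by (auto simp: T_funs_def)
  have extend: "(\<Sum>(u, y)\<in>A. a u y * T_fun h N u y t) =
      (\<Sum>(u, y)\<in>S \<union> S'. (if (u, y) \<in> A then a u y else 0) * T_fun h N u y t)"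
    if "A \<subseteq> S \<union> S'" for A a t
    using that S(1) S'(1) by (intro sum.mono_neutral_cong_left) auto
  have "(\<lambda>t. f t + g t) = (\<lambda>t. \<Sum>(u, y)\<in>S \<union> S'.
      ((if (u, y) \<in> S then c u y else 0) + (if (u, y) \<in> S' then c' u y else 0)) * T_fun h N u y t)"
    unfolding S(2) S'(2) extend[of S, OF Un_upper1] extend[of S', OF Un_upper2]
    by (simp add: fun_eq_iff distrib_right sum.distrib case_prod_unfold)
  then show ?thesis
    unfolding T_funs_def using S(1) S'(1)
    by (intro CollectI exI[of _ "S \<union> S'"]
        exI[of _ "\<lambda>u y. (if (u, y) \<in> S then c u y else 0) + (if (u, y) \<in> S' then c' u y else 0)"]) simp
qed

lemma T_funs_zero: "(\<lambda>_. 0) \<in> T_funs h N"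
  using T_funs_scaled_T_fun[of 0] by simp

lemma T_funs_const: "(\<lambda>_. c) \<in> T_funs h N"
  using T_funs_scaled_T_fun[of c h N 0 0] by simp

lemma T_funs_sum:
  "(\<And>i. i \<in> I \<Longrightarrow> f i \<in> T_funs h N) \<Longrightarrow> (\<lambda>t. \<Sum>i\<in>I. f i t) \<in> T_funs h N"
  by (induction I rule: infinite_finite_induct) (auto simp: T_funs_zero intro: T_funs_add)

text \<open>Scaled generators and sums exhaust \<open>T_funs\<close>, which reduces closure under
  products and shifts to computations with single exponentials.\<close>

lemma T_funs_induct [consumes 1, case_names scaled add]:
  assumes "f \<in> T_funs h N"
    and scaled: "\<And>c u y. P (\<lambda>t. c * T_fun h N u y t)"
    and add: "\<And>f g. P f \<Longrightarrow> P g \<Longrightarrow> P (\<lambda>t. f t + g t)"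
  shows "P f"
proof -
  obtain S c where S: "finite S" "f = (\<lambda>t. \<Sum>(u, y)\<in>S. c u y * T_fun h N u y t)"
    using assms(1) by (auto simp: T_funs_def)
  have "P (\<lambda>t. \<Sum>p\<in>S. c (fst p) (snd p) * T_fun h N (fst p) (snd p) t)" using S(1)
  proof (induction S)
    case empty
    then show ?case using scaled[of 0] by simp
  next
    case (insert p S)
    then show ?case
      using add[OF scaled[of "c (fst p) (snd p)" "fst p" "snd p"] insert.IH] by simp
  qed
  then show ?thesis by (simp add: S(2) case_prod_unfold)
qed

lemma T_funs_mult:
  assumes "f \<in> T_funs h N" "g \<in> T_funs h N"
  shows "(\<lambda>t. f t * g t) \<in> T_funs h N"
  using assms(1)
proof (induction rule: T_funs_induct)
  case (scaled c u y)
  show ?case using assms(2)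
  proof (induction rule: T_funs_induct)
    case (scaled c' u' y')
    have "(\<lambda>t. c * T_fun h N u y t * (c' * T_fun h N u' y' t)) =
        (\<lambda>t. (c * c') * T_fun h N (u + u') (y + y') t)"
      by (simp add: fun_eq_iff flip: T_fun_mult)
    then show ?case by (simp only: T_funs_scaled_T_fun)
  next
    case (add f g)
    then show ?case by (auto simp: distrib_left dest: T_funs_add)
  qed
next
  case (add f g)
  then show ?case by (auto simp: distrib_right dest: T_funs_add)
qed

lemma T_funs_shift:
  assumes "h \<noteq> 0" "f \<in> T_funs h N"
  shows "(\<lambda>t. f (\<lambda>i. t i + of_rat (w i) * h)) \<in> T_funs h N"
  using assms(2)
proof (induction rule: T_funs_induct)
  case (scaled c u y)
  show ?case
    unfolding T_fun_shift[OF assms(1)]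
    using T_funs_scaled_T_fun[of "c * qpow h (dot N u w + y * dot N w w / 2)"] by (simp add: mult.assoc)
next
  case (add f g)
  then show ?case by (rule T_funs_add)
qed

text \<open>A linear functional that is at least \<open>1\<close> on every simple root; it bounds the multiplicities in a
  given nonnegative combination of simple roots, which makes all products finite sums.\<close>

definition level :: "nat \<Rightarrow> wt \<Rightarrow> rat" where
  "level N v = (\<Sum>j=1..N. (of_nat N + 1 - of_nat j) * v j)"

lemma level_add: "level N (v + w) = level N v + level N w"
  by (simp add: level_def distrib_left sum.distrib)

lemma level_diff: "level N (v - w) = level N v - level N w"
  by (simp add: level_def right_diff_distrib sum_subtractf)

lemma level_scale: "level N (\<lambda>j. c * v j) = c * level N v"
  by (simp add: level_def sum_distrib_left ac_simps)

lemma level_e_vec: "i \<in> {1..N} \<Longrightarrow> level N (e_vec i) = of_nat N + 1 - of_nat i"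
  by (simp add: level_def e_vec_def mult_delta_right sum.delta)

locale quantum_torus =
  fixes ty :: affine_type and N :: nat and h :: complex
  assumes adm: "admissible_rank ty N" and Re_h: "Re h < 0"
begin

definition M :: "(complex, qelt) module" where "M = qtorus h ty N"

abbreviation \<alpha> :: "nat \<Rightarrow> wt" where "\<alpha> \<equiv> simple_root (type_R_star ty) N"

lemma h_nonzero: "h \<noteq> 0"
  using Re_h by auto

lemma N_pos: "1 \<le> N"
  using adm by (cases ty) auto

text \<open>The weights N + 1 - j of \<open>level\<close> drop by 1 from one coordinate to the next
  and end at 1. So e_a - e_(a+1) has level 1, and the last root e_N, 2 e_N or e_(N-1) + e_N has
  level 1, 2 or 3.\<close>

lemma level_simple_root:
  assumes "a \<in> {1..N}" shows "level N (\<alpha> a) \<ge> 1"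
proof (cases "a < N")
  case True
  then have "\<alpha> a = e_vec a - e_vec (a + 1)"
    by (cases "type_R_star ty") (auto simp: fun_diff_def)
  then show ?thesis using assms True by (simp add: level_diff level_e_vec)
next
  case False
  then have [simp]: "a = N" using assms by simp
  have e: "level N (e_vec N) = 1" using N_pos by (simp add: level_e_vec)
  consider "\<alpha> N = e_vec N" | "\<alpha> N = (\<lambda>j. 2 * e_vec N j)"
    | "\<alpha> N = e_vec (N - 1) + e_vec N" "N \<ge> 2"
    using adm by (cases ty) (auto simp: plus_fun_def)
  then show ?thesis by cases (use N_pos in \<open>simp_all add: level_add level_scale e level_e_vec of_nat_diff\<close>)
qed

lemma simple_root_outside: "j \<notin> {1..N} \<Longrightarrow> a \<in> {1..N} \<Longrightarrow> \<alpha> a j = 0"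
  using adm N_pos by (cases ty) (auto simp: e_vec_def)

section \<open>Cones of weights and finiteness of decompositions\<close>

definition root_comb :: "(nat \<Rightarrow> nat) \<Rightarrow> wt" where
  "root_comb k = (\<lambda>j. \<Sum>i=1..N. of_nat (k i) * \<alpha> i j)"

lemma cone_conv: "cone ty N \<mu> = {\<mu> - root_comb k | k. True}"
  by (simp add: cone_def root_comb_def fun_diff_def)

lemma root_comb_add: "root_comb (\<lambda>i. k i + l i) = root_comb k + root_comb l"
  by (simp add: root_comb_def fun_eq_iff distrib_right sum.distrib)

lemma root_comb_cong: "(\<And>i. i \<in> {1..N} \<Longrightarrow> k i = l i) \<Longrightarrow> root_comb k = root_comb l"
  by (simp add: root_comb_def)

lemma root_comb_single: "a \<in> {1..N} \<Longrightarrow> root_comb (\<lambda>i. if i = a then n else 0) = (\<lambda>j. of_nat n * \<alpha> a j)"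
  by (simp add: root_comb_def fun_eq_iff if_distrib[of of_nat]
    if_distrib[of "\<lambda>x. x * _"] cong: if_cong)

lemma level_root_comb: "of_nat (\<Sum>i=1..N. k i) \<le> level N (root_comb k)"
proof -
  have "level N (root_comb k) = (\<Sum>i=1..N. of_nat (k i) * level N (\<alpha> i))"
    unfolding level_def root_comb_def sum_distrib_left
    by (subst sum.swap) (simp add: ac_simps)
  also have "\<dots> \<ge> (\<Sum>i=1..N. of_nat (k i) * 1)"
    by (intro sum_mono mult_left_mono level_simple_root) auto
  finally show ?thesis by simp
qed

text \<open>A bound on the sum bounds every multiplicity, and \<open>root_comb\<close> sees only the
  values on {1..N}; restricting k to that interval leaves finitely many functions.\<close>

lemma finite_root_combs: "finite (root_comb ` {k. of_nat (\<Sum>i=1..N. k i) \<le> (c::rat)})"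
proof (rule finite_subset)
  let ?B = "{1..N} \<rightarrow>\<^sub>E {..nat \<lfloor>c\<rfloor>}"
  show "finite (root_comb ` ?B)" by (intro finite_imageI finite_PiE) auto
  show "root_comb ` {k. of_nat (\<Sum>i=1..N. k i) \<le> c} \<subseteq> root_comb ` ?B"
  proof
    fix w assume "w \<in> root_comb ` {k. of_nat (\<Sum>i=1..N. k i) \<le> c}"
    then obtain k where k: "w = root_comb k" "of_nat (\<Sum>i=1..N. k i) \<le> c" by blast
    have "k i \<le> nat \<lfloor>c\<rfloor>" if "i \<in> {1..N}" for i
    proof -
      have "of_nat (k i) \<le> (of_nat (\<Sum>i=1..N. k i) :: rat)"
        using member_le_sum[OF that, of k] by (simp only: of_nat_le_iff) simp
      then have "of_nat (k i) \<le> c" using k(2) by linarith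
      then show ?thesis by linarith
    qed
    then have "restrict k {1..N} \<in> ?B" by auto
    moreover have "w = root_comb (restrict k {1..N})"
      unfolding k(1) by (rule root_comb_cong) simp
    ultimately show "w \<in> root_comb ` ?B" by blast
  qed
qed

text \<open>The support condition of \<open>qtorus_carrier\<close>, isolated for sets of weights so
  that it passes to unions and to sums of supports.\<close>

definition cone_bounded :: "wt set \<Rightarrow> bool" where
  "cone_bounded A \<longleftrightarrow> (\<exists>S. finite S \<and> (\<forall>\<mu>\<in>S. \<forall>j. j \<notin> {1..N} \<longrightarrow> \<mu> j = 0) \<and>
     A \<subseteq> (\<Union>\<mu>\<in>S. cone ty N \<mu>))"

lemma cone_bounded_subset: "cone_bounded B \<Longrightarrow> A \<subseteq> B \<Longrightarrow> cone_bounded A"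
  unfolding cone_bounded_def by (meson subset_trans)

lemma cone_bounded_Un:
  assumes "cone_bounded A" "cone_bounded B" shows "cone_bounded (A \<union> B)"
proof -
  from assms obtain S S' where "finite S" "\<forall>\<mu>\<in>S. \<forall>j. j \<notin> {1..N} \<longrightarrow> \<mu> j = 0" "A \<subseteq> (\<Union>\<mu>\<in>S. cone ty N \<mu>)"
    "finite S'" "\<forall>\<mu>\<in>S'. \<forall>j. j \<notin> {1..N} \<longrightarrow> \<mu> j = 0" "B \<subseteq> (\<Union>\<mu>\<in>S'. cone ty N \<mu>)"
    unfolding cone_bounded_def by metis
  then show ?thesis unfolding cone_bounded_def by (intro exI[of _ "S \<union> S'"]) auto
qed

lemma cone_bounded_sums:
  assumes "cone_bounded A" "cone_bounded B"
  shows "cone_bounded {a + b | a b. a \<in> A \<and> b \<in> B}"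
proof -
  from assms obtain S S' where S: "finite S" "\<forall>\<mu>\<in>S. \<forall>j. j \<notin> {1..N} \<longrightarrow> \<mu> j = 0" "A \<subseteq> (\<Union>\<mu>\<in>S. cone ty N \<mu>)"
    "finite S'" "\<forall>\<mu>\<in>S'. \<forall>j. j \<notin> {1..N} \<longrightarrow> \<mu> j = 0" "B \<subseteq> (\<Union>\<mu>\<in>S'. cone ty N \<mu>)"
    unfolding cone_bounded_def by metis
  let ?T = "(\<lambda>(\<mu>, \<nu>). \<mu> + \<nu>) ` (S \<times> S')"
  have "a + b \<in> (\<Union>\<mu>\<in>?T. cone ty N \<mu>)" if "a \<in> A" "b \<in> B" for a b
  proof -
    from that S(3,6) obtain \<mu> \<nu> k l where "\<mu> \<in> S" "\<nu> \<in> S'" "a = \<mu> - root_comb k" "b = \<nu> - root_comb l"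
      by (fastforce simp: cone_conv)
    moreover from this have "a + b = (\<mu> + \<nu>) - root_comb (\<lambda>i. k i + l i)"
      by (simp add: root_comb_add)
    ultimately show ?thesis unfolding cone_conv by blast
  qed
  then show ?thesis unfolding cone_bounded_def using S(1,2,4,5)
    by (intro exI[of _ ?T] conjI) auto
qed

text \<open>If v - w and w lie below \<mu> and \<nu> in their cones, the two root combinations add
  up to \<mu> + \<nu> - v, which does not depend on w. Its level bounds the combination belonging to
  w, leaving finitely many w. This is what makes the product of two infinite series a finite sum in
  each coefficient.\<close>

lemma finite_decompositions:
  assumes "cone_bounded A" "cone_bounded B"
  shows "finite {w. v - w \<in> A \<and> w \<in> B}"
proof -
  from assms obtain S S' where S: "finite S" "A \<subseteq> (\<Union>\<mu>\<in>S. cone ty N \<mu>)"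
    "finite S'" "B \<subseteq> (\<Union>\<mu>\<in>S'. cone ty N \<mu>)"
    unfolding cone_bounded_def by metis
  let ?F = "\<lambda>\<mu> \<nu>. (\<lambda>r. \<nu> - r) `
    root_comb ` {k. of_nat (\<Sum>i=1..N. k i) \<le> level N (\<mu> + \<nu> - v)}"
  have "w \<in> (\<Union>\<mu>\<in>S. \<Union>\<nu>\<in>S'. ?F \<mu> \<nu>)" if w: "v - w \<in> A" "w \<in> B" for w
  proof -
    from w S(2,4) obtain \<mu> \<nu> k l where m: "\<mu> \<in> S" "\<nu> \<in> S'" "v - w = \<mu> - root_comb k" "w = \<nu> - root_comb l"
      by (fastforce simp: cone_conv)
    have "root_comb k = \<mu> - (v - w)" using m(3) by simp
    then have "root_comb k + root_comb l = \<mu> + \<nu> - v" using m(4) by simp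
    then have "level N (root_comb k) + level N (root_comb l) = level N (\<mu> + \<nu> - v)"
      by (simp flip: level_add)
    moreover have "0 \<le> level N (root_comb k)"
      using level_root_comb[of k] by (rule order_trans[rotated]) (rule of_nat_0_le_iff)
    ultimately have "of_nat (\<Sum>i=1..N. l i) \<le> level N (\<mu> + \<nu> - v)"
      using level_root_comb[of l] by linarith
    then show ?thesis using m by blast
  qed
  then have "{w. v - w \<in> A \<and> w \<in> B} \<subseteq> (\<Union>\<mu>\<in>S. \<Union>\<nu>\<in>S'. ?F \<mu> \<nu>)" by blast
  then show ?thesis
    by (rule finite_subset) (intro finite_UN_I finite_imageI finite_root_combs S)
qed

section \<open>The ring structure of the completion\<close>

definition supp :: "qelt \<Rightarrow> wt set" where
  "supp F = {v. F v \<noteq> (\<lambda>_. 0)}"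

lemma not_in_supp: "v \<notin> supp F \<Longrightarrow> F v t = 0"
  by (simp add: supp_def)

lemma carrier_M: "F \<in> carrier M \<longleftrightarrow> (\<forall>v. F v \<in> T_funs h N) \<and> cone_bounded (supp F)"
  by (simp add: M_def qtorus_def qtorus_carrier_def cone_bounded_def supp_def)

lemma M_simps: "\<one>\<^bsub>M\<^esub> = (\<lambda>v t. if v = 0 then 1 else 0)" "\<zero>\<^bsub>M\<^esub> = (\<lambda>v t. 0)"
  "F \<oplus>\<^bsub>M\<^esub> G = (\<lambda>v t. F v t + G v t)" "c \<odot>\<^bsub>M\<^esub> F = (\<lambda>v t. c * F v t)"
  by (simp_all add: M_def qtorus_def zero_fun_def)

abbreviation (input) shift :: "(nat \<Rightarrow> complex) \<Rightarrow> wt \<Rightarrow> nat \<Rightarrow> complex" where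
  "shift t w \<equiv> \<lambda>i. t i + of_rat (w i) * h"

text \<open>Terms outside the supports vanish, so the index set of the product may be enlarged to
  any convenient finite set.\<close>

lemma mult_eq:
  assumes "finite W" "\<And>w. v - w \<in> supp F \<Longrightarrow> w \<in> supp G \<Longrightarrow> w \<in> W"
  shows "(F \<otimes>\<^bsub>M\<^esub> G) v t = (\<Sum>w\<in>W. F (v - w) (shift t w) * G w t)"
proof -
  have "(F \<otimes>\<^bsub>M\<^esub> G) v t =
      (\<Sum>w\<in>{w. v - w \<in> supp F \<and> w \<in> supp G}. F (v - w) (shift t w) * G w t)"
    unfolding M_def qtorus_def monoid.simps supp_def mem_Collect_eq fun_diff_def by (rule refl)
  also have "\<dots> = (\<Sum>w\<in>W. F (v - w) (shift t w) * G w t)"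
  proof (rule sum.mono_neutral_left[OF assms(1)])
    show "{w. v - w \<in> supp F \<and> w \<in> supp G} \<subseteq> W" using assms(2) by blast
    show "\<forall>w\<in>W - {w. v - w \<in> supp F \<and> w \<in> supp G}. F (v - w) (shift t w) * G w t = 0"
    proof
      fix w assume "w \<in> W - {w. v - w \<in> supp F \<and> w \<in> supp G}"
      then have "F (v - w) (shift t w) = 0 \<or> G w t = 0"
        using not_in_supp[of "v - w" F "shift t w"] not_in_supp[of w G t] by blast
      then show "F (v - w) (shift t w) * G w t = 0" by (simp only: mult_eq_0_iff)
    qed
  qed
  finally show ?thesis .
qed

lemma mult_eq_supp:
  assumes "F \<in> carrier M" "G \<in> carrier M"
  shows "(F \<otimes>\<^bsub>M\<^esub> G) v t =
    (\<Sum>w | v - w \<in> supp F \<and> w \<in> supp G. F (v - w) (shift t w) * G w t)"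
  using assms by (intro mult_eq) (auto simp: carrier_M finite_decompositions)

lemma supp_mult: "supp (F \<otimes>\<^bsub>M\<^esub> G) \<subseteq> {a + b | a b. a \<in> supp F \<and> b \<in> supp G}"
proof
  fix v assume v: "v \<in> supp (F \<otimes>\<^bsub>M\<^esub> G)"
  have "\<exists>w. v - w \<in> supp F \<and> w \<in> supp G"
  proof (rule ccontr)
    assume "\<not> ?thesis"
    then have "(F \<otimes>\<^bsub>M\<^esub> G) v t = 0" for t
      by (subst mult_eq[of "{}"]) auto
    then show False using v by (simp add: supp_def fun_eq_iff)
  qed
  then obtain w where w: "v - w \<in> supp F" "w \<in> supp G" by blast
  then show "v \<in> {a + b | a b. a \<in> supp F \<and> b \<in> supp G}"
    by (intro CollectI exI[of _ "v - w"] exI[of _ w]) simp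
qed

lemma mult_closed:
  assumes F: "F \<in> carrier M" and G: "G \<in> carrier M"
  shows "F \<otimes>\<^bsub>M\<^esub> G \<in> carrier M"
  unfolding carrier_M
proof
  show "\<forall>v. (F \<otimes>\<^bsub>M\<^esub> G) v \<in> T_funs h N"
    unfolding mult_eq_supp[OF F G, abs_def]
    using F G by (intro allI T_funs_sum T_funs_mult T_funs_shift h_nonzero) (auto simp: carrier_M)
  show "cone_bounded (supp (F \<otimes>\<^bsub>M\<^esub> G))"
    using F G by (intro cone_bounded_subset[OF cone_bounded_sums supp_mult]) (auto simp: carrier_M)
qed

lemma add_closed:
  assumes "F \<in> carrier M" "G \<in> carrier M"
  shows "F \<oplus>\<^bsub>M\<^esub> G \<in> carrier M"
proof -
  have "supp (F \<oplus>\<^bsub>M\<^esub> G) \<subseteq> supp F \<union> supp G"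
    by (auto simp: supp_def M_simps fun_eq_iff)
  then show ?thesis using assms
    by (auto simp: carrier_M M_simps intro: T_funs_add cone_bounded_subset[OF cone_bounded_Un])
qed

lemma smult_closed_M:
  assumes "F \<in> carrier M" shows "c \<odot>\<^bsub>M\<^esub> F \<in> carrier M"
proof -
  have "supp (c \<odot>\<^bsub>M\<^esub> F) \<subseteq> supp F"
    by (auto simp: supp_def M_simps fun_eq_iff)
  then show ?thesis using assms
    by (auto simp: carrier_M M_simps intro!: T_funs_mult T_funs_const intro: cone_bounded_subset)
qed

lemma cone_bounded_singleton:
  assumes "\<And>j. j \<notin> {1..N} \<Longrightarrow> v j = 0" shows "cone_bounded {v}"
proof -
  have "v - root_comb (\<lambda>_. 0) \<in> cone ty N v" unfolding cone_conv by blast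
  then have "v \<in> cone ty N v" by (simp add: root_comb_def fun_diff_def)
  then show ?thesis using assms unfolding cone_bounded_def by (intro exI[of _ "{v}"]) auto
qed

lemma one_closed_M: "\<one>\<^bsub>M\<^esub> \<in> carrier M"
proof -
  have "supp \<one>\<^bsub>M\<^esub> = {0}" by (auto simp: supp_def M_simps fun_eq_iff)
  then show ?thesis
    by (auto simp: carrier_M M_simps T_funs_const cone_bounded_singleton)
qed

text \<open>Both bracketings are finite sums over pairs of weights, matched by passing from the
  weights (w, u) of H and G to the weights (u + w, w) of G H and H. Two successive shifts of t
  compose to the shift by the sum, so the terms agree.\<close>

lemma mult_assoc_M:
  assumes F: "F \<in> carrier M" and G: "G \<in> carrier M" and H: "H \<in> carrier M"
  shows "F \<otimes>\<^bsub>M\<^esub> G \<otimes>\<^bsub>M\<^esub> H = F \<otimes>\<^bsub>M\<^esub> (G \<otimes>\<^bsub>M\<^esub> H)"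
proof (intro ext)
  fix v t
  have bnd: "cone_bounded (supp F)" "cone_bounded (supp G)" "cone_bounded (supp H)"
    using assms by (auto simp: carrier_M)
  define FG where "FG = {a + b | a b. a \<in> supp F \<and> b \<in> supp G}"
  define GH where "GH = {a + b | a b. a \<in> supp G \<and> b \<in> supp H}"
  define W where "W = {w. v - w \<in> FG \<and> w \<in> supp H}"
  define Z where "Z = {z. v - z \<in> supp F \<and> z \<in> GH}"
  define U where "U = (\<lambda>w. {u. v - w - u \<in> supp F \<and> u \<in> supp G})"
  define V where "V = (\<lambda>z. {w. z - w \<in> supp G \<and> w \<in> supp H})"
  have fin: "finite W" "finite Z" "finite (U w)" "finite (V z)" for w z
    unfolding W_def Z_def U_def V_def FG_def GH_def
    by (intro finite_decompositions cone_bounded_sums bnd)+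
  have "(F \<otimes>\<^bsub>M\<^esub> G \<otimes>\<^bsub>M\<^esub> H) v t = (\<Sum>w\<in>W. (F \<otimes>\<^bsub>M\<^esub> G) (v - w) (shift t w) * H w t)"
    \<comment> \<open>The index set uses all sums of supports instead of the support of F G, which
      may be smaller because of cancellation.\<close>
    by (rule mult_eq[OF fin(1)]) (use supp_mult[of F G] in \<open>auto simp: W_def FG_def\<close>)
  also have "\<dots> = (\<Sum>w\<in>W. \<Sum>u\<in>U w.
      F (v - w - u) (shift (shift t w) u) * G u (shift t w) * H w t)"
    unfolding U_def mult_eq_supp[OF F G] by (simp add: sum_distrib_right)
  also have "\<dots> = (\<Sum>(w, u)\<in>Sigma W U. F (v - w - u) (shift (shift t w) u) * G u (shift t w) * H w t)"
    using fin by (simp add: sum.Sigma)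
  also have "\<dots> = (\<Sum>(z, w)\<in>Sigma Z V. F (v - z) (shift t z) * (G (z - w) (shift t w) * H w t))"
  proof (rule sum.reindex_bij_witness[of _ "\<lambda>(z, w). (w, z - w)" "\<lambda>(w, u). (u + w, w)"])
    fix p assume "p \<in> Sigma W U"
    then obtain w u where p: "p = (w, u)" "w \<in> W" "u \<in> U w" by auto
    then have "v - (u + w) \<in> supp F" "u \<in> supp G" "w \<in> supp H"
      by (auto simp: U_def W_def algebra_simps)
    then show "(case p of (w, u) \<Rightarrow> (u + w, w)) \<in> Sigma Z V"
      by (auto simp: p Z_def V_def GH_def)
    have "shift (shift t w) u = shift t (u + w)"
      by (simp add: fun_eq_iff of_rat_add algebra_simps)
    moreover have "v - w - u = v - (u + w)" by (simp add: algebra_simps)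
    ultimately show "(case (case p of (w, u) \<Rightarrow> (u + w, w)) of (z, w) \<Rightarrow>
        F (v - z) (shift t z) * (G (z - w) (shift t w) * H w t)) =
      (case p of (w, u) \<Rightarrow> F (v - w - u) (shift (shift t w) u) * G u (shift t w) * H w t)"
      by (simp only: p(1) prod.case mult.assoc add_diff_cancel_right')
  next
    fix p assume "p \<in> Sigma Z V"
    then obtain z w where p: "p = (z, w)" "z \<in> Z" "w \<in> V z" by auto
    then have *: "v - z \<in> supp F" "z - w \<in> supp G" "w \<in> supp H"
      by (auto simp: V_def Z_def)
    have "v - w \<in> FG" unfolding FG_def
      by (intro CollectI exI[of _ "v - z"] exI[of _ "z - w"]) (simp add: *)
    then show "(case p of (z, w) \<Rightarrow> (w, z - w)) \<in> Sigma W U"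
      using * by (simp add: p(1) W_def U_def)
  qed auto
  also have "\<dots> = (\<Sum>z\<in>Z. \<Sum>w\<in>V z. F (v - z) (shift t z) * (G (z - w) (shift t w) * H w t))"
    using fin by (simp add: sum.Sigma)
  also have "\<dots> = (\<Sum>z\<in>Z. F (v - z) (shift t z) * (G \<otimes>\<^bsub>M\<^esub> H) z t)"
    unfolding V_def mult_eq_supp[OF G H] by (simp add: sum_distrib_left)
  also have "\<dots> = (F \<otimes>\<^bsub>M\<^esub> (G \<otimes>\<^bsub>M\<^esub> H)) v t"
    by (rule mult_eq[OF fin(2), symmetric]) (use supp_mult[of G H] in \<open>auto simp: Z_def GH_def\<close>)
  finally show "(F \<otimes>\<^bsub>M\<^esub> G \<otimes>\<^bsub>M\<^esub> H) v t = (F \<otimes>\<^bsub>M\<^esub> (G \<otimes>\<^bsub>M\<^esub> H)) v t" .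
qed

lemma mult_one_left:
  assumes "F \<in> carrier M" shows "\<one>\<^bsub>M\<^esub> \<otimes>\<^bsub>M\<^esub> F = F"
proof (intro ext)
  fix v t
  have "(\<one>\<^bsub>M\<^esub> \<otimes>\<^bsub>M\<^esub> F) v t = (\<Sum>w\<in>{v}. \<one>\<^bsub>M\<^esub> (v - w) (shift t w) * F w t)"
    by (rule mult_eq) (auto simp: supp_def M_simps fun_eq_iff split: if_splits)
  then show "(\<one>\<^bsub>M\<^esub> \<otimes>\<^bsub>M\<^esub> F) v t = F v t" by (simp add: M_simps)
qed

lemma mult_one_right:
  assumes "F \<in> carrier M" shows "F \<otimes>\<^bsub>M\<^esub> \<one>\<^bsub>M\<^esub> = F"
proof (intro ext)
  fix v t
  have "(F \<otimes>\<^bsub>M\<^esub> \<one>\<^bsub>M\<^esub>) v t = (\<Sum>w\<in>{0}. F (v - w) (shift t w) * \<one>\<^bsub>M\<^esub> w t)"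
    by (rule mult_eq) (auto simp: supp_def M_simps fun_eq_iff split: if_splits)
  then show "(F \<otimes>\<^bsub>M\<^esub> \<one>\<^bsub>M\<^esub>) v t = F v t" by (simp add: M_simps)
qed

lemma mult_add_left:
  assumes "F \<in> carrier M" "G \<in> carrier M" "H \<in> carrier M"
  shows "(F \<oplus>\<^bsub>M\<^esub> G) \<otimes>\<^bsub>M\<^esub> H = F \<otimes>\<^bsub>M\<^esub> H \<oplus>\<^bsub>M\<^esub> G \<otimes>\<^bsub>M\<^esub> H"
proof (intro ext)
  fix v t
  let ?W = "{w. v - w \<in> supp F \<union> supp G \<and> w \<in> supp H}"
  have W: "finite ?W"
    using assms by (intro finite_decompositions cone_bounded_Un) (auto simp: carrier_M)
  have "supp (F \<oplus>\<^bsub>M\<^esub> G) \<subseteq> supp F \<union> supp G"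
    by (auto simp: supp_def M_simps fun_eq_iff)
  then have *: "((F \<oplus>\<^bsub>M\<^esub> G) \<otimes>\<^bsub>M\<^esub> H) v t = (\<Sum>w\<in>?W. (F \<oplus>\<^bsub>M\<^esub> G) (v - w) (shift t w) * H w t)"
    by (intro mult_eq W) auto
  show "((F \<oplus>\<^bsub>M\<^esub> G) \<otimes>\<^bsub>M\<^esub> H) v t = (F \<otimes>\<^bsub>M\<^esub> H \<oplus>\<^bsub>M\<^esub> G \<otimes>\<^bsub>M\<^esub> H) v t"
    unfolding * by (simp add: M_simps mult_eq[OF W] distrib_right sum.distrib)
qed

lemma mult_add_right:
  assumes "F \<in> carrier M" "G \<in> carrier M" "H \<in> carrier M"
  shows "H \<otimes>\<^bsub>M\<^esub> (F \<oplus>\<^bsub>M\<^esub> G) = H \<otimes>\<^bsub>M\<^esub> F \<oplus>\<^bsub>M\<^esub> H \<otimes>\<^bsub>M\<^esub> G"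
proof (intro ext)
  fix v t
  let ?W = "{w. v - w \<in> supp H \<and> w \<in> supp F \<union> supp G}"
  have W: "finite ?W"
    using assms by (intro finite_decompositions cone_bounded_Un) (auto simp: carrier_M)
  have "supp (F \<oplus>\<^bsub>M\<^esub> G) \<subseteq> supp F \<union> supp G"
    by (auto simp: supp_def M_simps fun_eq_iff)
  then have *: "(H \<otimes>\<^bsub>M\<^esub> (F \<oplus>\<^bsub>M\<^esub> G)) v t = (\<Sum>w\<in>?W. H (v - w) (shift t w) * (F \<oplus>\<^bsub>M\<^esub> G) w t)"
    by (intro mult_eq W) auto
  show "(H \<otimes>\<^bsub>M\<^esub> (F \<oplus>\<^bsub>M\<^esub> G)) v t = (H \<otimes>\<^bsub>M\<^esub> F \<oplus>\<^bsub>M\<^esub> H \<otimes>\<^bsub>M\<^esub> G) v t"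
    unfolding * by (simp add: M_simps mult_eq[OF W] distrib_left sum.distrib)
qed

lemma smult_mult_M:
  assumes F: "F \<in> carrier M" and G: "G \<in> carrier M"
  shows "(c \<odot>\<^bsub>M\<^esub> F) \<otimes>\<^bsub>M\<^esub> G = c \<odot>\<^bsub>M\<^esub> (F \<otimes>\<^bsub>M\<^esub> G)" (is ?left)
    and "F \<otimes>\<^bsub>M\<^esub> (c \<odot>\<^bsub>M\<^esub> G) = c \<odot>\<^bsub>M\<^esub> (F \<otimes>\<^bsub>M\<^esub> G)" (is ?right)
proof -
  have supp: "supp (c \<odot>\<^bsub>M\<^esub> H) \<subseteq> supp H" for H
    by (auto simp: supp_def M_simps fun_eq_iff)
  have W: "finite {w. v - w \<in> supp F \<and> w \<in> supp G}" for v
    using assms by (intro finite_decompositions) (auto simp: carrier_M)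
  show ?left
  proof (intro ext)
    fix v t
    show "((c \<odot>\<^bsub>M\<^esub> F) \<otimes>\<^bsub>M\<^esub> G) v t = (c \<odot>\<^bsub>M\<^esub> (F \<otimes>\<^bsub>M\<^esub> G)) v t"
      using supp[of F] by (subst mult_eq[OF W])
        (auto simp: M_simps mult_eq_supp[OF F G] sum_distrib_left mult.assoc)
  qed
  show ?right
  proof (intro ext)
    fix v t
    show "(F \<otimes>\<^bsub>M\<^esub> (c \<odot>\<^bsub>M\<^esub> G)) v t = (c \<odot>\<^bsub>M\<^esub> (F \<otimes>\<^bsub>M\<^esub> G)) v t"
      using supp[of G] by (subst mult_eq[OF W])
        (auto simp: M_simps mult_eq_supp[OF F G] sum_distrib_left mult.left_commute)
  qed
qed

lemma ring_M: "ring M"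
proof (intro ringI abelian_groupI monoid.intro)
  fix F assume F: "F \<in> carrier M"
  show "\<exists>G\<in>carrier M. G \<oplus>\<^bsub>M\<^esub> F = \<zero>\<^bsub>M\<^esub>"
    using smult_closed_M[OF F, of "-1"]
    by (intro bexI[of _ "(-1) \<odot>\<^bsub>M\<^esub> F"]) (simp_all add: M_simps)
next
  show "\<zero>\<^bsub>M\<^esub> \<in> carrier M"
    using smult_closed_M[OF one_closed_M, of 0] by (simp add: M_simps)
qed (simp_all add: add_closed mult_closed mult_assoc_M mult_one_left mult_one_right
      mult_add_left mult_add_right one_closed_M, simp_all add: M_simps ac_simps)

sublocale M: complex_algebra M
proof (rule complex_algebra.intro[OF ring_M], unfold_locales)
qed (simp_all add: smult_closed_M smult_mult_M, simp_all add: M_simps distrib_left mult.assoc)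

end

section \<open>Monomials and q-Pochhammer symbols\<close>

definition qpoch_fps_fin :: "complex \<Rightarrow> complex \<Rightarrow> nat \<Rightarrow> complex fps" where
  "qpoch_fps_fin c p m = (\<Prod>j<m. 1 - fps_const (c * p ^ j) * fps_X)"

text \<open>X stands for the single monomial substituted later; the coefficientwise limit mirrors
  the one in \<open>qpoch\<close>.\<close>

definition qpoch_fps :: "complex \<Rightarrow> complex \<Rightarrow> complex fps" where
  "qpoch_fps c p = Abs_fps (\<lambda>k. lim (\<lambda>m. fps_nth (qpoch_fps_fin c p m) k))"

lemma qpoch_fps_fin_Suc_nth:
  "fps_nth (qpoch_fps_fin c p (Suc m)) k = fps_nth (qpoch_fps_fin c p m) k -
     c * p ^ m * (if k = 0 then 0 else fps_nth (qpoch_fps_fin c p m) (k - 1))"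
proof -
  have "qpoch_fps_fin c p (Suc m) = qpoch_fps_fin c p m -
      fps_const (c * p ^ m) * (qpoch_fps_fin c p m * fps_X)"
    by (simp only: qpoch_fps_fin_def prod.lessThan_Suc) (simp add: left_diff_distrib ac_simps)
  then show ?thesis by (simp only: fps_sub_nth fps_mult_left_const_nth fps_X_mult_right_nth)
qed

text \<open>Appending the factor number m changes coefficient k + 1 by - c p^m times coefficient k.
  The latter is bounded in m by the induction hypothesis, so the increments are dominated by a
  geometric series.\<close>

lemma qpoch_fps_fin_convergent:
  assumes "norm p < 1"
  shows "convergent (\<lambda>m. fps_nth (qpoch_fps_fin c p m) k)"
proof (induction k)
  case 0
  have "fps_nth (qpoch_fps_fin c p m) 0 = 1" for m
    by (induction m) (simp_all add: qpoch_fps_fin_Suc_nth, simp add: qpoch_fps_fin_def)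
  then show ?case by (simp add: convergent_const)
next
  case (Suc k)
  let ?a = "\<lambda>m. fps_nth (qpoch_fps_fin c p m) (Suc k)"
  from convergent_imp_Bseq[OF Suc] obtain B where B: "norm (fps_nth (qpoch_fps_fin c p m) k) \<le> B" for m
    by (auto simp: Bseq_def)
  have "norm (?a (Suc m) - ?a m) \<le> norm c * B * norm p ^ m" for m
    using mult_left_mono[OF B[of m], of "norm c * norm p ^ m"]
    by (simp add: qpoch_fps_fin_Suc_nth norm_mult norm_power ac_simps)
  then have "summable (\<lambda>m. ?a (Suc m) - ?a m)"
  proof (rule summable_comparison_test'[where N = 0, rotated])
    show "summable (\<lambda>m. norm c * B * norm p ^ m)"
      using assms by (intro summable_mult summable_geometric) simp
  qed
  then have "convergent (\<lambda>m. \<Sum>i<m. ?a (Suc i) - ?a i)"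
    by (simp add: summable_iff_convergent)
  then have "convergent (\<lambda>m. ?a m - ?a 0)"
    by (simp only: sum_lessThan_telescope[of ?a])
  then have "convergent (\<lambda>m. ?a m - ?a 0 + ?a 0)"
    by (intro convergent_add convergent_const)
  then show ?case by simp
qed

lemma qpoch_fps_LIMSEQ:
  "norm p < 1 \<Longrightarrow> (\<lambda>m. fps_nth (qpoch_fps_fin c p m) k) \<longlonglongrightarrow> fps_nth (qpoch_fps c p) k"
  using qpoch_fps_fin_convergent[of p c k] by (simp add: qpoch_fps_def convergent_LIMSEQ_iff)

lemma qpoch_fps_fin_scale:
  "fps_nth (qpoch_fps_fin (c * s) p m) k = s ^ k * fps_nth (qpoch_fps_fin c p m) k"
proof (induction m arbitrary: k)
  case 0
  then show ?case by (cases k) (simp_all add: qpoch_fps_fin_def)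
next
  case (Suc m)
  then show ?case
    by (cases k) (simp_all add: qpoch_fps_fin_Suc_nth right_diff_distrib ac_simps)
qed

lemma qpoch_fps_scale:
  assumes "norm p < 1"
  shows "qpoch_fps (c * s) p = Abs_fps (\<lambda>k. s ^ k * fps_nth (qpoch_fps c p) k)"
proof (rule fps_ext)
  fix k
  have "(\<lambda>m. s ^ k * fps_nth (qpoch_fps_fin c p m) k) \<longlonglongrightarrow> s ^ k * fps_nth (qpoch_fps c p) k"
    by (intro tendsto_mult_left qpoch_fps_LIMSEQ assms)
  then show "fps_nth (qpoch_fps (c * s) p) k = fps_nth (Abs_fps (\<lambda>k. s ^ k * fps_nth (qpoch_fps c p) k)) k"
    using LIMSEQ_unique[OF qpoch_fps_LIMSEQ[OF assms, of "c * s" k]]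
    by (simp add: qpoch_fps_fin_scale)
qed

text \<open>Splitting off the first factor of the finite product turns m + 1 factors in c into m
  factors in c p; both sides converge coefficientwise.\<close>

lemma qpoch_fps_functional_equation:
  assumes "norm p < 1"
  shows "qpoch_fps c p = (1 - fps_const c * fps_X) * qpoch_fps (c * p) p"
proof (rule fps_ext)
  fix k
  have nth: "fps_nth ((1 - fps_const c * fps_X) * f) k =
      fps_nth f k - c * (if k = 0 then 0 else fps_nth f (k - 1))" for f
    by (cases k) (simp_all add: left_diff_distrib mult.assoc)
  have "qpoch_fps_fin c p (Suc m) = (1 - fps_const c * fps_X) * qpoch_fps_fin (c * p) p m" for m
    unfolding qpoch_fps_fin_def prod.lessThan_Suc_shift by (simp add: mult.assoc)
  moreover have "(\<lambda>m. fps_nth ((1 - fps_const c * fps_X) * qpoch_fps_fin (c * p) p m) k) \<longlonglongrightarrow>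
      fps_nth ((1 - fps_const c * fps_X) * qpoch_fps (c * p) p) k"
    unfolding nth by (cases "k = 0") (auto intro!: tendsto_intros qpoch_fps_LIMSEQ[OF assms])
  ultimately have "(\<lambda>m. fps_nth (qpoch_fps_fin c p (Suc m)) k) \<longlonglongrightarrow>
      fps_nth ((1 - fps_const c * fps_X) * qpoch_fps (c * p) p) k"
    by simp
  then show "fps_nth (qpoch_fps c p) k = fps_nth ((1 - fps_const c * fps_X) * qpoch_fps (c * p) p) k"
    using LIMSEQ_Suc[OF qpoch_fps_LIMSEQ[OF assms, of c k]] by (intro LIMSEQ_unique)
qed

lemma qpoch_fps_nth_0 [simp]: "norm p < 1 \<Longrightarrow> fps_nth (qpoch_fps c p) 0 = 1"
proof -
  have "fps_nth (qpoch_fps_fin c p m) 0 = 1" for m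
    by (induction m) (simp_all add: qpoch_fps_fin_Suc_nth, simp add: qpoch_fps_fin_def)
  then show ?thesis by (simp add: qpoch_fps_def)
qed

lemma dot_add_left: "dot N (u + v) w = dot N u w + dot N v w"
  and dot_add_right: "dot N w (u + v) = dot N w u + dot N w v"
  and dot_diff_left: "dot N (u - v) w = dot N u w - dot N v w"
  and dot_diff_right: "dot N w (u - v) = dot N w u - dot N w v"
  and dot_uminus_right: "dot N w (- u) = - dot N w u"
  and dot_scale_left: "dot N (\<lambda>j. c * u j) w = c * dot N u w"
  and dot_scale_right: "dot N w (\<lambda>j. c * u j) = c * dot N w u"
  and dot_commute: "dot N u w = dot N w u"
  and dot_zero_left [simp]: "dot N 0 w = 0"
  and dot_zero_right [simp]: "dot N w 0 = 0"
  by (simp_all add: dot_def distrib_left distrib_right sum.distrib left_diff_distrib right_diff_distrib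
      sum_subtractf sum_distrib_left ac_simps sum_negf)

context quantum_torus
begin

section \<open>Monomials in \<Lambda>, T and g_T\<close>

abbreviation mon :: "wt \<Rightarrow> wt \<Rightarrow> rat \<Rightarrow> qelt" where "mon \<equiv> monom_elt h N"
abbreviation Lam :: "wt \<Rightarrow> qelt" where "Lam \<equiv> Lam_pow h N"
abbreviation Tp :: "wt \<Rightarrow> qelt" where "Tp \<equiv> T_pow h N"
abbreviation gT :: "rat \<Rightarrow> qelt" where "gT \<equiv> gT_pow h N"

definition weights :: "wt set" where
  "weights = {v. \<forall>j. j \<notin> {1..N} \<longrightarrow> v j = 0}"

lemma weights_closed [simp]:
  "0 \<in> weights" "v \<in> weights \<Longrightarrow> w \<in> weights \<Longrightarrow> v + w \<in> weights"
  "v \<in> weights \<Longrightarrow> w \<in> weights \<Longrightarrow> v - w \<in> weights"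
  "v \<in> weights \<Longrightarrow> - v \<in> weights" "v \<in> weights \<Longrightarrow> (\<lambda>j. c * v j) \<in> weights"
  by (auto simp: weights_def)

lemma simple_root_weights [simp]: "a \<in> {1..N} \<Longrightarrow> \<alpha> a \<in> weights"
  unfolding weights_def mem_Collect_eq by (metis simple_root_outside)

lemma supp_mon: "supp (mon v u y) = {v}"
proof -
  have "T_fun h N u y \<noteq> (\<lambda>_. 0)"
    by (metis T_fun_nonzero)
  then show ?thesis by (auto simp: supp_def monom_elt_def)
qed

lemma mon_closed [simp]:
  assumes "v \<in> weights" shows "mon v u y \<in> carrier M"
proof -
  have "mon v u y w \<in> T_funs h N" for w
    using T_funs_scaled_T_fun[of 1 h N u y] by (cases "w = v") (simp_all add: monom_elt_def T_funs_zero)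
  moreover have "cone_bounded {v}"
    using assms unfolding weights_def by (intro cone_bounded_singleton) blast
  ultimately show ?thesis by (simp add: carrier_M supp_mon)
qed

text \<open>The normal order is \<Lambda>, T, g_T. Moving T^u g_T^y past \<Lambda>^w costs the power
  of q shown and leaves T^(y w) behind. The commutation rules below are instances.\<close>

lemma mon_mult:
  "mon v u y \<otimes>\<^bsub>M\<^esub> mon w x z = qpow h (dot N u w + y * dot N w w / 2) \<odot>\<^bsub>M\<^esub>
     mon (v + w) (u + (\<lambda>j. y * w j) + x) (y + z)"
proof (intro ext)
  fix s t
  have "(mon v u y \<otimes>\<^bsub>M\<^esub> mon w x z) s t =
      (\<Sum>r\<in>{w}. mon v u y (s - r) (\<lambda>i. t i + of_rat (r i) * h) * mon w x z r t)"
    by (rule mult_eq) (auto simp: supp_mon)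
  also have "\<dots> = (if s = v + w then qpow h (dot N u w + y * dot N w w / 2) *
      (T_fun h N (u + (\<lambda>j. y * w j)) y t * T_fun h N x z t) else 0)"
    by (simp add: monom_elt_def T_fun_shift[OF h_nonzero] plus_fun_def diff_eq_eq[of s w v, unfolded plus_fun_def])
  also have "\<dots> = (qpow h (dot N u w + y * dot N w w / 2) \<odot>\<^bsub>M\<^esub>
     mon (v + w) (u + (\<lambda>j. y * w j) + x) (y + z)) s t"
    unfolding T_fun_mult by (simp add: M_simps monom_elt_def)
  finally show "(mon v u y \<otimes>\<^bsub>M\<^esub> mon w x z) s t = (qpow h (dot N u w + y * dot N w w / 2) \<odot>\<^bsub>M\<^esub>
     mon (v + w) (u + (\<lambda>j. y * w j) + x) (y + z)) s t" .
qed

lemma mon_defs: "Lam v = mon v 0 0" "Tp u = mon 0 u 0" "gT y = mon 0 0 y"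
  by (simp_all add: Lam_pow_def T_pow_def gT_pow_def zero_fun_def)

lemma one_mon: "\<one>\<^bsub>M\<^esub> = mon 0 0 0"
  by (simp add: M_simps monom_elt_def fun_eq_iff)

lemma zero_wt [simp]: "(\<lambda>j::nat. 0::rat) = 0"
  by (rule zero_fun_conv)

lemma Lam_closed [simp]: "v \<in> weights \<Longrightarrow> Lam v \<in> carrier M"
  and Tp_closed [simp]: "Tp u \<in> carrier M"
  and gT_closed [simp]: "gT y \<in> carrier M"
  by (simp_all add: mon_defs)

lemma Lam_zero: "Lam 0 = \<one>\<^bsub>M\<^esub>" and Tp_zero: "Tp 0 = \<one>\<^bsub>M\<^esub>"
  by (simp_all add: mon_defs one_mon)

lemma Lam_mult: "v \<in> weights \<Longrightarrow> w \<in> weights \<Longrightarrow> Lam v \<otimes>\<^bsub>M\<^esub> Lam w = Lam (v + w)"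
  and Tp_mult: "Tp u \<otimes>\<^bsub>M\<^esub> Tp x = Tp (u + x)"
  and gT_mult: "gT y \<otimes>\<^bsub>M\<^esub> gT z = gT (y + z)"
  and Lam_Tp: "v \<in> weights \<Longrightarrow> Lam v \<otimes>\<^bsub>M\<^esub> Tp u = mon v u 0"
  by (simp_all add: mon_defs mon_mult)

lemma Tp_Lam: "v \<in> weights \<Longrightarrow> Tp u \<otimes>\<^bsub>M\<^esub> Lam v = qpow h (dot N u v) \<odot>\<^bsub>M\<^esub> (Lam v \<otimes>\<^bsub>M\<^esub> Tp u)"
  by (simp add: mon_defs mon_mult)

lemma gT_Tp: "gT y \<otimes>\<^bsub>M\<^esub> Tp u = Tp u \<otimes>\<^bsub>M\<^esub> gT y"
  by (simp add: mon_defs mon_mult)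

lemma gT_Lam: "v \<in> weights \<Longrightarrow> gT y \<otimes>\<^bsub>M\<^esub> Lam v =
    (qpow h (y * dot N v v / 2) \<odot>\<^bsub>M\<^esub> (Lam v \<otimes>\<^bsub>M\<^esub> Tp (\<lambda>j. y * v j))) \<otimes>\<^bsub>M\<^esub> gT y"
  by (simp add: mon_defs mon_mult M.smult_simps)

lemma M_UnitsI: "x \<in> carrier M \<Longrightarrow> y \<in> carrier M \<Longrightarrow> x \<otimes>\<^bsub>M\<^esub> y = \<one>\<^bsub>M\<^esub> \<Longrightarrow> y \<otimes>\<^bsub>M\<^esub> x = \<one>\<^bsub>M\<^esub> \<Longrightarrow> x \<in> Units M"
  unfolding Units_def by blast

lemma Lam_Units [simp]: "v \<in> weights \<Longrightarrow> Lam v \<in> Units M"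
  by (rule M_UnitsI[of _ "Lam (- v)"]) (simp_all add: Lam_mult Lam_zero)

lemma Tp_Units [simp]: "Tp u \<in> Units M"
  by (rule M_UnitsI[of _ "Tp (- u)"]) (simp_all add: Tp_mult Tp_zero)

lemma gT_Units [simp]: "gT y \<in> Units M"
  by (rule M_UnitsI[of _ "gT (- y)"]) (simp_all add: gT_mult, simp_all add: mon_defs one_mon)

section \<open>The commutative subalgebra of series in \<Lambda> alone\<close>

definition const_elts :: "qelt set" where
  "const_elts = {F \<in> carrier M. \<forall>v t t'. F v t = F v t'}"

lemma const_elts_closed: "F \<in> const_elts \<Longrightarrow> F \<in> carrier M"
  by (simp add: const_elts_def)

lemma const_elts_eq: "F \<in> const_elts \<Longrightarrow> F v t = F v t'"
  unfolding const_elts_def by blast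

text \<open>Coefficients that do not depend on t do not feel the shift in the product, and the
  remaining convolution is symmetric under exchanging w and v - w.\<close>

lemma const_elts_commute:
  assumes "F \<in> const_elts" "G \<in> const_elts"
  shows "F \<otimes>\<^bsub>M\<^esub> G = G \<otimes>\<^bsub>M\<^esub> F"
proof (intro ext)
  fix v t
  have "(F \<otimes>\<^bsub>M\<^esub> G) v t = (\<Sum>w | v - w \<in> supp F \<and> w \<in> supp G. F (v - w) t * G w t)"
    using assms by (auto simp: mult_eq_supp const_elts_closed intro!: sum.cong intro: const_elts_eq)
  also have "\<dots> = (\<Sum>w | v - w \<in> supp G \<and> w \<in> supp F. G (v - w) t * F w t)"
    by (rule sum.reindex_bij_witness[of _ "\<lambda>w. v - w" "\<lambda>w. v - w"]) auto
  also have "\<dots> = (G \<otimes>\<^bsub>M\<^esub> F) v t"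
    using assms by (auto simp: mult_eq_supp const_elts_closed intro!: sum.cong intro: const_elts_eq)
  finally show "(F \<otimes>\<^bsub>M\<^esub> G) v t = (G \<otimes>\<^bsub>M\<^esub> F) v t" .
qed

lemma const_elts_mult [simp]:
  assumes "F \<in> const_elts" "G \<in> const_elts"
  shows "F \<otimes>\<^bsub>M\<^esub> G \<in> const_elts"
  unfolding const_elts_def
proof (intro CollectI conjI allI)
  show "F \<otimes>\<^bsub>M\<^esub> G \<in> carrier M" using assms by (simp add: const_elts_closed)
  fix v t t'
  show "(F \<otimes>\<^bsub>M\<^esub> G) v t = (F \<otimes>\<^bsub>M\<^esub> G) v t'"
    using assms by (auto simp: mult_eq_supp const_elts_closed intro!: sum.cong arg_cong2[of _ _ _ _ "(*)"]
        intro: const_elts_eq)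
qed

lemma Lam_const_elts [simp]: "v \<in> weights \<Longrightarrow> Lam v \<in> const_elts"
  using mon_closed[of v 0 0] by (auto simp: const_elts_def mon_defs) (simp add: monom_elt_def)

lemma one_const_elts [simp]: "\<one>\<^bsub>M\<^esub> \<in> const_elts"
  using Lam_const_elts[of 0] by (simp add: Lam_zero)

text \<open>The power series f evaluated at X = \<Lambda>^(- \<alpha> a). For a label in {1..N} at
  most one k contributes; the sum avoids having to select it and is 0 when there is none.\<close>

definition ser :: "nat \<Rightarrow> complex fps \<Rightarrow> qelt" where
  "ser a f = (\<lambda>v t. \<Sum>k | v = (\<lambda>j. - of_nat k * \<alpha> a j). fps_nth f k)"

text \<open>A simple root has positive level, so distinct multiples have distinct levels.\<close>

lemma root_multiple_inject:
  assumes "a \<in> {1..N}"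
  shows "(\<lambda>j. - of_nat k * \<alpha> a j) = (\<lambda>j. - of_nat l * \<alpha> a j) \<longleftrightarrow> k = l"
proof
  assume "(\<lambda>j. - of_nat k * \<alpha> a j) = (\<lambda>j. - of_nat l * \<alpha> a j)"
  then have "level N (\<lambda>j. - of_nat k * \<alpha> a j) = level N (\<lambda>j. - of_nat l * \<alpha> a j)" by simp
  then show "k = l" using level_simple_root[OF assms] unfolding level_scale by simp
qed simp

lemma ser_at: "a \<in> {1..N} \<Longrightarrow> ser a f (\<lambda>j. - of_nat k * \<alpha> a j) t = fps_nth f k"
  unfolding ser_def root_multiple_inject by simp

lemma ser_off: "v \<notin> range (\<lambda>k j. - of_nat k * \<alpha> a j) \<Longrightarrow> ser a f v t = 0"
  unfolding ser_def by (rule sum.neutral) auto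

lemma ser_const: "ser a f v t = ser a f v t'"
  by (simp add: ser_def)

lemma supp_ser: "supp (ser a f) \<subseteq> range (\<lambda>k j. - of_nat k * \<alpha> a j)"
  unfolding supp_def using ser_off[of _ a f] by blast

lemma ser_const_elts [simp]:
  assumes a: "a \<in> {1..N}"
  shows "ser a f \<in> const_elts"
proof -
  have "(\<lambda>j. - of_nat k * \<alpha> a j) \<in> cone ty N 0" for k
  proof -
    have "(\<lambda>j. - of_nat k * \<alpha> a j) = 0 - root_comb (\<lambda>i. if i = a then k else 0)"
      unfolding root_comb_single[OF a] by (simp add: fun_eq_iff)
    then show ?thesis unfolding cone_conv by blast
  qed
  then have "cone_bounded (supp (ser a f))"
    unfolding cone_bounded_def using supp_ser[of a f] by (intro exI[of _ "{0}"]) auto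
  moreover have "ser a f v \<in> T_funs h N" for v
    using T_funs_const unfolding ser_def .
  ultimately show ?thesis
    unfolding const_elts_def carrier_M using ser_const by blast
qed

lemma ser_closed [simp]: "a \<in> {1..N} \<Longrightarrow> ser a f \<in> carrier M"
  by (rule const_elts_closed) (rule ser_const_elts)

lemma ser_eqI:
  assumes "a \<in> {1..N}"
    and on: "\<And>k t. F (\<lambda>j. - of_nat k * \<alpha> a j) t = fps_nth f k"
    and off: "\<And>v t. v \<notin> range (\<lambda>k j. - of_nat k * \<alpha> a j) \<Longrightarrow> F v t = 0"
  shows "F = ser a f"
proof (intro ext)
  fix v t
  show "F v t = ser a f v t"
  proof (cases "v \<in> range (\<lambda>k j. - of_nat k * \<alpha> a j)")
    case True
    then obtain k where "v = (\<lambda>j. - of_nat k * \<alpha> a j)" by blast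
    then show ?thesis using on ser_at[OF assms(1)] by simp
  next
    case False
    then show ?thesis using off ser_off by simp
  qed
qed

text \<open>Decomposing - n \<alpha> a into two elements of the supports amounts to writing n = k +
  l, so the product of the torus becomes the Cauchy product. Thus \<open>ser a\<close> transports
  multiplicative identities from formal power series to the torus.\<close>

lemma ser_mult:
  assumes a: "a \<in> {1..N}"
  shows "ser a f \<otimes>\<^bsub>M\<^esub> ser a g = ser a (f * g)"
proof (rule ser_eqI[OF a])
  let ?p = "\<lambda>k::nat. \<lambda>j. - of_nat k * \<alpha> a j"
  have p_add: "?p k + ?p l = ?p (k + l)" for k l
    by (simp add: fun_eq_iff algebra_simps)
  {
    fix v t assume v: "v \<notin> range ?p"
    have "(ser a f \<otimes>\<^bsub>M\<^esub> ser a g) v t = (\<Sum>w\<in>{}. ser a f (v - w) (\<lambda>i. t i + of_rat (w i) * h) * ser a g w t)"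
    proof (rule mult_eq)
      fix w assume "v - w \<in> supp (ser a f)" "w \<in> supp (ser a g)"
      then obtain k l where "v - w = ?p k" "w = ?p l" using supp_ser by blast
      then have "v = ?p (k + l)" using p_add[of k l] by (metis diff_add_cancel)
      then show "w \<in> {}" using v by blast
    qed simp
    then show "(ser a f \<otimes>\<^bsub>M\<^esub> ser a g) v t = 0" by simp
  }
  fix n t
  have diff: "?p n - ?p l = ?p (n - l)" if "l \<le> n" for l
    using that by (simp add: fun_eq_iff of_nat_diff algebra_simps)
  have "(ser a f \<otimes>\<^bsub>M\<^esub> ser a g) (?p n) t =
      (\<Sum>w\<in>?p ` {..n}. ser a f (?p n - w) (\<lambda>i. t i + of_rat (w i) * h) * ser a g w t)"
  proof (rule mult_eq)
    fix w assume "?p n - w \<in> supp (ser a f)" "w \<in> supp (ser a g)"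
    then obtain k l where kl: "?p n - w = ?p k" "w = ?p l" using supp_ser by blast
    then have "?p n = ?p (k + l)" using p_add[of k l] by (metis diff_add_cancel)
    then have "n = k + l" using root_multiple_inject[OF a] by blast
    then show "w \<in> ?p ` {..n}" using kl(2) by auto
  qed simp
  also have "\<dots> = (\<Sum>l\<le>n. ser a f (?p n - ?p l) (\<lambda>i. t i + of_rat (?p l i) * h) * ser a g (?p l) t)"
    by (rule sum.reindex_cong[OF _ refl refl]) (rule inj_onI, simp only: root_multiple_inject[OF a])
  also have "\<dots> = (\<Sum>l\<le>n. fps_nth f (n - l) * fps_nth g l)"
    by (intro sum.cong refl) (simp only: diff ser_at[OF a] atMost_iff)
  also have "\<dots> = fps_nth (g * f) n"
    unfolding fps_mult_nth atLeast0AtMost by (rule sum.cong) (simp_all add: mult.commute)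
  finally show "(ser a f \<otimes>\<^bsub>M\<^esub> ser a g) (?p n) t = fps_nth (f * g) n"
    by (simp add: mult.commute)
qed

lemma ser_one:
  assumes a: "a \<in> {1..N}" shows "\<one>\<^bsub>M\<^esub> = ser a 1"
proof (rule ser_eqI[OF a])
  have p0: "0 = (\<lambda>j. - of_nat 0 * \<alpha> a j)" by (simp add: fun_eq_iff)
  {
    fix k t
    show "\<one>\<^bsub>M\<^esub> (\<lambda>j. - of_nat k * \<alpha> a j) t = fps_nth 1 k"
      unfolding M_simps p0 root_multiple_inject[OF a] fps_one_nth ..
  next
    fix v t assume "v \<notin> range (\<lambda>k j. - of_nat k * \<alpha> a j)"
    then have "v \<noteq> 0" unfolding p0 by blast
    then show "\<one>\<^bsub>M\<^esub> v t = 0" by (simp only: M_simps if_False)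
  }
qed

lemma ser_X:
  assumes a: "a \<in> {1..N}" shows "c \<odot>\<^bsub>M\<^esub> Lam (- \<alpha> a) = ser a (fps_const c * fps_X)"
proof (rule ser_eqI[OF a])
  have p1: "- \<alpha> a = (\<lambda>j. - of_nat 1 * \<alpha> a j)" by (simp add: fun_eq_iff)
  {
    fix k t
    show "(c \<odot>\<^bsub>M\<^esub> Lam (- \<alpha> a)) (\<lambda>j. - of_nat k * \<alpha> a j) t = fps_nth (fps_const c * fps_X) k"
      unfolding M_simps mon_defs monom_elt_def p1 root_multiple_inject[OF a] by (simp add: fps_X_def)
  next
    fix v t assume "v \<notin> range (\<lambda>k j. - of_nat k * \<alpha> a j)"
    then have "v \<noteq> - \<alpha> a" unfolding p1 by blast
    then show "(c \<odot>\<^bsub>M\<^esub> Lam (- \<alpha> a)) v t = 0" by (simp add: M_simps mon_defs monom_elt_def)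
  }
qed

lemma ser_diff:
  assumes a: "a \<in> {1..N}" shows "ser a f \<ominus>\<^bsub>M\<^esub> ser a g = ser a (f - g)"
proof -
  have "ser a f = ser a (f - g) \<oplus>\<^bsub>M\<^esub> ser a g"
    by (simp add: ser_def M_simps sum.distrib[symmetric])
  then show ?thesis using a
    by (simp add: a_minus_def M.a_assoc M.r_neg)
qed

lemma one_minus_ser:
  "a \<in> {1..N} \<Longrightarrow> \<one>\<^bsub>M\<^esub> \<ominus>\<^bsub>M\<^esub> c \<odot>\<^bsub>M\<^esub> Lam (- \<alpha> a) = ser a (1 - fps_const c * fps_X)"
  by (metis ser_one ser_X ser_diff)

text \<open>Invertibility is inherited from formal power series, where a nonzero constant term
  suffices. This makes the inverse Pochhammer factors of \<open>g\<close> genuine elements of the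
  completion.\<close>

lemma ser_inverse:
  assumes a: "a \<in> {1..N}" and f: "fps_nth f 0 \<noteq> 0"
  shows "ser a f \<in> Units M" "inv\<^bsub>M\<^esub> (ser a f) = ser a (inverse f)"
proof -
  have "f * inverse f = 1" "inverse f * f = 1"
    using f by (simp_all add: inverse_mult_eq_1 inverse_mult_eq_1')
  then have inv: "ser a f \<otimes>\<^bsub>M\<^esub> ser a (inverse f) = \<one>\<^bsub>M\<^esub>" "ser a (inverse f) \<otimes>\<^bsub>M\<^esub> ser a f = \<one>\<^bsub>M\<^esub>"
    using a by (simp_all add: ser_mult ser_one)
  then show "ser a f \<in> Units M"
    using a by (intro M_UnitsI[of _ "ser a (inverse f)"]) auto
  show "inv\<^bsub>M\<^esub> (ser a f) = ser a (inverse f)"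
    using inv a by (intro M.inv_char) auto
qed

lemma qpoch_fin_ser:
  assumes a: "a \<in> {1..N}"
  shows "qpoch_fin M (c \<odot>\<^bsub>M\<^esub> Lam (- \<alpha> a)) p m = ser a (qpoch_fps_fin c p m)"
proof (induction m)
  case 0
  then show ?case using a by (simp add: qpoch_fps_fin_def ser_one)
next
  case (Suc m)
  have "qpoch_fin M (c \<odot>\<^bsub>M\<^esub> Lam (- \<alpha> a)) p (Suc m) = ser a (qpoch_fps_fin c p m) \<otimes>\<^bsub>M\<^esub>
      (\<one>\<^bsub>M\<^esub> \<ominus>\<^bsub>M\<^esub> (c * p ^ m) \<odot>\<^bsub>M\<^esub> Lam (- \<alpha> a))"
    using a by (simp add: Suc M.smult_simps mult.commute)
  also have "\<dots> = ser a (qpoch_fps_fin c p (Suc m))"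
    unfolding one_minus_ser[OF a] ser_mult[OF a] by (simp add: qpoch_fps_fin_def)
  finally show ?case .
qed

lemma qpoch_ser:
  assumes a: "a \<in> {1..N}"
  shows "qpoch M (c \<odot>\<^bsub>M\<^esub> Lam (- \<alpha> a)) p = ser a (qpoch_fps c p)"
  by (rule ser_eqI[OF a])
    (simp_all add: qpoch_def qpoch_fin_ser[OF a] ser_at[OF a, simplified] ser_off qpoch_fps_def)

text \<open>Moving T^u to the left through \<Lambda>^(- k \<alpha> a) multiplies by q^(k u \<cdot>
  \<alpha> a), which is the substitution X -> q^(u \<cdot> \<alpha> a) X in the power
  series.\<close>

lemma ser_Tp:
  assumes a: "a \<in> {1..N}"
  shows "ser a f \<otimes>\<^bsub>M\<^esub> Tp u =
    Tp u \<otimes>\<^bsub>M\<^esub> ser a (Abs_fps (\<lambda>k. qpow h (dot N u (\<alpha> a)) ^ k * fps_nth f k))"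
proof (intro ext)
  let ?g = "Abs_fps (\<lambda>k. qpow h (dot N u (\<alpha> a)) ^ k * fps_nth f k)"
  fix v t
  have "(ser a f \<otimes>\<^bsub>M\<^esub> Tp u) v t = (\<Sum>w\<in>{0}. ser a f (v - w) (\<lambda>i. t i + of_rat (w i) * h) * Tp u w t)"
    by (rule mult_eq) (auto simp: mon_defs supp_mon)
  then have left: "(ser a f \<otimes>\<^bsub>M\<^esub> Tp u) v t = ser a f v t * T_fun h N u 0 t"
    by (simp add: mon_defs monom_elt_def)
  have "(Tp u \<otimes>\<^bsub>M\<^esub> ser a ?g) v t = (\<Sum>w\<in>{v}. Tp u (v - w) (\<lambda>i. t i + of_rat (w i) * h) * ser a ?g w t)"
    by (rule mult_eq) (auto simp: mon_defs supp_mon)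
  then have right: "(Tp u \<otimes>\<^bsub>M\<^esub> ser a ?g) v t = qpow h (dot N u v) * T_fun h N u 0 t * ser a ?g v t"
    by (simp add: mon_defs monom_elt_def T_fun_shift[OF h_nonzero])
  show "(ser a f \<otimes>\<^bsub>M\<^esub> Tp u) v t = (Tp u \<otimes>\<^bsub>M\<^esub> ser a ?g) v t"
  proof (cases "v \<in> range (\<lambda>k j. - of_nat k * \<alpha> a j)")
    case True
    then obtain k where v: "v = (\<lambda>j. - of_nat k * \<alpha> a j)" by blast
    have "qpow h (dot N u v) * qpow h (dot N u (\<alpha> a)) ^ k = 1"
    proof -
      have "qpow h (dot N u (\<alpha> a)) ^ k = qpow h (of_nat k * dot N u (\<alpha> a))"
        by (induction k) (simp_all add: distrib_right qpow_add)
      then show ?thesis unfolding v dot_scale_right by (simp flip: qpow_add)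
    qed
    then show ?thesis unfolding left right by (simp add: v ser_at[OF a, simplified])
  next
    case False
    then show ?thesis unfolding left right by (simp add: ser_off)
  qed
qed

definition inv_qpoch :: "nat \<Rightarrow> complex \<Rightarrow> complex \<Rightarrow> qelt" where
  "inv_qpoch a c p = inv\<^bsub>M\<^esub> (qpoch M (c \<odot>\<^bsub>M\<^esub> Lam (- \<alpha> a)) p)"

lemma inv_qpoch_ser:
  assumes "a \<in> {1..N}" "norm p < 1"
  shows "inv_qpoch a c p = ser a (inverse (qpoch_fps c p))"
  using assms by (simp add: inv_qpoch_def qpoch_ser ser_inverse)

lemma inv_qpoch_closed [simp]:
  assumes "a \<in> {1..N}" "norm p < 1"
  shows "inv_qpoch a c p \<in> Units M" "inv_qpoch a c p \<in> const_elts"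
  using assms by (simp_all add: inv_qpoch_ser ser_inverse)

text \<open>\<open>T\<^sup>u\<close> rescales the argument of each \<open>q\<close>-Pochhammer factor of \<open>C\<close>; \<open>f\<close> collects the linear
  factors \<open>1 - x\<close> split off by \<open>(x; p)\<^sub>\<infinity> = (1 - x) (p x; p)\<^sub>\<infinity>\<close>.\<close>

definition twist :: "qelt \<Rightarrow> wt \<Rightarrow> qelt \<Rightarrow> bool" where
  "twist C u f \<longleftrightarrow> C \<in> const_elts \<and> f \<in> const_elts \<and> C \<in> Units M \<and>
     C \<otimes>\<^bsub>M\<^esub> Tp u = Tp u \<otimes>\<^bsub>M\<^esub> (f \<otimes>\<^bsub>M\<^esub> C)"

lemma twist_inv_qpoch_trivial:
  assumes "a \<in> {1..N}" "norm p < 1" "dot N u (\<alpha> a) = 0"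
  shows "twist (inv_qpoch a c p) u \<one>\<^bsub>M\<^esub>"
  using assms unfolding twist_def by (simp add: inv_qpoch_ser ser_inverse ser_Tp fps_nth_inverse)

text \<open>The base p is chosen to equal q^(u \<cdot> \<alpha> a). The substitution X -> p X then
  turns 1/(c X; p) into 1/(c p X; p), and the functional equation says that the two differ by
  exactly the factor 1 - c X.\<close>

lemma twist_inv_qpoch:
  assumes a: "a \<in> {1..N}" and p: "norm p < 1" "qpow h (dot N u (\<alpha> a)) = p"
  shows "twist (inv_qpoch a c p) u (\<one>\<^bsub>M\<^esub> \<ominus>\<^bsub>M\<^esub> c \<odot>\<^bsub>M\<^esub> Lam (- \<alpha> a))"
proof -
  let ?E = "qpoch_fps c p" and ?X = "1 - fps_const c * fps_X"
  \<comment> \<open>Rescaling the coefficients is written as a composition because composition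
    commutes with inverses.\<close>
  have comp: "Abs_fps (\<lambda>k. p ^ k * fps_nth g k) = fps_compose g (fps_const p * fps_X)" for g :: "complex fps"
    by (simp add: fps_compose_linear)
  have "Abs_fps (\<lambda>k. p ^ k * fps_nth (inverse ?E) k) = inverse (qpoch_fps (c * p) p)"
    unfolding qpoch_fps_scale[OF p(1)] comp
    by (rule fps_inverse_compose) (use p(1) in simp_all)
  also have "\<dots> = ?X * inverse ?E"
  proof -
    have "?X * inverse ?E = ?X * inverse ?X * inverse (qpoch_fps (c * p) p)"
      unfolding qpoch_fps_functional_equation[OF p(1), of c] fps_inverse_mult by (simp only: mult.assoc)
    then show ?thesis by (simp add: inverse_mult_eq_1')
  qed
  finally have "ser a (inverse ?E) \<otimes>\<^bsub>M\<^esub> Tp u = Tp u \<otimes>\<^bsub>M\<^esub> (ser a ?X \<otimes>\<^bsub>M\<^esub> ser a (inverse ?E))"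
    unfolding ser_Tp[OF a] p(2) ser_mult[OF a] by simp
  then show ?thesis
    using a p(1) by (simp add: twist_def one_minus_ser inv_qpoch_ser ser_inverse)
qed

text \<open>The factor split off by D has to pass C, which it does because both are series in
  \<Lambda> alone.\<close>

lemma twist_mult:
  assumes "twist C u f" "twist D u g"
  shows "twist (C \<otimes>\<^bsub>M\<^esub> D) u (f \<otimes>\<^bsub>M\<^esub> g)"
proof -
  have const: "C \<in> const_elts" "D \<in> const_elts" "f \<in> const_elts" "g \<in> const_elts"
    using assms by (auto simp: twist_def)
  then have car: "C \<in> carrier M" "D \<in> carrier M" "f \<in> carrier M" "g \<in> carrier M"
    by (auto intro: const_elts_closed)
  have "C \<otimes>\<^bsub>M\<^esub> D \<otimes>\<^bsub>M\<^esub> Tp u = (C \<otimes>\<^bsub>M\<^esub> Tp u) \<otimes>\<^bsub>M\<^esub> (g \<otimes>\<^bsub>M\<^esub> D)"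
    using assms(2) car by (simp add: twist_def M.m_assoc)
  also have "\<dots> = Tp u \<otimes>\<^bsub>M\<^esub> (f \<otimes>\<^bsub>M\<^esub> ((C \<otimes>\<^bsub>M\<^esub> g) \<otimes>\<^bsub>M\<^esub> D))"
    using assms(1) car by (simp add: twist_def M.m_assoc)
  also have "C \<otimes>\<^bsub>M\<^esub> g = g \<otimes>\<^bsub>M\<^esub> C"
    using const by (intro const_elts_commute)
  finally show ?thesis
    using assms car const by (simp add: twist_def M.m_assoc)
qed

section \<open>Solving the Q-system by conjugation\<close>

abbreviation \<omega> :: "nat \<Rightarrow> wt" where "\<omega> \<equiv> omega ty N"
abbreviation \<omega>s :: "nat \<Rightarrow> wt" where "\<omega>s \<equiv> omega_star ty N"
abbreviation L :: "nat \<Rightarrow> qelt" where "L a \<equiv> Lam (\<omega>s a)"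
abbreviation LT :: "nat \<Rightarrow> qelt" where "LT a \<equiv> Lam (\<omega>s a) \<otimes>\<^bsub>M\<^esub> Tp (\<omega> a)"
abbreviation \<kappa> :: "nat \<Rightarrow> rat" where "\<kappa> a \<equiv> Lam_num ty N a a"
abbreviation g :: qelt where "g \<equiv> g_elt ty h N"

lemma fund_wt_weights [simp]: "a \<le> N \<Longrightarrow> fund_wt X N a \<in> weights"
  using N_pos by (cases X) (auto simp: weights_def e_sum_def e_vec_def)

text \<open>The hypotheses of \<open>step_relation\<close> for L = \<Lambda>^z and T = T^u. The
  scalar q^(z \<cdot> u / 2) is the square root of the factor in T^u \<Lambda>^z = q^(z \<cdot> u)
  \<Lambda>^z T^u. For z = \<omega>s a and u = \<omega> a its exponent is \<kappa> a / 2, which is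
  the normalisation in the theorem.\<close>

definition advances :: "qelt \<Rightarrow> wt \<Rightarrow> wt \<Rightarrow> qelt \<Rightarrow> bool" where
  "advances S z u x \<longleftrightarrow> S \<in> Units M \<and> z \<in> weights \<and> x \<in> const_elts \<and>
     M.conjug S (Lam z) = qpow h (dot N z u / 2) \<odot>\<^bsub>M\<^esub> (Lam z \<otimes>\<^bsub>M\<^esub> Tp u) \<and>
     S \<otimes>\<^bsub>M\<^esub> Tp u = Tp u \<otimes>\<^bsub>M\<^esub> S \<otimes>\<^bsub>M\<^esub> (\<one>\<^bsub>M\<^esub> \<ominus>\<^bsub>M\<^esub> x)"

lemma advancesD:
  assumes "advances S z u x"
  shows "S \<in> Units M" "S \<in> carrier M" "z \<in> weights" "x \<in> const_elts" "x \<in> carrier M"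
    "M.conjug S (Lam z) = qpow h (dot N z u / 2) \<odot>\<^bsub>M\<^esub> (Lam z \<otimes>\<^bsub>M\<^esub> Tp u)"
    "S \<otimes>\<^bsub>M\<^esub> Tp u = Tp u \<otimes>\<^bsub>M\<^esub> S \<otimes>\<^bsub>M\<^esub> (\<one>\<^bsub>M\<^esub> \<ominus>\<^bsub>M\<^esub> x)"
  using assms by (auto simp: advances_def const_elts_closed)

lemma twistD:
  assumes "twist C u f"
  shows "C \<in> const_elts" "C \<in> carrier M" "C \<in> Units M" "f \<in> const_elts" "f \<in> carrier M"
    "C \<otimes>\<^bsub>M\<^esub> Tp u = Tp u \<otimes>\<^bsub>M\<^esub> (f \<otimes>\<^bsub>M\<^esub> C)"
  using assms by (auto simp: twist_def const_elts_closed)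

lemma conjug_const_elts:
  assumes "C \<in> const_elts" "C \<in> Units M" "F \<in> const_elts"
  shows "M.conjug C F = F"
  using assms by (intro M.conjug_commute const_elts_commute) (auto intro: const_elts_closed)

text \<open>The two tasks are divided: A moves \<Lambda>^z and commutes with T^u, while C commutes
  with \<Lambda>^z and supplies the factor 1 - x.\<close>

lemma advances_mult:
  assumes A: "A \<in> Units M" "A \<otimes>\<^bsub>M\<^esub> Tp u = Tp u \<otimes>\<^bsub>M\<^esub> A"
      "M.conjug A (Lam z) = qpow h (dot N z u / 2) \<odot>\<^bsub>M\<^esub> (Lam z \<otimes>\<^bsub>M\<^esub> Tp u)"
    and z: "z \<in> weights" and x: "x \<in> const_elts"
    and C: "twist C u (\<one>\<^bsub>M\<^esub> \<ominus>\<^bsub>M\<^esub> x)"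
  shows "advances (A \<otimes>\<^bsub>M\<^esub> C) z u x"
proof -
  note [simp] = twistD(2,3,5)[OF C] const_elts_closed[OF x] M.Units_closed[OF A(1)]
  have "A \<otimes>\<^bsub>M\<^esub> C \<otimes>\<^bsub>M\<^esub> Tp u = A \<otimes>\<^bsub>M\<^esub> Tp u \<otimes>\<^bsub>M\<^esub> ((\<one>\<^bsub>M\<^esub> \<ominus>\<^bsub>M\<^esub> x) \<otimes>\<^bsub>M\<^esub> C)"
    by (simp add: M.m_assoc twistD(6)[OF C])
  also have "(\<one>\<^bsub>M\<^esub> \<ominus>\<^bsub>M\<^esub> x) \<otimes>\<^bsub>M\<^esub> C = C \<otimes>\<^bsub>M\<^esub> (\<one>\<^bsub>M\<^esub> \<ominus>\<^bsub>M\<^esub> x)"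
    using twistD[OF C] by (intro const_elts_commute)
  finally show ?thesis
    using A z x conjug_const_elts[OF twistD(1,3)[OF C]]
    by (simp add: advances_def M.conjug_conjug M.m_assoc)
qed

text \<open>The evolution equation at time 0. The rescaled conjugate by the inverse of S is the
  value at time -1, and \<Lambda>^z T^u is the value at time 1.\<close>

lemma advances_relation:
  assumes S: "advances S z u x"
  shows "qpow h (dot N z u) \<odot>\<^bsub>M\<^esub> ((qpow h (dot N z u / 2) \<odot>\<^bsub>M\<^esub> M.conjug (inv\<^bsub>M\<^esub> S) (Lam z)) \<otimes>\<^bsub>M\<^esub>
      (Lam z \<otimes>\<^bsub>M\<^esub> Tp u)) = Lam z \<otimes>\<^bsub>M\<^esub> Lam z \<ominus>\<^bsub>M\<^esub> Lam z \<otimes>\<^bsub>M\<^esub> Lam z \<otimes>\<^bsub>M\<^esub> x"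
proof -
  note [simp] = advancesD(1-5)[OF S]
  let ?c = "qpow h (dot N z u / 2)"
  have cc: "?c * ?c = qpow h (dot N z u)" by (rule qpow_mult_eqI) simp
  have "(?c * ?c * ?c) \<odot>\<^bsub>M\<^esub> (M.conjug (inv\<^bsub>M\<^esub> S) (Lam z) \<otimes>\<^bsub>M\<^esub> (Lam z \<otimes>\<^bsub>M\<^esub> Tp u)) =
      Lam z \<otimes>\<^bsub>M\<^esub> Lam z \<ominus>\<^bsub>M\<^esub> Lam z \<otimes>\<^bsub>M\<^esub> Lam z \<otimes>\<^bsub>M\<^esub> x"
  proof (rule M.step_relation)
    show "Tp u \<otimes>\<^bsub>M\<^esub> Lam z = (?c * ?c) \<odot>\<^bsub>M\<^esub> (Lam z \<otimes>\<^bsub>M\<^esub> Tp u)"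
      unfolding cc unfolding dot_commute[of N z u] by (rule Tp_Lam) simp
    show "x \<otimes>\<^bsub>M\<^esub> Lam z = Lam z \<otimes>\<^bsub>M\<^esub> x"
      by (rule const_elts_commute) simp_all
  qed (use advancesD[OF S] in simp_all)
  then show ?thesis by (simp add: M.smult_simps flip: cc)
qed

text \<open>The candidate solution. For a short label one period covers two time steps, and rounding
  down in \<open>m div 2\<close> leaves remainder 0 or 1 for negative m as well, so parity selects
  the initial datum.\<close>

definition Dsol :: "nat \<Rightarrow> int \<Rightarrow> qelt" where
  "Dsol a m = (if short ty N a
     then qpow h (- of_int (m div 2) * \<kappa> a) \<odot>\<^bsub>M\<^esub>
       M.conjug (g [^]\<^bsub>M\<^esub> (m div 2)) (if even m then L a else LT a)
     else qpow h (- of_int m * (\<kappa> a / 2)) \<odot>\<^bsub>M\<^esub> M.conjug (g [^]\<^bsub>M\<^esub> m) (L a))"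

text \<open>In every admissible type label 0 falls into the branch of an empty sum of unit vectors,
  so the convention that Q at label 0 is 1 obeys the general formulas.\<close>

lemma fund_wt_0: "\<omega> 0 = 0" "\<omega>s 0 = 0" "\<kappa> 0 = 0"
proof -
  show "\<omega> 0 = 0" "\<omega>s 0 = 0"
    using adm by (cases ty; auto simp: e_sum_def fun_eq_iff)+
  then show "\<kappa> 0 = 0" by (simp add: Lam_num_def)
qed

context
  assumes gU: "g \<in> Units M"
begin

lemma gpow_Units [simp]: "g [^]\<^bsub>M\<^esub> (n::int) \<in> Units M"
  by (rule M.Units_int_pow_closed[OF gU])

lemma conjug_gpow_add:
  "y \<in> carrier M \<Longrightarrow> M.conjug (g [^]\<^bsub>M\<^esub> (m + n :: int)) y = M.conjug (g [^]\<^bsub>M\<^esub> m) (M.conjug (g [^]\<^bsub>M\<^esub> n) y)"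
  by (simp add: M.Units_int_pow_mult[OF gU] M.conjug_conjug)

lemma Dsol_Units: "a \<le> N \<Longrightarrow> Dsol a m \<in> Units M"
  unfolding Dsol_def by (auto intro!: M.smult_Units M.conjug_Units)

lemma Dsol_closed: "a \<le> N \<Longrightarrow> Dsol a m \<in> carrier M"
  by (rule M.Units_closed) (rule Dsol_Units)

lemma Dsol_0_label: "Dsol 0 m = \<one>\<^bsub>M\<^esub>"
  by (simp add: Dsol_def fund_wt_0 Lam_zero Tp_zero)

lemma Dsol_at_0: "a \<le> N \<Longrightarrow> Dsol a 0 = L a"
  by (simp add: Dsol_def)

text \<open>Label 0 carries the constant sequence 1 with rate 0. It may therefore stand next to long
  or short labels alike, which explains the alternative a = 0 here and in the short case.\<close>

lemma Dsol_long_evolves: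
  assumes "a \<le> N" "\<not> short ty N a \<or> a = 0"
  shows "M.evolves h g (\<kappa> a / 2) (\<lambda>n. Dsol a (n + i))"
proof (cases "a = 0")
  case True
  then show ?thesis by (simp add: Dsol_0_label fund_wt_0 M.evolves_one gU)
next
  case False
  with assms have s: "\<not> short ty N a" by simp
  have "Dsol a (n + i) = qpow h (- of_int n * (\<kappa> a / 2)) \<odot>\<^bsub>M\<^esub> M.conjug (g [^]\<^bsub>M\<^esub> n) (Dsol a (0 + i))" for n
  proof -
    have "qpow h (- of_int n * (\<kappa> a / 2)) * qpow h (- of_int i * (\<kappa> a / 2)) = qpow h (- of_int (n + i) * (\<kappa> a / 2))"
      by (rule qpow_mult_eqI) (simp add: algebra_simps)
    then show ?thesis
      using assms(1) s by (simp add: Dsol_def conjug_gpow_add M.conjug_smult M.smult_simps)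
  qed
  then show ?thesis using Dsol_closed[OF assms(1)] unfolding M.evolves_def by blast
qed

lemma Dsol_short_evolves:
  assumes "a \<le> N" "short ty N a \<or> a = 0"
  shows "M.evolves h g (\<kappa> a) (\<lambda>n. Dsol a (2 * n + i))"
proof (cases "a = 0")
  case True
  then show ?thesis by (simp add: Dsol_0_label fund_wt_0 M.evolves_one gU)
next
  case False
  with assms have s: "short ty N a" by simp
  have "Dsol a (2 * n + i) = qpow h (- of_int n * \<kappa> a) \<odot>\<^bsub>M\<^esub> M.conjug (g [^]\<^bsub>M\<^esub> n) (Dsol a (2 * 0 + i))" for n
  proof -
    have "qpow h (- of_int n * \<kappa> a) * qpow h (- of_int (i div 2) * \<kappa> a) = qpow h (- of_int (n + i div 2) * \<kappa> a)"
      by (rule qpow_mult_eqI) (simp add: algebra_simps)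
    moreover have "(2 * n + i) div 2 = n + i div 2" by simp
    ultimately show ?thesis
      using assms(1) s by (simp add: Dsol_def conjug_gpow_add M.conjug_smult M.smult_simps)
  qed
  then show ?thesis using Dsol_closed[OF assms(1)] unfolding M.evolves_def by blast
qed

lemma Dsol_evolves:
  assumes "a \<le> N"
  shows "M.evolves h g (\<kappa> a * of_int (t_lab ty N a) / 2) (\<lambda>n. Dsol a (t_lab ty N a * n + i))"
  using Dsol_long_evolves[OF assms, of i] Dsol_short_evolves[OF assms, of i]
  by (cases "short ty N a") (simp_all add: t_lab_def)

lemma Dsol_formula_long:
  assumes "a \<le> N" "\<not> short ty N a"
  shows "Dsol a n = qpow h (- (of_int n / 2) * \<kappa> a) \<odot>\<^bsub>M\<^esub>
    (g [^]\<^bsub>M\<^esub> n \<otimes>\<^bsub>M\<^esub> Dsol a 0 \<otimes>\<^bsub>M\<^esub> g [^]\<^bsub>M\<^esub> (- n))"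
  using assms unfolding Dsol_at_0[OF assms(1)]
  by (simp add: Dsol_def M.conjug_def M.Units_int_pow_neg[OF gU])

lemma Dsol_formula_short:
  assumes "a \<le> N" "short ty N a"
  shows "Dsol a (2 * n + i) = qpow h (- of_int n * \<kappa> a) \<odot>\<^bsub>M\<^esub>
    (g [^]\<^bsub>M\<^esub> n \<otimes>\<^bsub>M\<^esub> Dsol a i \<otimes>\<^bsub>M\<^esub> g [^]\<^bsub>M\<^esub> (- n))"
  using M.evolvesD[OF Dsol_short_evolves[of a i], of n] assms
  by (simp add: M.conjug_def M.Units_int_pow_neg[OF gU])

text \<open>For a long label \<open>g\<close> is a single time step, and the normalisation of
  \<open>Dsol\<close> cancels the scalar produced by \<open>advances\<close>. Hence time 1 has the
  prescribed initial value.\<close>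

lemma long_relation:
  assumes a: "a \<in> {1..N}" "\<not> short ty N a" and S: "advances g (\<omega>s a) (\<omega> a) x"
  shows "Dsol a 1 = LT a"
    and "qpow h (\<kappa> a) \<odot>\<^bsub>M\<^esub> (Dsol a (-1) \<otimes>\<^bsub>M\<^esub> Dsol a 1) =
      Dsol a 0 \<otimes>\<^bsub>M\<^esub> Dsol a 0 \<ominus>\<^bsub>M\<^esub> L a \<otimes>\<^bsub>M\<^esub> L a \<otimes>\<^bsub>M\<^esub> x"
proof -
  have car: "L a \<in> carrier M" "LT a \<in> carrier M" using a by simp_all
  have "qpow h (- (\<kappa> a / 2)) * qpow h (\<kappa> a / 2) = 1" by (simp flip: qpow_add)
  then show D1: "Dsol a 1 = LT a"
    using a car advancesD(6)[OF S]
    by (simp add: Dsol_def M.Units_int_pow_1[OF gU] Lam_num_def M.smult_simps)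
  have Dm: "Dsol a (-1) = qpow h (\<kappa> a / 2) \<odot>\<^bsub>M\<^esub> M.conjug (inv\<^bsub>M\<^esub> g) (L a)"
    using a M.Units_int_pow_neg[OF gU, of 1] by (simp add: Dsol_def M.Units_int_pow_1[OF gU])
  show "qpow h (\<kappa> a) \<odot>\<^bsub>M\<^esub> (Dsol a (-1) \<otimes>\<^bsub>M\<^esub> Dsol a 1) =
      Dsol a 0 \<otimes>\<^bsub>M\<^esub> Dsol a 0 \<ominus>\<^bsub>M\<^esub> L a \<otimes>\<^bsub>M\<^esub> L a \<otimes>\<^bsub>M\<^esub> x"
    using a advances_relation[OF S] unfolding Dm D1 Lam_num_def by (simp add: Dsol_at_0)
qed

text \<open>For a short label, one period \<open>g\<close> consists of two time steps, performed by \<open>S\<close> and \<open>S'\<close>, while \<open>R\<close>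
  is invisible to that label.\<close>

lemma short_relation:
  assumes a: "a \<in> {1..N}" "short ty N a" and g: "g = S' \<otimes>\<^bsub>M\<^esub> S \<otimes>\<^bsub>M\<^esub> R"
    and S: "advances S (\<omega>s a) (\<omega> a) x" and S': "advances S' (\<omega>s a) (\<omega> a) x'"
    and R: "R \<in> Units M" "R \<in> const_elts"
      "R \<otimes>\<^bsub>M\<^esub> M.conjug (inv\<^bsub>M\<^esub> S) (L a) = M.conjug (inv\<^bsub>M\<^esub> S) (L a) \<otimes>\<^bsub>M\<^esub> R"
  shows "Dsol a 1 = LT a"
    and "qpow h (\<kappa> a) \<odot>\<^bsub>M\<^esub> (Dsol a (-1) \<otimes>\<^bsub>M\<^esub> Dsol a 1) =
      Dsol a 0 \<otimes>\<^bsub>M\<^esub> Dsol a 0 \<ominus>\<^bsub>M\<^esub> L a \<otimes>\<^bsub>M\<^esub> L a \<otimes>\<^bsub>M\<^esub> x"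
    and "qpow h (\<kappa> a) \<odot>\<^bsub>M\<^esub> (Dsol a 0 \<otimes>\<^bsub>M\<^esub> Dsol a 2) =
      Dsol a 1 \<otimes>\<^bsub>M\<^esub> Dsol a 1 \<ominus>\<^bsub>M\<^esub> qpow h (- \<kappa> a) \<odot>\<^bsub>M\<^esub> M.conjug S' (L a \<otimes>\<^bsub>M\<^esub> L a \<otimes>\<^bsub>M\<^esub> x')"
proof -
  note [simp] = advancesD(1,2,5)[OF S] advancesD(1,2,5)[OF S'] R(1) M.Units_closed[OF R(1)]
  have car [simp]: "L a \<in> carrier M" "LT a \<in> carrier M" using a by simp_all
  define k where "k = qpow h (\<kappa> a / 2)"
  have "k * k = qpow h (\<kappa> a)" unfolding k_def by (rule qpow_mult_eqI) simp
  moreover have "qpow h (\<kappa> a) * qpow h (- \<kappa> a) = 1" by (simp flip: qpow_add)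
  ultimately have k: "qpow h (\<kappa> a) = k * k" "qpow h (- \<kappa> a) = inverse (k * k)" "k \<noteq> 0"
    by (auto simp: k_def intro: inverse_unique[symmetric])
  have SL: "M.conjug S (L a) = k \<odot>\<^bsub>M\<^esub> LT a" and S'L: "M.conjug S' (L a) = k \<odot>\<^bsub>M\<^esub> LT a"
    using advancesD(6)[OF S] advancesD(6)[OF S'] by (simp_all add: k_def Lam_num_def)
  have RL: "M.conjug R (L a) = L a"
    using a R by (intro conjug_const_elts) auto
  have R': "M.conjug (inv\<^bsub>M\<^esub> R) (M.conjug (inv\<^bsub>M\<^esub> S) (L a)) = M.conjug (inv\<^bsub>M\<^esub> S) (L a)"
    using R(3) by (intro M.conjug_inv_eq M.conjug_commute) simp_all
  show D1: "Dsol a 1 = LT a" using a by (simp add: Dsol_def)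
  \<comment> \<open>Going back one period from time 1: undoing S' returns from \<Lambda> T to
    \<Lambda>, undoing S gives the value at time -1, and undoing R has no effect.\<close>
  have "LT a = inverse k \<odot>\<^bsub>M\<^esub> M.conjug S' (L a)"
    using k(3) by (simp add: S'L M.smult_simps)
  moreover have "inv\<^bsub>M\<^esub> g = inv\<^bsub>M\<^esub> R \<otimes>\<^bsub>M\<^esub> (inv\<^bsub>M\<^esub> S \<otimes>\<^bsub>M\<^esub> inv\<^bsub>M\<^esub> S')"
    unfolding g by (simp add: M.inv_Units_mult)
  ultimately have "M.conjug (inv\<^bsub>M\<^esub> g) (LT a) = inverse k \<odot>\<^bsub>M\<^esub> M.conjug (inv\<^bsub>M\<^esub> S) (L a)"
    by (simp add: M.conjug_smult M.conjug_conjug R')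
  then have Dm: "Dsol a (-1) = k \<odot>\<^bsub>M\<^esub> M.conjug (inv\<^bsub>M\<^esub> S) (L a)"
    using a M.Units_int_pow_neg[OF gU, of 1] k
    by (simp add: Dsol_def M.Units_int_pow_1[OF gU] M.smult_simps mult.assoc)
  show "qpow h (\<kappa> a) \<odot>\<^bsub>M\<^esub> (Dsol a (-1) \<otimes>\<^bsub>M\<^esub> Dsol a 1) =
      Dsol a 0 \<otimes>\<^bsub>M\<^esub> Dsol a 0 \<ominus>\<^bsub>M\<^esub> L a \<otimes>\<^bsub>M\<^esub> L a \<otimes>\<^bsub>M\<^esub> x"
    using a advances_relation[OF S] unfolding Dm D1 k_def Lam_num_def by (simp add: Dsol_at_0)
  have "M.conjug g (L a) = k \<odot>\<^bsub>M\<^esub> M.conjug S' (LT a)"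
    unfolding g by (simp add: M.conjug_conjug RL SL M.conjug_smult)
  then have D2: "Dsol a 2 = inverse k \<odot>\<^bsub>M\<^esub> M.conjug S' (LT a)"
    using a k by (simp add: Dsol_def M.Units_int_pow_1[OF gU] M.smult_simps mult.assoc)
  \<comment> \<open>The equation at time 0 for the step S', conjugated by S' itself, becomes the
    equation at time 1: each of its three values moves forward by one step.\<close>
  have "(k * k) \<odot>\<^bsub>M\<^esub> ((k \<odot>\<^bsub>M\<^esub> M.conjug (inv\<^bsub>M\<^esub> S') (L a)) \<otimes>\<^bsub>M\<^esub> LT a) =
      L a \<otimes>\<^bsub>M\<^esub> L a \<ominus>\<^bsub>M\<^esub> L a \<otimes>\<^bsub>M\<^esub> L a \<otimes>\<^bsub>M\<^esub> x'"
    using advances_relation[OF S'] by (simp add: k_def Lam_num_def flip: qpow_add)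
  then have "M.conjug S' ((k * k) \<odot>\<^bsub>M\<^esub> ((k \<odot>\<^bsub>M\<^esub> M.conjug (inv\<^bsub>M\<^esub> S') (L a)) \<otimes>\<^bsub>M\<^esub> LT a)) =
      M.conjug S' (L a \<otimes>\<^bsub>M\<^esub> L a \<ominus>\<^bsub>M\<^esub> L a \<otimes>\<^bsub>M\<^esub> L a \<otimes>\<^bsub>M\<^esub> x')" by simp
  moreover have "M.conjug S' ((k * k) \<odot>\<^bsub>M\<^esub> ((k \<odot>\<^bsub>M\<^esub> M.conjug (inv\<^bsub>M\<^esub> S') (L a)) \<otimes>\<^bsub>M\<^esub> LT a)) =
      (k * k * (k * k)) \<odot>\<^bsub>M\<^esub> (L a \<otimes>\<^bsub>M\<^esub> Dsol a 2)"
    using k(3) M.conjug_mult[of S' "M.conjug (inv\<^bsub>M\<^esub> S') (L a)" "LT a"]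
    by (simp add: D2 M.smult_simps M.conjug_smult mult.assoc)
  moreover have "M.conjug S' (L a \<otimes>\<^bsub>M\<^esub> L a \<ominus>\<^bsub>M\<^esub> L a \<otimes>\<^bsub>M\<^esub> L a \<otimes>\<^bsub>M\<^esub> x') =
      (k * k) \<odot>\<^bsub>M\<^esub> (LT a \<otimes>\<^bsub>M\<^esub> LT a) \<ominus>\<^bsub>M\<^esub> M.conjug S' (L a \<otimes>\<^bsub>M\<^esub> L a \<otimes>\<^bsub>M\<^esub> x')"
    using M.conjug_mult[of S' "L a" "L a"] by (simp add: M.conjug_minus S'L M.smult_simps del: Lam_mult)
  ultimately have "(k * k * (k * k)) \<odot>\<^bsub>M\<^esub> (L a \<otimes>\<^bsub>M\<^esub> Dsol a 2) =
      (k * k) \<odot>\<^bsub>M\<^esub> (LT a \<otimes>\<^bsub>M\<^esub> LT a) \<ominus>\<^bsub>M\<^esub> M.conjug S' (L a \<otimes>\<^bsub>M\<^esub> L a \<otimes>\<^bsub>M\<^esub> x')" by simp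
  then have inv: "inverse (k * k) \<odot>\<^bsub>M\<^esub> ((k * k * (k * k)) \<odot>\<^bsub>M\<^esub> (L a \<otimes>\<^bsub>M\<^esub> Dsol a 2)) =
      inverse (k * k) \<odot>\<^bsub>M\<^esub> ((k * k) \<odot>\<^bsub>M\<^esub> (LT a \<otimes>\<^bsub>M\<^esub> LT a) \<ominus>\<^bsub>M\<^esub> M.conjug S' (L a \<otimes>\<^bsub>M\<^esub> L a \<otimes>\<^bsub>M\<^esub> x'))" by simp
  have "(k * k) \<odot>\<^bsub>M\<^esub> (L a \<otimes>\<^bsub>M\<^esub> Dsol a 2) =
      LT a \<otimes>\<^bsub>M\<^esub> LT a \<ominus>\<^bsub>M\<^esub> inverse (k * k) \<odot>\<^bsub>M\<^esub> M.conjug S' (L a \<otimes>\<^bsub>M\<^esub> L a \<otimes>\<^bsub>M\<^esub> x')"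
  proof -
    have e: "inverse (k * k) * (k * k * (k * k)) = k * k" "inverse (k * k) * (k * k) = 1"
      using k(3) by (simp_all add: field_simps)
    show ?thesis
      using inv a Dsol_closed[of a 2] by (simp add: M.smult_minus M.smult_smult e del: inverse_mult_distrib)
  qed
  then show "qpow h (\<kappa> a) \<odot>\<^bsub>M\<^esub> (Dsol a 0 \<otimes>\<^bsub>M\<^esub> Dsol a 2) =
      Dsol a 1 \<otimes>\<^bsub>M\<^esub> Dsol a 1 \<ominus>\<^bsub>M\<^esub> qpow h (- \<kappa> a) \<odot>\<^bsub>M\<^esub> M.conjug S' (L a \<otimes>\<^bsub>M\<^esub> L a \<otimes>\<^bsub>M\<^esub> x')"
    using a by (simp add: D1 Dsol_at_0 k)
qed

lemma q_rel_Dsol_long: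
  assumes a: "a \<in> {1..N}" "\<not> short ty N a" and S: "advances g (\<omega>s a) (\<omega> a) x"
    and X: "M.evolves h g \<eta> X" "L a \<otimes>\<^bsub>M\<^esub> L a \<otimes>\<^bsub>M\<^esub> x = qpow h d0 \<odot>\<^bsub>M\<^esub> X 0"
    and c: "c = \<kappa> a" and d: "d = d0 + of_int n * (\<eta> - \<kappa> a)"
  shows "q_rel h (opposite M) Dsol c a n d (X n)"
proof -
  have "qpow h (\<kappa> a) \<odot>\<^bsub>M\<^esub> (Dsol a (n + -1) \<otimes>\<^bsub>M\<^esub> Dsol a (n + 1)) =
      Dsol a (n + 0) \<otimes>\<^bsub>M\<^esub> Dsol a (n + 0) \<ominus>\<^bsub>M\<^esub> qpow h d \<odot>\<^bsub>M\<^esub> X n"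
    by (rule M.evolves_relation[OF gU Dsol_long_evolves[of a] Dsol_long_evolves[of a] Dsol_long_evolves[of a] X(1)])
      (use a long_relation(2)[OF a S] in \<open>simp_all add: X(2) d\<close>)
  then show ?thesis using a c by (simp add: M.q_rel_opposite Dsol_closed)
qed

lemma q_rel_Dsol_short:
  assumes a: "a \<in> {1..N}" "short ty N a"
    and rel: "qpow h (\<kappa> a) \<odot>\<^bsub>M\<^esub> (Dsol a (i - 1) \<otimes>\<^bsub>M\<^esub> Dsol a (i + 1)) =
      Dsol a i \<otimes>\<^bsub>M\<^esub> Dsol a i \<ominus>\<^bsub>M\<^esub> qpow h d0 \<odot>\<^bsub>M\<^esub> X 0"
    and X: "M.evolves h g \<eta> X" and c: "c = \<kappa> a" and d: "d = d0 + of_int n * (\<eta> - 2 * \<kappa> a)"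
  shows "q_rel h (opposite M) Dsol c a (2 * n + i) d (X n)"
proof -
  have "qpow h (\<kappa> a) \<odot>\<^bsub>M\<^esub> (Dsol a (2 * n + (i - 1)) \<otimes>\<^bsub>M\<^esub> Dsol a (2 * n + (i + 1))) =
      Dsol a (2 * n + i) \<otimes>\<^bsub>M\<^esub> Dsol a (2 * n + i) \<ominus>\<^bsub>M\<^esub> qpow h d \<odot>\<^bsub>M\<^esub> X n"
    by (rule M.evolves_relation[OF gU Dsol_short_evolves[of a] Dsol_short_evolves[of a] Dsol_short_evolves[of a] X])
      (use a rel d in simp_all)
  then show ?thesis using a c by (simp add: M.q_rel_opposite Dsol_closed algebra_simps)
qed

text \<open>Conjugation reduces the claim to k = 0. There all values are monomials
  \<Lambda>^(\<omega>s) T^(l \<omega>) with l in {0, 1}, and normal ordering yields both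
  exponents.\<close>

lemma Dsol_commutation:
  assumes ab: "a \<in> {1..N}" "b \<in> {1..N}" and ij: "i \<in> {0, 1}" "j \<in> {0, 1}"
    and D1: "\<And>a. a \<in> {1..N} \<Longrightarrow> Dsol a 1 = LT a"
  shows "Dsol b (t_lab ty N b * k + j) \<otimes>\<^bsub>M\<^esub> Dsol a (t_lab ty N a * k + i) =
     qpow h (Lam_num ty N a b * of_int j - Lam_num ty N b a * of_int i) \<odot>\<^bsub>M\<^esub>
       (Dsol a (t_lab ty N a * k + i) \<otimes>\<^bsub>M\<^esub> Dsol b (t_lab ty N b * k + j))"
proof (rule M.evolves_commutation[OF gU Dsol_evolves Dsol_evolves])
  have D: "Dsol c l = mon (\<omega>s c) (\<lambda>r. of_int l * \<omega> c r) 0" if "c \<in> {1..N}" "l \<in> {0, 1}" for c l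
    using that by (auto simp: Dsol_at_0 D1 Lam_Tp) (simp add: mon_defs)
  show "Dsol b (t_lab ty N b * 0 + j) \<otimes>\<^bsub>M\<^esub> Dsol a (t_lab ty N a * 0 + i) =
     qpow h (Lam_num ty N a b * of_int j - Lam_num ty N b a * of_int i) \<odot>\<^bsub>M\<^esub>
       (Dsol a (t_lab ty N a * 0 + i) \<otimes>\<^bsub>M\<^esub> Dsol b (t_lab ty N b * 0 + j))"
    using ab by (simp add: D[OF ab(1) ij(1)] D[OF ab(2) ij(2)] mon_mult M.smult_simps dot_scale_left Lam_num_def flip: qpow_add)
      (simp add: ac_simps dot_commute)
qed (use ab in auto)

end

end

lemma complex_of_real_of_rat: "complex_of_real (of_rat r) = of_rat r"
  by (cases r) (simp add: of_rat_rat)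

lemma dot_e_vec: "i \<in> {1..N} \<Longrightarrow> dot N v (e_vec i) = v i"
  by (simp add: dot_def e_vec_def mult_delta_right)

lemma dot_e_sum:
  assumes "a \<le> N" "b \<le> N"
  shows "dot N (e_sum a) (e_sum b) = of_nat (min a b)"
proof -
  have "dot N (e_sum a) (e_sum b) = (\<Sum>i\<in>{1..min a b}. 1)"
    unfolding dot_def using assms by (intro sum.mono_neutral_cong_right) (auto simp: e_sum_def)
  then show ?thesis by simp
qed

lemmas dot_simps = dot_add_left dot_add_right dot_diff_left dot_diff_right dot_uminus_right
  dot_scale_left dot_scale_right

context quantum_torus
begin

section \<open>Pairings with simple roots and the factors of \<open>g\<close>\<close>

lemma norm_qpow_less_1: "0 < r \<Longrightarrow> norm (qpow h r) < 1"
  using Re_h by (simp add: qpow_def norm_exp_eq_Re mult_pos_neg flip: complex_of_real_of_rat)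

lemma dot_simple_root: "a \<in> {1..<N} \<Longrightarrow> dot N u (\<alpha> a) = u a - u (a + 1)"
proof -
  assume a: "a \<in> {1..<N}"
  then have "\<alpha> a = e_vec a - e_vec (a + 1)"
    by (cases "type_R_star ty") (auto simp: fun_diff_def)
  then show ?thesis using a by (simp add: dot_simps dot_e_vec)
qed

abbreviation G :: qelt where "G \<equiv> g_Lam ty h N"

abbreviation q :: complex where "q \<equiv> qpow h 1"

lemma g_Lam_eq:
  "G = foldr (\<lambda>a y. inv_qpoch a 1 q \<otimes>\<^bsub>M\<^esub> y) [1..<N] \<one>\<^bsub>M\<^esub>"
  unfolding g_Lam_def Let_def M_def[symmetric]
proof (rule foldr_cong[OF refl refl])
  fix a y assume a: "a \<in> set [1..<N]"
  then have "(\<lambda>j. e_vec (a + 1) j - e_vec a j) = - \<alpha> a"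
    by (cases "type_R_star ty") (auto simp: fun_eq_iff)
  then show "inv\<^bsub>M\<^esub> (qpoch M (Lam (\<lambda>j. e_vec (a + 1) j - e_vec a j)) q) \<otimes>\<^bsub>M\<^esub> y =
      inv_qpoch a 1 q \<otimes>\<^bsub>M\<^esub> y"
    using a by (simp add: inv_qpoch_def)
qed

lemma twist_one: "twist \<one>\<^bsub>M\<^esub> u \<one>\<^bsub>M\<^esub>"
  by (simp add: twist_def)

text \<open>At most one factor of \<open>g_Lam\<close> pairs nontrivially with u, and it contributes
  1 - \<Lambda>^(- \<alpha> b). Any b outside {1..<N} expresses that no factor does.\<close>

lemma twist_g_Lam:
  assumes "\<And>a. a \<in> {1..<N} \<Longrightarrow> dot N u (\<alpha> a) = (if a = b then 1 else 0)"
  shows "twist G u (if b \<in> {1..<N} then \<one>\<^bsub>M\<^esub> \<ominus>\<^bsub>M\<^esub> 1 \<odot>\<^bsub>M\<^esub> Lam (- \<alpha> b) else \<one>\<^bsub>M\<^esub>)"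
proof -
  have nq: "norm q < 1" by (simp add: norm_qpow_less_1)
  have "set xs \<subseteq> {1..<N} \<Longrightarrow> distinct xs \<Longrightarrow>
      twist (foldr (\<lambda>a y. inv_qpoch a 1 q \<otimes>\<^bsub>M\<^esub> y) xs \<one>\<^bsub>M\<^esub>) u
        (if b \<in> set xs then \<one>\<^bsub>M\<^esub> \<ominus>\<^bsub>M\<^esub> 1 \<odot>\<^bsub>M\<^esub> Lam (- \<alpha> b) else \<one>\<^bsub>M\<^esub>)" for xs
  proof (induction xs)
    case Nil
    then show ?case by (simp add: twist_one)
  next
    case (Cons a xs)
    then have IH: "twist (foldr (\<lambda>a y. inv_qpoch a 1 q \<otimes>\<^bsub>M\<^esub> y) xs \<one>\<^bsub>M\<^esub>) u
        (if b \<in> set xs then \<one>\<^bsub>M\<^esub> \<ominus>\<^bsub>M\<^esub> 1 \<odot>\<^bsub>M\<^esub> Lam (- \<alpha> b) else \<one>\<^bsub>M\<^esub>)" by simp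
    have a: "a \<in> {1..N}" "a \<in> {1..<N}" using Cons.prems by auto
    show ?case
    proof (cases "a = b")
      case True
      then show ?thesis
        using Cons.prems a twist_mult[OF twist_inv_qpoch[OF a(1) nq, of u 1] IH] assms[OF a(2)] by simp
    next
      case False
      have "(if b \<in> set xs then \<one>\<^bsub>M\<^esub> \<ominus>\<^bsub>M\<^esub> 1 \<odot>\<^bsub>M\<^esub> Lam (- \<alpha> b) else \<one>\<^bsub>M\<^esub>) \<in> carrier M"
        using twistD(5)[OF IH] .
      then show ?thesis
        using False twist_mult[OF twist_inv_qpoch_trivial[OF a(1) nq, of u 1] IH] assms[OF a(2)] by simp
    qed
  qed
  from this[of "[1..<N]"] show ?thesis by (simp add: g_Lam_eq)
qed

lemma twist_g_Lam_trivial: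
  assumes "\<And>a. a \<in> {1..<N} \<Longrightarrow> dot N u (\<alpha> a) = 0"
  shows "twist G u \<one>\<^bsub>M\<^esub>"
  using twist_g_Lam[of u 0] assms by simp

lemma g_Lam_closed: "G \<in> const_elts" "G \<in> Units M" "G \<in> carrier M"
  using twist_g_Lam_trivial[of 0] by (auto simp: twist_def const_elts_closed)

text \<open>The exponent r of the last base has to be the pairing of \<omega> N with \<alpha> N,
  which varies with the type. The scalar c leaves room for the q^(1/2) in A2even.\<close>

lemma twist_full:
  assumes b: "b \<in> {1..N}" and r: "0 < r"
    and u: "\<And>a. a \<in> {1..<N} \<Longrightarrow> dot N u (\<alpha> a) = (if a = b then 1 else 0)"
      "dot N u (\<alpha> N) = (if b = N then r else 0)"
  shows "twist (G \<otimes>\<^bsub>M\<^esub> inv_qpoch N c (qpow h r)) u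
    (\<one>\<^bsub>M\<^esub> \<ominus>\<^bsub>M\<^esub> (if b = N then c else 1) \<odot>\<^bsub>M\<^esub> Lam (- \<alpha> b))"
proof -
  have N: "N \<in> {1..N}" using N_pos by simp
  note nr = norm_qpow_less_1[OF r]
  show ?thesis
  proof (cases "b = N")
    case True
    then show ?thesis
      using b twist_mult[OF twist_g_Lam[OF u(1)] twist_inv_qpoch[OF N nr, of u c]] u(2) by simp
  next
    case False
    then show ?thesis
      using b twist_mult[OF twist_g_Lam[OF u(1)] twist_inv_qpoch_trivial[OF N nr, of u c]] u(2) by simp
  qed
qed

text \<open>Since g_T^y produces T^(y z), a single Gaussian factor makes a step only when u = y z.
  The value y = 1/2 is for the last label of B1.\<close>

lemma advances_gT_mult:
  assumes z: "z \<in> weights" and u: "u = (\<lambda>j. y * z j)" and x: "x \<in> const_elts"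
    and C: "twist C u (\<one>\<^bsub>M\<^esub> \<ominus>\<^bsub>M\<^esub> x)"
  shows "advances (gT y \<otimes>\<^bsub>M\<^esub> C) z u x"
proof (rule advances_mult[OF _ _ _ z x C])
  show "M.conjug (gT y) (Lam z) = qpow h (dot N z u / 2) \<odot>\<^bsub>M\<^esub> (Lam z \<otimes>\<^bsub>M\<^esub> Tp u)"
    using z gT_Lam[OF z, of y] by (simp add: M.conjug_eq_iff u dot_simps)
qed (simp_all add: gT_Tp)

lemma root_monomial_const [simp]: "b \<in> {1..N} \<Longrightarrow> c \<odot>\<^bsub>M\<^esub> Lam (- \<alpha> b) \<in> const_elts"
  by (simp add: ser_X)

lemma conjug_gT_mult_Lam:
  assumes "C \<in> const_elts" "C \<in> Units M" "v \<in> weights"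
  shows "M.conjug (gT y \<otimes>\<^bsub>M\<^esub> C) (Lam v) = qpow h (y * dot N v v / 2) \<odot>\<^bsub>M\<^esub> mon v (\<lambda>j. y * v j) 0"
proof -
  have "M.conjug (gT y) (Lam v) = qpow h (y * dot N v v / 2) \<odot>\<^bsub>M\<^esub> mon v (\<lambda>j. y * v j) 0"
    using gT_Lam[OF assms(3), of y] assms(3) by (simp add: M.conjug_eq_iff Lam_Tp)
  then show ?thesis
    using assms conjug_const_elts[of C "Lam v"] by (simp add: M.conjug_conjug)
qed

text \<open>By the evolution equation, \<open>S\<^sup>-\<^sup>1 \<Lambda>\<^sup>z S\<close> is a quotient of elements that commute with \<open>R\<close>.\<close>

lemma twist_trivial_commutes:
  assumes S: "advances S z u x" and R: "twist R u \<one>\<^bsub>M\<^esub>"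
  shows "R \<otimes>\<^bsub>M\<^esub> M.conjug (inv\<^bsub>M\<^esub> S) (Lam z) = M.conjug (inv\<^bsub>M\<^esub> S) (Lam z) \<otimes>\<^bsub>M\<^esub> R"
proof -
  note [simp] = advancesD(1-5)[OF S] twistD(1-3)[OF R]
  define Y where "Y = M.conjug (inv\<^bsub>M\<^esub> S) (Lam z)"
  define W where "W = Lam z \<otimes>\<^bsub>M\<^esub> Tp u"
  have car [simp]: "Y \<in> carrier M" "W \<in> Units M" "W \<in> carrier M" by (simp_all add: Y_def W_def)
  have RT: "M.conjug R (Tp u) = Tp u"
    using twistD(6)[OF R] by (simp add: M.conjug_eq_iff)
  have RW: "M.conjug R W = W"
    by (simp add: W_def M.conjug_mult RT conjug_const_elts)
  let ?c = "qpow h (dot N z u) * qpow h (dot N z u / 2)"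
  have YW: "?c \<odot>\<^bsub>M\<^esub> (Y \<otimes>\<^bsub>M\<^esub> W) = Lam z \<otimes>\<^bsub>M\<^esub> Lam z \<ominus>\<^bsub>M\<^esub> Lam z \<otimes>\<^bsub>M\<^esub> Lam z \<otimes>\<^bsub>M\<^esub> x"
    using advances_relation[OF S] unfolding Y_def[symmetric] W_def[symmetric] by (simp add: M.smult_simps)
  have "M.conjug R (?c \<odot>\<^bsub>M\<^esub> (Y \<otimes>\<^bsub>M\<^esub> W)) = ?c \<odot>\<^bsub>M\<^esub> (Y \<otimes>\<^bsub>M\<^esub> W)"
    unfolding YW by (subst M.conjug_minus) (simp_all add: conjug_const_elts)
  then have "?c \<odot>\<^bsub>M\<^esub> (M.conjug R Y \<otimes>\<^bsub>M\<^esub> W) = ?c \<odot>\<^bsub>M\<^esub> (Y \<otimes>\<^bsub>M\<^esub> W)"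
    by (simp add: M.conjug_smult M.conjug_mult RW)
  then have "M.conjug R Y \<otimes>\<^bsub>M\<^esub> W = Y \<otimes>\<^bsub>M\<^esub> W"
    by (rule M.smult_cancel) simp_all
  then have "M.conjug R Y = Y" by (simp add: M.Units_cancel)
  then show ?thesis unfolding Y_def[symmetric] by (simp add: M.conjug_eq_iff)
qed

lemma weights_numeral [simp]: "v \<in> weights \<Longrightarrow> numeral k * v \<in> weights"
  by (simp add: weights_def)

lemma L_L_root:
  "a \<in> {1..N} \<Longrightarrow> L a \<otimes>\<^bsub>M\<^esub> L a \<otimes>\<^bsub>M\<^esub> (c \<odot>\<^bsub>M\<^esub> Lam (- \<alpha> a)) = c \<odot>\<^bsub>M\<^esub> Lam (\<omega>s a + \<omega>s a - \<alpha> a)"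
  by (simp add: Lam_mult M.smult_simps)

lemma e_sum_weights [simp]: "a \<le> N \<Longrightarrow> e_sum a \<in> weights"
  by (auto simp: weights_def e_sum_def)

text \<open>This weight identity is why the second term of an interior equation is the product of
  the two neighbouring labels.\<close>

lemma e_sum_neighbours:
  assumes "a \<in> {1..<N}" shows "e_sum a + e_sum a - \<alpha> a = e_sum (a - 1) + e_sum (a + 1)"
proof -
  have "\<alpha> a = e_vec a - e_vec (a + 1)"
    using assms by (cases "type_R_star ty") (auto simp: fun_diff_def)
  then show ?thesis using assms by (auto simp: fun_eq_iff e_sum_def e_vec_def)
qed

text \<open>Label 0 and the labels whose weight is a plain sum e_1 + ... + e_a in both root systems.
  An interior equation involves three consecutive labels of this kind.\<close>

definition e_sum_label :: "nat \<Rightarrow> bool" where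
  "e_sum_label a \<longleftrightarrow> a \<le> N \<and> \<omega> a = e_sum a \<and> \<omega>s a = e_sum a"

lemma e_sum_labelD:
  "e_sum_label a \<Longrightarrow> a \<le> N" "e_sum_label a \<Longrightarrow> \<omega> a = e_sum a" "e_sum_label a \<Longrightarrow> \<omega>s a = e_sum a"
  "e_sum_label a \<Longrightarrow> \<kappa> a = of_nat a"
  by (simp_all add: e_sum_label_def Lam_num_def dot_e_sum)

section \<open>Interior equations and assembly of a solution\<close>

context
  assumes gU: "g \<in> Units M"
begin

text \<open>Since \<kappa> a = a is linear in the label, the rates of the two neighbours add up to
  that of the square, and no power of q survives.\<close>

lemma interior_long:
  assumes a: "1 \<le> a" "e_sum_label (a - 1)" "e_sum_label a" "e_sum_label (a + 1)"
    and long: "\<not> short ty N a" "\<not> short ty N (a - 1) \<or> a = 1" "\<not> short ty N (a + 1)"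
    and adv: "advances g (\<omega>s a) (\<omega> a) (1 \<odot>\<^bsub>M\<^esub> Lam (- \<alpha> a))"
  shows "q_rel h (opposite M) Dsol (of_nat a) a n 0 (Dsol (a + 1) n \<otimes>\<^bsub>opposite M\<^esub> Dsol (a - 1) n)"
proof -
  note lab = a(2-4)[THEN e_sum_labelD(1)]  a(2-4)[THEN e_sum_labelD(3)] a(2-4)[THEN e_sum_labelD(4)]
  have aN: "a \<in> {1..N}" "a \<in> {1..<N}" using lab a(1) by auto
  have X: "M.evolves h g (\<kappa> (a - 1) / 2 + \<kappa> (a + 1) / 2) (\<lambda>n. Dsol (a - 1) n \<otimes>\<^bsub>M\<^esub> Dsol (a + 1) n)"
    using M.evolves_mult[OF gU Dsol_long_evolves[OF gU, of "a - 1" 0] Dsol_long_evolves[OF gU, of "a + 1" 0]]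
      lab long by auto
  have "q_rel h (opposite M) Dsol (of_nat a) a n 0 (Dsol (a - 1) n \<otimes>\<^bsub>M\<^esub> Dsol (a + 1) n)"
  proof (rule q_rel_Dsol_long[OF gU aN(1) long(1) adv X])
    show "L a \<otimes>\<^bsub>M\<^esub> L a \<otimes>\<^bsub>M\<^esub> (1 \<odot>\<^bsub>M\<^esub> Lam (- \<alpha> a)) =
        qpow h 0 \<odot>\<^bsub>M\<^esub> (Dsol (a - 1) 0 \<otimes>\<^bsub>M\<^esub> Dsol (a + 1) 0)"
      unfolding L_L_root[OF aN(1)] unfolding lab e_sum_neighbours[OF aN(2)]
      using lab by (simp add: Dsol_at_0[OF gU] Lam_mult)
    have "\<kappa> (a - 1) / 2 + \<kappa> (a + 1) / 2 - \<kappa> a = 0"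
      unfolding lab using a(1) by (simp add: of_nat_diff field_simps)
    then show "0 = 0 + of_int n * (\<kappa> (a - 1) / 2 + \<kappa> (a + 1) / 2 - \<kappa> a)" by simp
  qed (use lab in simp_all)
  then show ?thesis by simp
qed

lemma Dsol_at_1_0: "Dsol 0 1 = LT 0"
  by (simp add: Dsol_0_label[OF gU] fund_wt_0 Lam_zero Tp_zero)

lemma interior_short:
  assumes a: "1 \<le> a" "e_sum_label (a - 1)" "e_sum_label a" "e_sum_label (a + 1)"
    and short: "short ty N a" "short ty N (a - 1) \<or> a = 1" "short ty N (a + 1)"
    and rel0: "qpow h (\<kappa> a) \<odot>\<^bsub>M\<^esub> (Dsol a (-1) \<otimes>\<^bsub>M\<^esub> Dsol a 1) =
      Dsol a 0 \<otimes>\<^bsub>M\<^esub> Dsol a 0 \<ominus>\<^bsub>M\<^esub> L a \<otimes>\<^bsub>M\<^esub> L a \<otimes>\<^bsub>M\<^esub> (1 \<odot>\<^bsub>M\<^esub> Lam (- \<alpha> a))"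
    and C: "C \<in> const_elts" "C \<in> Units M"
    and rel1: "qpow h (\<kappa> a) \<odot>\<^bsub>M\<^esub> (Dsol a 0 \<otimes>\<^bsub>M\<^esub> Dsol a 2) =
      Dsol a 1 \<otimes>\<^bsub>M\<^esub> Dsol a 1 \<ominus>\<^bsub>M\<^esub> qpow h (- \<kappa> a) \<odot>\<^bsub>M\<^esub>
        M.conjug (gT 1 \<otimes>\<^bsub>M\<^esub> C) (L a \<otimes>\<^bsub>M\<^esub> L a \<otimes>\<^bsub>M\<^esub> (1 \<odot>\<^bsub>M\<^esub> Lam (- \<alpha> a)))"
    and D1: "\<And>b. 1 \<le> b \<Longrightarrow> b \<le> a + 1 \<Longrightarrow> Dsol b 1 = LT b"
  shows "q_rel h (opposite M) Dsol (of_nat a) a m 0 (Dsol (a + 1) m \<otimes>\<^bsub>opposite M\<^esub> Dsol (a - 1) m)"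
proof -
  note lab = a(2-4)[THEN e_sum_labelD(1)] a(2-4)[THEN e_sum_labelD(3)] a(2-4)[THEN e_sum_labelD(4)]
    a(2-4)[THEN e_sum_labelD(2)]
  have aN: "a \<in> {1..N}" "a \<in> {1..<N}" using lab a(1) by auto
  have X: "M.evolves h g (\<kappa> (a - 1) + \<kappa> (a + 1)) (\<lambda>n. Dsol (a - 1) (2 * n + i) \<otimes>\<^bsub>M\<^esub> Dsol (a + 1) (2 * n + i))" for i
    using M.evolves_mult[OF gU Dsol_short_evolves[OF gU, of "a - 1" i] Dsol_short_evolves[OF gU, of "a + 1" i]]
      lab short by auto
  have D1': "Dsol (a - 1) 1 = LT (a - 1)" "Dsol (a + 1) 1 = LT (a + 1)"
    using D1[of "a - 1"] D1[of "a + 1"] Dsol_at_1_0 a(1) by (cases "a = 1"; simp)+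
  have LLx: "L a \<otimes>\<^bsub>M\<^esub> L a \<otimes>\<^bsub>M\<^esub> (1 \<odot>\<^bsub>M\<^esub> Lam (- \<alpha> a)) = Lam (e_sum (a - 1) + e_sum (a + 1))"
    unfolding L_L_root[OF aN(1)] unfolding lab e_sum_neighbours[OF aN(2)] using lab by simp
  have "\<kappa> (a - 1) + \<kappa> (a + 1) - 2 * \<kappa> a = 0"
    unfolding lab using a(1) by (simp add: of_nat_diff)
  then have d: "0 = 0 + of_int n * (\<kappa> (a - 1) + \<kappa> (a + 1) - 2 * \<kappa> a)" for n by simp
  have c: "of_nat a = \<kappa> a" using lab by simp
  have X0: "Dsol (a - 1) 0 \<otimes>\<^bsub>M\<^esub> Dsol (a + 1) 0 = Lam (e_sum (a - 1) + e_sum (a + 1))"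
    using lab by (simp add: Dsol_at_0[OF gU] Lam_mult)
  have even: "q_rel h (opposite M) Dsol (of_nat a) a (2 * n + 0) 0
      (Dsol (a - 1) (2 * n + 0) \<otimes>\<^bsub>M\<^esub> Dsol (a + 1) (2 * n + 0))" for n
    by (rule q_rel_Dsol_short[OF gU aN(1) short(1) _ X c d])
      (use rel0[unfolded LLx] X0 lab in simp)
  have odd: "q_rel h (opposite M) Dsol (of_nat a) a (2 * n + 1) 0
      (Dsol (a - 1) (2 * n + 1) \<otimes>\<^bsub>M\<^esub> Dsol (a + 1) (2 * n + 1))" for n
  proof (rule q_rel_Dsol_short[OF gU aN(1) short(1) _ X c d])
    let ?v = "e_sum (a - 1) + e_sum (a + 1)"
    have v: "?v \<in> weights" using lab by simp
    have "qpow h (- \<kappa> a) \<odot>\<^bsub>M\<^esub> M.conjug (gT 1 \<otimes>\<^bsub>M\<^esub> C) (L a \<otimes>\<^bsub>M\<^esub> L a \<otimes>\<^bsub>M\<^esub> (1 \<odot>\<^bsub>M\<^esub> Lam (- \<alpha> a))) =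
        qpow h (- \<kappa> a + dot N ?v ?v / 2) \<odot>\<^bsub>M\<^esub> mon ?v ?v 0"
    proof -
      have "(\<lambda>j. 1 * ?v j) = ?v" by (simp add: fun_eq_iff)
      then show ?thesis
        unfolding LLx conjug_gT_mult_Lam[OF C v] qpow_add mult_1_left
        by (simp only: M.smult_smult[OF mon_closed[OF v]])
    qed
    \<comment> \<open>Here v \<cdot> v / 2 = 2 a - 1 and \<kappa> a = a, which leaves a - 1: the
      exponent from normal ordering the two neighbours at time 1.\<close>
    also have "- \<kappa> a + dot N ?v ?v / 2 = dot N (e_sum (a - 1)) (e_sum (a + 1))"
      using lab a(1) by (simp add: dot_simps dot_e_sum of_nat_diff field_simps)
    also have "qpow h \<dots> \<odot>\<^bsub>M\<^esub> mon ?v ?v 0 = Dsol (a - 1) 1 \<otimes>\<^bsub>M\<^esub> Dsol (a + 1) 1"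
      unfolding D1' lab using lab(1,3) by (simp add: Lam_Tp mon_mult)
    finally have "qpow h (- \<kappa> a) \<odot>\<^bsub>M\<^esub> M.conjug (gT 1 \<otimes>\<^bsub>M\<^esub> C) (L a \<otimes>\<^bsub>M\<^esub> L a \<otimes>\<^bsub>M\<^esub> (1 \<odot>\<^bsub>M\<^esub> Lam (- \<alpha> a))) =
        Dsol (a - 1) 1 \<otimes>\<^bsub>M\<^esub> Dsol (a + 1) 1" .
    then show "qpow h (\<kappa> a) \<odot>\<^bsub>M\<^esub> (Dsol a (1 - 1) \<otimes>\<^bsub>M\<^esub> Dsol a (1 + 1)) = Dsol a 1 \<otimes>\<^bsub>M\<^esub> Dsol a 1 \<ominus>\<^bsub>M\<^esub>
        qpow h 0 \<odot>\<^bsub>M\<^esub> (Dsol (a - 1) (2 * 0 + 1) \<otimes>\<^bsub>M\<^esub> Dsol (a + 1) (2 * 0 + 1))"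
      using rel1 lab aN Dsol_closed[OF gU] by simp
  qed
  show ?thesis
    using even[of "m div 2"] odd[of "m div 2"] by (cases "even m") (simp_all add: odd_two_times_div_two_succ)
qed

lemma D_bar_solution_Dsol:
  assumes D1: "\<And>a. a \<in> {1..N} \<Longrightarrow> Dsol a 1 = LT a"
    and interior: "\<And>a n. a \<in> {1..N_bar ty N} \<Longrightarrow>
      q_rel h (opposite M) Dsol (of_nat a) a n 0 (Dsol (a + 1) n \<otimes>\<^bsub>opposite M\<^esub> Dsol (a - 1) n)"
    and boundary: "\<And>n. boundary_rel ty h N (opposite M) Dsol n"
  shows "D_bar_solution ty h N Dsol"
  unfolding D_bar_solution_def Q_system_def M_def[symmetric]
proof (intro conjI ballI allI)
  fix a b i j k assume "a \<in> {1..N}" "b \<in> {1..N}" "i \<in> {0, 1::int}" "j \<in> {0, 1::int}"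
  then show "Dsol a (t_lab ty N a * k + i) \<otimes>\<^bsub>opposite M\<^esub> Dsol b (t_lab ty N b * k + j) =
        qpow h (Lam_num ty N a b * of_int j - Lam_num ty N b a * of_int i) \<odot>\<^bsub>opposite M\<^esub>
          (Dsol b (t_lab ty N b * k + j) \<otimes>\<^bsub>opposite M\<^esub> Dsol a (t_lab ty N a * k + i))"
    unfolding M.opposite_simps by (intro Dsol_commutation[OF gU] D1)
next
  fix a n assume "a \<in> {1..N_bar ty N}"
  then show "q_rel h (opposite M) Dsol (of_nat a) a n 0 (Dsol (a + 1) n \<otimes>\<^bsub>opposite M\<^esub> Dsol (a - 1) n)"
    by (rule interior)
next
  fix n show "boundary_rel ty h N (opposite M) Dsol n" by (rule boundary)
next
  fix a assume "a \<in> {1..N}"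
  then show "Dsol a 1 = LT a" by (rule D1)
qed (simp_all add: Dsol_closed[OF gU] Dsol_0_label[OF gU] Dsol_at_0[OF gU])

end

section \<open>Verification type by type\<close>

lemma Dsol_evolves_simps:
  assumes "g \<in> Units M" "a \<le> N"
  shows "\<not> short ty N a \<or> a = 0 \<Longrightarrow> M.evolves h g (\<kappa> a / 2) (\<lambda>n. Dsol a n)"
    and "\<not> short ty N a \<or> a = 0 \<Longrightarrow> M.evolves h g (\<kappa> a / 2) (\<lambda>n. Dsol a (n + 1))"
    and "short ty N a \<or> a = 0 \<Longrightarrow> M.evolves h g (\<kappa> a) (\<lambda>n. Dsol a (2 * n))"
    and "short ty N a \<or> a = 0 \<Longrightarrow> M.evolves h g (\<kappa> a) (\<lambda>n. Dsol a (2 * n + 1))"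
  using Dsol_long_evolves[OF assms, of 0] Dsol_long_evolves[OF assms, of 1]
    Dsol_short_evolves[OF assms, of 0] Dsol_short_evolves[OF assms, of 1] by simp_all

lemma last_label: "N \<in> {1..N}"
  using N_pos by simp

text \<open>With x = \<Lambda>^(- \<alpha> a) the second term at time 0 is a pure power of
  \<Lambda>. A boundary equation is thus reduced to one identity of weights and one of
  rates.\<close>

lemma q_rel_long_Lam:
  assumes gU: "g \<in> Units M" and a: "a \<in> {1..N}" "\<not> short ty N a"
    and adv: "advances g (\<omega>s a) (\<omega> a) (1 \<odot>\<^bsub>M\<^esub> Lam (- \<alpha> a))"
    and X: "M.evolves h g \<eta> X" "X 0 = Lam (\<omega>s a + \<omega>s a - \<alpha> a)"
    and c: "c = \<kappa> a" and d: "d = of_int n * (\<eta> - \<kappa> a)"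
  shows "q_rel h (opposite M) Dsol c a n d (X n)"
proof (rule q_rel_Dsol_long[OF gU a adv X(1) _ c, of 0])
  have "X 0 \<in> carrier M" by (rule M.evolves_closed[OF X(1)])
  then show "L a \<otimes>\<^bsub>M\<^esub> L a \<otimes>\<^bsub>M\<^esub> (1 \<odot>\<^bsub>M\<^esub> Lam (- \<alpha> a)) = qpow h 0 \<odot>\<^bsub>M\<^esub> X 0"
    unfolding L_L_root[OF a(1)] X(2) by simp
qed (use d in simp)

lemma q_rel_short_even_Lam:
  assumes gU: "g \<in> Units M" and a: "a \<in> {1..N}" "short ty N a"
    and rel0: "qpow h (\<kappa> a) \<odot>\<^bsub>M\<^esub> (Dsol a (-1) \<otimes>\<^bsub>M\<^esub> Dsol a 1) =
      Dsol a 0 \<otimes>\<^bsub>M\<^esub> Dsol a 0 \<ominus>\<^bsub>M\<^esub> L a \<otimes>\<^bsub>M\<^esub> L a \<otimes>\<^bsub>M\<^esub> (1 \<odot>\<^bsub>M\<^esub> Lam (- \<alpha> a))"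
    and X: "M.evolves h g \<eta> X" "X 0 = Lam (\<omega>s a + \<omega>s a - \<alpha> a)"
    and c: "c = \<kappa> a" and d: "d = of_int n * (\<eta> - 2 * \<kappa> a)"
  shows "q_rel h (opposite M) Dsol c a (2 * n) d (X n)"
proof -
  have "q_rel h (opposite M) Dsol c a (2 * n + 0) d (X n)"
  proof (rule q_rel_Dsol_short[OF gU a _ X(1) c, of _ 0])
    have "X 0 \<in> carrier M" by (rule M.evolves_closed[OF X(1)])
    then show "qpow h (\<kappa> a) \<odot>\<^bsub>M\<^esub> (Dsol a (0 - 1) \<otimes>\<^bsub>M\<^esub> Dsol a (0 + 1)) =
      Dsol a 0 \<otimes>\<^bsub>M\<^esub> Dsol a 0 \<ominus>\<^bsub>M\<^esub> qpow h 0 \<odot>\<^bsub>M\<^esub> X 0"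
      using rel0 unfolding L_L_root[OF a(1)] X(2)[symmetric] by simp
  qed (use d in simp)
  then show ?thesis by simp
qed

text \<open>The constant part of d collects y v \<cdot> v / 2 from the Gaussian, e from the scalar
  in the Pochhammer argument, - \<kappa> a from the normalisation, and - f from normal ordering the
  second term.\<close>

lemma q_rel_short_odd_mon:
  assumes gU: "g \<in> Units M" and a: "a \<in> {1..N}" "short ty N a"
    and C: "C \<in> const_elts" "C \<in> Units M"
    and rel1: "qpow h (\<kappa> a) \<odot>\<^bsub>M\<^esub> (Dsol a 0 \<otimes>\<^bsub>M\<^esub> Dsol a 2) =
      Dsol a 1 \<otimes>\<^bsub>M\<^esub> Dsol a 1 \<ominus>\<^bsub>M\<^esub> qpow h (- \<kappa> a) \<odot>\<^bsub>M\<^esub>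
        M.conjug (gT y \<otimes>\<^bsub>M\<^esub> C) (L a \<otimes>\<^bsub>M\<^esub> L a \<otimes>\<^bsub>M\<^esub> (qpow h e \<odot>\<^bsub>M\<^esub> Lam (- \<alpha> a)))"
    and v: "v = \<omega>s a + \<omega>s a - \<alpha> a" and u: "u = (\<lambda>j. y * v j)"
    and X: "M.evolves h g \<eta> X" "X 0 = qpow h f \<odot>\<^bsub>M\<^esub> mon v u 0"
    and c: "c = \<kappa> a"
    and d: "d = y * dot N v v / 2 + e - \<kappa> a - f + of_int n * (\<eta> - 2 * \<kappa> a)"
  shows "q_rel h (opposite M) Dsol c a (2 * n + 1) d (X n)"
proof (rule q_rel_Dsol_short[OF gU a _ X(1) c d])
  have vw: "v \<in> weights" unfolding v using a by simp
  have "qpow h (- \<kappa> a) \<odot>\<^bsub>M\<^esub> M.conjug (gT y \<otimes>\<^bsub>M\<^esub> C) (L a \<otimes>\<^bsub>M\<^esub> L a \<otimes>\<^bsub>M\<^esub> (qpow h e \<odot>\<^bsub>M\<^esub> Lam (- \<alpha> a))) =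
      (qpow h (- \<kappa> a) * (qpow h e * qpow h (y * dot N v v / 2))) \<odot>\<^bsub>M\<^esub> mon v u 0"
    unfolding L_L_root[OF a(1)] v[symmetric]
    using conjug_gT_mult_Lam[OF C vw, of y] C vw by (simp add: M.conjug_smult M.smult_smult u const_elts_closed)
  also have "\<dots> = qpow h (y * dot N v v / 2 + e - \<kappa> a - f) \<odot>\<^bsub>M\<^esub> X 0"
    unfolding X(2) using vw by (simp add: M.smult_smult flip: qpow_add) (simp add: algebra_simps)
  finally show "qpow h (\<kappa> a) \<odot>\<^bsub>M\<^esub> (Dsol a (1 - 1) \<otimes>\<^bsub>M\<^esub> Dsol a (1 + 1)) =
      Dsol a 1 \<otimes>\<^bsub>M\<^esub> Dsol a 1 \<ominus>\<^bsub>M\<^esub> qpow h (y * dot N v v / 2 + e - \<kappa> a - f) \<odot>\<^bsub>M\<^esub> X 0"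
    using rel1 by simp
qed

lemma dot_N:
  "dot N (e_sum N) (e_sum N) = of_nat N" "dot N (e_sum N) (e_vec N) = 1"
  "dot N (e_vec N) (e_sum N) = 1" "dot N (e_vec N) (e_vec N) = 1"
  using N_pos dot_e_vec[OF last_label, of "e_sum N"] dot_e_vec[OF last_label, of "e_vec N"]
  by (simp_all add: dot_e_sum dot_commute[of N "e_vec N" "e_sum N"], simp_all add: e_sum_def e_vec_def)

text \<open>Where R and its dual partner agree, one g_T is a full step for every label, and the
  product of all Pochhammer factors supplies the right linear factor for each.\<close>

lemma advances_full:
  assumes b: "b \<in> {1..N}" and \<omega>: "\<omega> b = \<omega>s b" and r: "0 < r"
    and u: "\<And>a. a \<in> {1..<N} \<Longrightarrow> dot N (\<omega> b) (\<alpha> a) = (if a = b then 1 else 0)"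
      "dot N (\<omega> b) (\<alpha> N) = (if b = N then r else 0)"
  shows "advances (gT 1 \<otimes>\<^bsub>M\<^esub> (G \<otimes>\<^bsub>M\<^esub> inv_qpoch N c (qpow h r))) (\<omega>s b) (\<omega> b)
    ((if b = N then c else 1) \<odot>\<^bsub>M\<^esub> Lam (- \<alpha> b))"
  by (rule advances_gT_mult[OF _ _ _ twist_full[OF b r u]]) (use b \<omega> in auto)

lemma uniform_e_sum_dots:
  assumes "\<omega> b = e_sum b" "b \<in> {1..N}" "a \<in> {1..<N}"
  shows "dot N (\<omega> b) (\<alpha> a) = (if a = b then 1 else 0)"
  using assms by (auto simp: dot_simple_root e_sum_def)

lemma inv_qpoch_one: "a \<in> {1..N} \<Longrightarrow> inv_qpoch a 1 p = inv\<^bsub>M\<^esub> (qpoch M (Lam (- \<alpha> a)) p)"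
  by (simp add: inv_qpoch_def)

lemma advances_one_simp: "(if b = N then 1 else 1) = (1::complex)"
  by simp

lemma D_bar_solution_D1:
  assumes ty: "ty = D1"
  shows "g \<in> Units M \<and> D_bar_solution ty h N Dsol"
proof -
  have N3: "3 \<le> N" using adm by (simp add: ty)
  have long: "\<not> short ty N a" for a by (simp add: short_def ty)
  have root: "(\<lambda>j. - e_vec (N - 1) j - e_vec N j) = - \<alpha> N" "\<alpha> N = e_vec (N - 1) + e_vec N"
    by (simp_all add: ty fun_eq_iff)
  have P: "inv_qpoch N 1 q \<in> Units M" "inv_qpoch N 1 q \<in> carrier M"
    using inv_qpoch_closed[OF last_label norm_qpow_less_1, of 1 1] by (auto intro: const_elts_closed)
  have g: "g = gT 1 \<otimes>\<^bsub>M\<^esub> (G \<otimes>\<^bsub>M\<^esub> inv_qpoch N 1 q)"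
    unfolding g_elt_def Let_def M_def[symmetric] affine_type.case_cong_weak[OF ty] affine_type.case root(1)
      inv_qpoch_one[OF last_label, symmetric]
    using P g_Lam_closed by (simp add: M.m_assoc)
  have w: "\<omega>s a = \<omega> a" for a by (simp add: ty)
  have lab: "e_sum_label a" if "a + 2 \<le> N" for a using that unfolding e_sum_label_def by (simp add: ty)
  have wN: "\<omega> (N - 1) = (\<lambda>j. (1 / 2) * e_sum N j) - e_vec N" "\<omega> N = (\<lambda>j. (1 / 2) * e_sum N j)"
    using N3 by (auto simp: ty fun_eq_iff)
  have kN: "\<kappa> (N - 1) = of_nat N / 4" "\<kappa> N = of_nat N / 4"
    unfolding Lam_num_def w wN dot_simps by (simp_all add: dot_N field_simps)
  have k2: "\<kappa> (N - 2) = of_nat N - 2" and k3: "\<kappa> (N - 3) = of_nat N - 3"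
    using N3 lab[of "N - 2", THEN e_sum_labelD(4)] lab[of "N - 3", THEN e_sum_labelD(4)]
    by (simp_all add: of_nat_diff)
  have dots: "dot N (\<omega> b) (\<alpha> a) = (if a = b then 1 else 0)" if "b \<in> {1..N}" "a \<in> {1..<N}" for a b
    unfolding dot_simple_root[OF that(2)] using that N3
    by (auto simp: ty e_sum_def e_vec_def split: if_splits)
  have dotsN: "dot N (\<omega> b) (\<alpha> N) = (if b = N then 1 else 0)" if "b \<in> {1..N}" for b
  proof -
    have "dot N (\<omega> b) (\<alpha> N) = \<omega> b (N - 1) + \<omega> b N"
      unfolding root(2) dot_add_right using N3 by (simp add: dot_e_vec)
    then show ?thesis using that N3 by (auto simp: ty e_sum_def e_vec_def split: if_splits)
  qed
  have adv: "advances g (\<omega>s a) (\<omega> a) (1 \<odot>\<^bsub>M\<^esub> Lam (- \<alpha> a))" if "a \<in> {1..N}" for a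
    using advances_full[OF that w[symmetric] zero_less_one dots[OF that] dotsN[OF that], of 1]
    unfolding g advances_one_simp by simp
  have gU: "g \<in> Units M" using adv[of N] advancesD(1) N3 by simp
  note ev = Dsol_evolves_simps(1)[OF gU _ disjI1[OF long]]
  have "D_bar_solution ty h N Dsol"
  proof (rule D_bar_solution_Dsol[OF gU])
    show "Dsol a 1 = LT a" if "a \<in> {1..N}" for a
      using long_relation(1)[OF gU that long adv[OF that]] .
    show "q_rel h (opposite M) Dsol (of_nat a) a n 0 (Dsol (a + 1) n \<otimes>\<^bsub>opposite M\<^esub> Dsol (a - 1) n)"
      if "a \<in> {1..N_bar ty N}" for a n
      using that by (intro interior_long gU lab disjI1 long adv) (auto simp: ty)
    fix n
    \<comment> \<open>Multiplication in the opposite algebra reads the three factors of the second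
      term backwards.\<close>
    have ev1: "M.evolves h g (\<kappa> N / 2 + (\<kappa> (N - 1) / 2 + \<kappa> (N - 3) / 2))
        (\<lambda>n. Dsol N n \<otimes>\<^bsub>M\<^esub> (Dsol (N - 1) n \<otimes>\<^bsub>M\<^esub> Dsol (N - 3) n))"
      by (intro M.evolves_mult gU ev) simp_all
    have 1: "q_rel h (opposite M) Dsol (of_nat N - 2) (N - 2) n (- ((of_nat N - 2) * of_int n / 4))
       (Dsol N n \<otimes>\<^bsub>M\<^esub> (Dsol (N - 1) n \<otimes>\<^bsub>M\<^esub> Dsol (N - 3) n))"
    proof (rule q_rel_long_Lam[OF gU _ long adv ev1])
      have "\<omega> N + (\<omega> (N - 1) + \<omega> (N - 3)) = \<omega> (N - 2) + \<omega> (N - 2) - \<alpha> (N - 2)"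
        using N3 by (auto simp: ty fun_eq_iff e_sum_def e_vec_def)
      then show "Dsol N 0 \<otimes>\<^bsub>M\<^esub> (Dsol (N - 1) 0 \<otimes>\<^bsub>M\<^esub> Dsol (N - 3) 0) =
          Lam (\<omega>s (N - 2) + \<omega>s (N - 2) - \<alpha> (N - 2))"
        using N3 by (simp add: Dsol_at_0[OF gU] w Lam_mult)
      \<comment> \<open>The rates are N/8 + N/8 + (N - 3)/2 against N - 2, with difference - (N -
        2)/4.\<close>
      show "- ((of_nat N - 2) * of_int n / 4) =
          of_int n * (\<kappa> N / 2 + (\<kappa> (N - 1) / 2 + \<kappa> (N - 3) / 2) - \<kappa> (N - 2))"
        unfolding kN k2 k3 by (simp add: field_simps)
    qed (use N3 k2 in auto)
    have ev2: "M.evolves h g (\<kappa> (N - 2) / 2) (\<lambda>n. Dsol (N - 2) n)"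
      by (intro ev) simp
    have 2: "q_rel h (opposite M) Dsol (of_nat N / 4) b n ((of_nat N - 4) * of_int n / 4) (Dsol (N - 2) n)"
      if "b \<in> {N - 1, N}" for b
    proof (rule q_rel_long_Lam[OF gU _ long adv ev2])
      have "\<omega> (N - 2) = \<omega> b + \<omega> b - \<alpha> b"
        using N3 that by (auto simp: ty fun_eq_iff e_sum_def e_vec_def)
      then show "Dsol (N - 2) 0 = Lam (\<omega>s b + \<omega>s b - \<alpha> b)"
        using N3 by (simp add: Dsol_at_0[OF gU] w)
      have kb: "\<kappa> b = of_nat N / 4" using that kN by auto
      show "of_nat N / 4 = \<kappa> b" by (simp only: kb)
      show "(of_nat N - 4) * of_int n / 4 = of_int n * (\<kappa> (N - 2) / 2 - \<kappa> b)"
        unfolding kb k2 by (simp add: field_simps)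
    qed (use N3 that in auto)
    have "boundary_rel D1 h N (opposite M) Dsol n"
      using 1 2 by simp
    then show "boundary_rel ty h N (opposite M) Dsol n" by (simp only: ty)
  qed
  with gU show ?thesis ..
qed

lemma inv_qpoch_N_closed:
  assumes "0 < r"
  shows "inv_qpoch N c (qpow h r) \<in> Units M" "inv_qpoch N c (qpow h r) \<in> carrier M"
    "inv_qpoch N c (qpow h r) \<in> const_elts"
  using inv_qpoch_closed[OF last_label norm_qpow_less_1[OF assms], of c] by (auto intro: const_elts_closed)

lemma D_bar_solution_A2odd:
  assumes ty: "ty = A2odd"
  shows "g \<in> Units M \<and> D_bar_solution ty h N Dsol"
proof -
  have long: "\<not> short ty N a" for a by (simp add: short_def ty)
  have root: "(\<lambda>j. - 2 * e_vec N j) = - \<alpha> N" "\<alpha> N = (\<lambda>j. 2 * e_vec N j)"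
    by (simp_all add: ty fun_eq_iff)
  have g: "g = gT 1 \<otimes>\<^bsub>M\<^esub> (G \<otimes>\<^bsub>M\<^esub> inv_qpoch N 1 (qpow h 2))"
    unfolding g_elt_def Let_def M_def[symmetric] affine_type.case_cong_weak[OF ty] affine_type.case root(1)
      inv_qpoch_one[OF last_label, symmetric]
    using inv_qpoch_N_closed[of 2 1] g_Lam_closed by (simp add: M.m_assoc)
  have w: "\<omega>s a = \<omega> a" for a by (simp add: ty)
  have lab: "e_sum_label a" if "a \<le> N" for a using that unfolding e_sum_label_def by (simp add: ty)
  have dots: "dot N (\<omega> b) (\<alpha> a) = (if a = b then 1 else 0)" if "b \<in> {1..N}" "a \<in> {1..<N}" for a b
    using that lab[THEN e_sum_labelD(2)] by (intro uniform_e_sum_dots) auto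
  \<comment> \<open>The root 2 e_N meets a weight with last coordinate 1; the pairing 2 is the
    exponent of the base q^2.\<close>
  have dotsN: "dot N (\<omega> b) (\<alpha> N) = (if b = N then 2 else 0)" if "b \<in> {1..N}" for b
    unfolding root(2) dot_scale_right dot_e_vec[OF last_label] using that by (auto simp: ty e_sum_def)
  have adv: "advances g (\<omega>s a) (\<omega> a) (1 \<odot>\<^bsub>M\<^esub> Lam (- \<alpha> a))" if "a \<in> {1..N}" for a
    using advances_full[OF that w[symmetric] _ dots[OF that] dotsN[OF that], of 1]
    unfolding g advances_one_simp by simp
  have gU: "g \<in> Units M" using adv[of N] advancesD(1) N_pos by simp
  note ev = Dsol_evolves_simps(1)[OF gU _ disjI1[OF long]]
  have "D_bar_solution ty h N Dsol"
  proof (rule D_bar_solution_Dsol[OF gU])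
    show "Dsol a 1 = LT a" if "a \<in> {1..N}" for a
      using long_relation(1)[OF gU that long adv[OF that]] .
    show "q_rel h (opposite M) Dsol (of_nat a) a n 0 (Dsol (a + 1) n \<otimes>\<^bsub>opposite M\<^esub> Dsol (a - 1) n)"
      if "a \<in> {1..N_bar ty N}" for a n
      using that by (intro interior_long gU lab disjI1 long adv) (auto simp: ty)
    fix n
    have ev1: "M.evolves h g (\<kappa> (N - 1) / 2 + \<kappa> (N - 1) / 2) (\<lambda>n. Dsol (N - 1) n \<otimes>\<^bsub>M\<^esub> Dsol (N - 1) n)"
      by (intro M.evolves_mult gU ev) simp_all
    have 1: "q_rel h (opposite M) Dsol (of_nat N) N n (- of_int n) (Dsol (N - 1) n \<otimes>\<^bsub>M\<^esub> Dsol (N - 1) n)"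
    proof (rule q_rel_long_Lam[OF gU last_label long adv[OF last_label] ev1])
      have "\<omega> (N - 1) + \<omega> (N - 1) = \<omega> N + \<omega> N - \<alpha> N"
        using N_pos by (auto simp: ty fun_eq_iff e_sum_def e_vec_def)
      then show "Dsol (N - 1) 0 \<otimes>\<^bsub>M\<^esub> Dsol (N - 1) 0 = Lam (\<omega>s N + \<omega>s N - \<alpha> N)"
        by (simp add: Dsol_at_0[OF gU] w Lam_mult)
      have k: "\<kappa> N = of_nat N" "\<kappa> (N - 1) = of_nat N - 1"
        using N_pos lab[THEN e_sum_labelD(4)] by (simp_all add: of_nat_diff)
      show "of_nat N = \<kappa> N" by (simp only: k)
      show "- of_int n = of_int n * (\<kappa> (N - 1) / 2 + \<kappa> (N - 1) / 2 - \<kappa> N)"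
        unfolding k by (simp add: field_simps)
    qed
    have "boundary_rel A2odd h N (opposite M) Dsol n"
      using 1 by (simp add: Dsol_closed[OF gU])
    then show "boundary_rel ty h N (opposite M) Dsol n" by (simp only: ty)
  qed
  with gU show ?thesis ..
qed

lemma D_bar_solution_D2:
  assumes ty: "ty = D2"
  shows "g \<in> Units M \<and> D_bar_solution ty h N Dsol"
proof -
  have N2: "2 \<le> N" using adm by (simp add: ty)
  have long: "\<not> short ty N a" for a by (simp add: short_def ty)
  have root: "(\<lambda>j. - e_vec N j) = - \<alpha> N" "\<alpha> N = e_vec N"
    by (simp_all add: ty fun_eq_iff)
  have g: "g = gT 1 \<otimes>\<^bsub>M\<^esub> (G \<otimes>\<^bsub>M\<^esub> inv_qpoch N 1 (qpow h (1 / 2)))"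
    unfolding g_elt_def Let_def M_def[symmetric] affine_type.case_cong_weak[OF ty] affine_type.case root(1)
      inv_qpoch_one[OF last_label, symmetric]
    using inv_qpoch_N_closed[of "1 / 2" 1] g_Lam_closed by (simp add: M.m_assoc)
  have w: "\<omega>s a = \<omega> a" for a by (simp add: ty)
  have lab: "e_sum_label a" if "a < N" for a using that unfolding e_sum_label_def by (simp add: ty)
  have wN: "\<omega> N = (\<lambda>j. (1 / 2) * e_sum N j)" by (simp add: ty fun_eq_iff)
  have kN: "\<kappa> N = of_nat N / 4"
    unfolding Lam_num_def w wN dot_simps by (simp add: dot_N)
  have k: "\<kappa> (N - 1) = of_nat N - 1" "\<kappa> (N - 2) = of_nat N - 2"
    using N2 lab[THEN e_sum_labelD(4)] by (simp_all add: of_nat_diff)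
  have dots: "dot N (\<omega> b) (\<alpha> a) = (if a = b then 1 else 0)" if "b \<in> {1..N}" "a \<in> {1..<N}" for a b
    unfolding dot_simple_root[OF that(2)] using that by (auto simp: ty e_sum_def split: if_splits)
  \<comment> \<open>The half-sum weight has last coordinate 1/2, whence the base q^(1/2).\<close>
  have dotsN: "dot N (\<omega> b) (\<alpha> N) = (if b = N then 1 / 2 else 0)" if "b \<in> {1..N}" for b
    unfolding root(2) dot_e_vec[OF last_label] using that by (auto simp: ty e_sum_def)
  have adv: "advances g (\<omega>s a) (\<omega> a) (1 \<odot>\<^bsub>M\<^esub> Lam (- \<alpha> a))" if "a \<in> {1..N}" for a
    using advances_full[OF that w[symmetric] _ dots[OF that] dotsN[OF that], of 1]
    unfolding g advances_one_simp by simp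
  have gU: "g \<in> Units M" using adv[of N] advancesD(1) N_pos by simp
  note ev = Dsol_evolves_simps(1)[OF gU _ disjI1[OF long]]
  have "D_bar_solution ty h N Dsol"
  proof (rule D_bar_solution_Dsol[OF gU])
    show "Dsol a 1 = LT a" if "a \<in> {1..N}" for a
      using long_relation(1)[OF gU that long adv[OF that]] .
    show "q_rel h (opposite M) Dsol (of_nat a) a n 0 (Dsol (a + 1) n \<otimes>\<^bsub>opposite M\<^esub> Dsol (a - 1) n)"
      if "a \<in> {1..N_bar ty N}" for a n
      using that by (intro interior_long gU lab disjI1 long adv) (auto simp: ty)
    fix n
    have ev1: "M.evolves h g (\<kappa> N / 2 + \<kappa> N / 2 + \<kappa> (N - 2) / 2)
        (\<lambda>n. Dsol N n \<otimes>\<^bsub>M\<^esub> Dsol N n \<otimes>\<^bsub>M\<^esub> Dsol (N - 2) n)"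
      by (intro M.evolves_mult gU ev) simp_all
    have 1: "q_rel h (opposite M) Dsol (of_nat N - 1) (N - 1) n (- (of_nat N * of_int n / 4))
        (Dsol N n \<otimes>\<^bsub>M\<^esub> Dsol N n \<otimes>\<^bsub>M\<^esub> Dsol (N - 2) n)"
    proof (rule q_rel_long_Lam[OF gU _ long adv ev1])
      have "\<omega> N + \<omega> N + \<omega> (N - 2) = \<omega> (N - 1) + \<omega> (N - 1) - \<alpha> (N - 1)"
        using N2 by (auto simp: ty fun_eq_iff e_sum_def e_vec_def)
      then show "Dsol N 0 \<otimes>\<^bsub>M\<^esub> Dsol N 0 \<otimes>\<^bsub>M\<^esub> Dsol (N - 2) 0 = Lam (\<omega>s (N - 1) + \<omega>s (N - 1) - \<alpha> (N - 1))"
        by (simp add: Dsol_at_0[OF gU] w Lam_mult)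
      show "of_nat N - 1 = \<kappa> (N - 1)" by (simp only: k)
      show "- (of_nat N * of_int n / 4) = of_int n * (\<kappa> N / 2 + \<kappa> N / 2 + \<kappa> (N - 2) / 2 - \<kappa> (N - 1))"
        unfolding k kN by (simp add: field_simps)
    qed (use N2 in auto)
    have ev2: "M.evolves h g (\<kappa> (N - 1) / 2) (\<lambda>n. Dsol (N - 1) n)"
      by (intro ev) simp
    have 2: "q_rel h (opposite M) Dsol (of_nat N / 4) N n ((of_nat N - 2) * of_int n / 4) (Dsol (N - 1) n)"
    proof (rule q_rel_long_Lam[OF gU last_label long adv[OF last_label] ev2])
      have "\<omega> (N - 1) = \<omega> N + \<omega> N - \<alpha> N"
        using N2 by (auto simp: ty fun_eq_iff e_sum_def e_vec_def)
      then show "Dsol (N - 1) 0 = Lam (\<omega>s N + \<omega>s N - \<alpha> N)"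
        by (simp add: Dsol_at_0[OF gU] w)
      show "of_nat N / 4 = \<kappa> N" by (simp only: kN)
      show "(of_nat N - 2) * of_int n / 4 = of_int n * (\<kappa> (N - 1) / 2 - \<kappa> N)"
        unfolding k kN by (simp add: field_simps)
    qed
    have "boundary_rel D2 h N (opposite M) Dsol n"
      using 1 2 by (simp add: Dsol_closed[OF gU])
    then show "boundary_rel ty h N (opposite M) Dsol n" by (simp only: ty)
  qed
  with gU show ?thesis ..
qed

text \<open>Every label is short, and the two steps in \<open>g\<close> differ only by the scalar
  q^(1/2) in the last Pochhammer factor. That scalar enters the equation of label N at odd times
  alone.\<close>

lemma D_bar_solution_A2even:
  assumes ty: "ty = A2even"
  shows "g \<in> Units M \<and> D_bar_solution ty h N Dsol"
proof -
  have short: "short ty N a" for a by (simp add: short_def ty)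
  have root: "(\<lambda>j. - e_vec N j) = - \<alpha> N" "\<alpha> N = e_vec N"
    by (simp_all add: ty fun_eq_iff)
  define C where "C = G \<otimes>\<^bsub>M\<^esub> inv_qpoch N 1 q"
  define C' where "C' = G \<otimes>\<^bsub>M\<^esub> inv_qpoch N (qpow h (1 / 2)) q"
  define S where "S = gT 1 \<otimes>\<^bsub>M\<^esub> C"
  define S' where "S' = gT 1 \<otimes>\<^bsub>M\<^esub> C'"
  note P = inv_qpoch_N_closed[OF zero_less_one]
  have C': "C' \<in> const_elts" "C' \<in> Units M"
    using P g_Lam_closed by (simp_all add: C'_def)
  \<comment> \<open>The trailing unit fits \<open>g\<close> to the three factors of
    \<open>short_relation\<close>.\<close>
  have g: "g = S' \<otimes>\<^bsub>M\<^esub> S \<otimes>\<^bsub>M\<^esub> \<one>\<^bsub>M\<^esub>"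
    unfolding g_elt_def Let_def M_def[symmetric] affine_type.case_cong_weak[OF ty] affine_type.case root(1)
      inv_qpoch_one[OF last_label, symmetric] inv_qpoch_def[symmetric] S_def S'_def C_def C'_def
    using P g_Lam_closed by (simp add: M.m_assoc)
  have w: "\<omega>s a = \<omega> a" for a by (simp add: ty)
  have lab: "e_sum_label a" if "a \<le> N" for a using that unfolding e_sum_label_def by (simp add: ty)
  have k: "\<kappa> N = of_nat N" "\<kappa> (N - 1) = of_nat N - 1"
    using N_pos lab[THEN e_sum_labelD(4)] by (simp_all add: of_nat_diff)
  have dots: "dot N (\<omega> b) (\<alpha> a) = (if a = b then 1 else 0)" if "b \<in> {1..N}" "a \<in> {1..<N}" for a b
    using that lab[THEN e_sum_labelD(2)] by (intro uniform_e_sum_dots) auto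
  have dotsN: "dot N (\<omega> b) (\<alpha> N) = (if b = N then 1 else 0)" if "b \<in> {1..N}" for b
    unfolding root(2) dot_e_vec[OF last_label] using that by (auto simp: ty e_sum_def)
  have S: "advances S (\<omega>s a) (\<omega> a) (1 \<odot>\<^bsub>M\<^esub> Lam (- \<alpha> a))" if "a \<in> {1..N}" for a
    using advances_full[OF that w[symmetric] zero_less_one dots[OF that] dotsN[OF that], of 1]
    unfolding S_def C_def advances_one_simp by simp
  have S': "advances S' (\<omega>s a) (\<omega> a) ((if a = N then qpow h (1 / 2) else 1) \<odot>\<^bsub>M\<^esub> Lam (- \<alpha> a))"
    if "a \<in> {1..N}" for a
    using advances_full[OF that w[symmetric] zero_less_one dots[OF that] dotsN[OF that], of "qpow h (1 / 2)"]
    unfolding S'_def C'_def by simp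
  have gU: "g \<in> Units M"
    unfolding g using advancesD(1)[OF S[OF last_label]] advancesD(1)[OF S'[OF last_label]] by simp
  have rel: "Dsol a 1 = LT a"
    "qpow h (\<kappa> a) \<odot>\<^bsub>M\<^esub> (Dsol a (-1) \<otimes>\<^bsub>M\<^esub> Dsol a 1) =
      Dsol a 0 \<otimes>\<^bsub>M\<^esub> Dsol a 0 \<ominus>\<^bsub>M\<^esub> L a \<otimes>\<^bsub>M\<^esub> L a \<otimes>\<^bsub>M\<^esub> (1 \<odot>\<^bsub>M\<^esub> Lam (- \<alpha> a))"
    "qpow h (\<kappa> a) \<odot>\<^bsub>M\<^esub> (Dsol a 0 \<otimes>\<^bsub>M\<^esub> Dsol a 2) =
      Dsol a 1 \<otimes>\<^bsub>M\<^esub> Dsol a 1 \<ominus>\<^bsub>M\<^esub> qpow h (- \<kappa> a) \<odot>\<^bsub>M\<^esub> M.conjug (gT 1 \<otimes>\<^bsub>M\<^esub> C')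
        (L a \<otimes>\<^bsub>M\<^esub> L a \<otimes>\<^bsub>M\<^esub> ((if a = N then qpow h (1 / 2) else 1) \<odot>\<^bsub>M\<^esub> Lam (- \<alpha> a)))"
    if a: "a \<in> {1..N}" for a
  proof -
    have "M.conjug (inv\<^bsub>M\<^esub> S) (L a) \<in> carrier M" using a advancesD(1)[OF S[OF a]] by simp
    then have "\<one>\<^bsub>M\<^esub> \<otimes>\<^bsub>M\<^esub> M.conjug (inv\<^bsub>M\<^esub> S) (L a) = M.conjug (inv\<^bsub>M\<^esub> S) (L a) \<otimes>\<^bsub>M\<^esub> \<one>\<^bsub>M\<^esub>" by simp
    from short_relation[OF gU a short g S[OF a] S'[OF a] M.Units_one_closed one_const_elts this]
    show "Dsol a 1 = LT a"
      "qpow h (\<kappa> a) \<odot>\<^bsub>M\<^esub> (Dsol a (-1) \<otimes>\<^bsub>M\<^esub> Dsol a 1) =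
        Dsol a 0 \<otimes>\<^bsub>M\<^esub> Dsol a 0 \<ominus>\<^bsub>M\<^esub> L a \<otimes>\<^bsub>M\<^esub> L a \<otimes>\<^bsub>M\<^esub> (1 \<odot>\<^bsub>M\<^esub> Lam (- \<alpha> a))"
      "qpow h (\<kappa> a) \<odot>\<^bsub>M\<^esub> (Dsol a 0 \<otimes>\<^bsub>M\<^esub> Dsol a 2) =
        Dsol a 1 \<otimes>\<^bsub>M\<^esub> Dsol a 1 \<ominus>\<^bsub>M\<^esub> qpow h (- \<kappa> a) \<odot>\<^bsub>M\<^esub> M.conjug (gT 1 \<otimes>\<^bsub>M\<^esub> C')
          (L a \<otimes>\<^bsub>M\<^esub> L a \<otimes>\<^bsub>M\<^esub> ((if a = N then qpow h (1 / 2) else 1) \<odot>\<^bsub>M\<^esub> Lam (- \<alpha> a)))"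
      unfolding S'_def .
  qed
  note ev = Dsol_evolves_simps(3,4)[OF gU _ disjI1[OF short]]
  have "D_bar_solution ty h N Dsol"
  proof (rule D_bar_solution_Dsol[OF gU rel(1)])
    show "q_rel h (opposite M) Dsol (of_nat a) a n 0 (Dsol (a + 1) n \<otimes>\<^bsub>opposite M\<^esub> Dsol (a - 1) n)"
      if "a \<in> {1..N_bar ty N}" for a n
    proof -
      have a: "1 \<le> a" "a + 1 \<le> N" "a \<in> {1..N}" "a \<noteq> N" using that by (auto simp: ty)
      show ?thesis
        using a rel(3)[OF a(3)]
        by (intro interior_short[OF gU a(1) lab lab lab short disjI1[OF short] short rel(2) C'] rel(1)) auto
    qed
    fix n
    have v: "\<omega> N + \<omega> (N - 1) = \<omega> N + \<omega> N - \<alpha> N"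
      using N_pos by (auto simp: ty fun_eq_iff e_sum_def e_vec_def)
    have ev1: "M.evolves h g (\<kappa> N + \<kappa> (N - 1)) (\<lambda>n. Dsol N (2 * n) \<otimes>\<^bsub>M\<^esub> Dsol (N - 1) (2 * n))"
      by (intro M.evolves_mult gU ev) simp_all
    have 1: "q_rel h (opposite M) Dsol (of_nat N) N (2 * n) (- of_int n)
        (Dsol N (2 * n) \<otimes>\<^bsub>M\<^esub> Dsol (N - 1) (2 * n))"
    proof (rule q_rel_short_even_Lam[OF gU last_label short rel(2)[OF last_label] ev1])
      show "Dsol N (2 * 0) \<otimes>\<^bsub>M\<^esub> Dsol (N - 1) (2 * 0) = Lam (\<omega>s N + \<omega>s N - \<alpha> N)"
        unfolding w v[symmetric] by (simp add: Dsol_at_0[OF gU] w Lam_mult)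
      show "of_nat N = \<kappa> N" by (simp only: k)
      show "- of_int n = of_int n * (\<kappa> N + \<kappa> (N - 1) - 2 * \<kappa> N)"
        unfolding k by (simp add: field_simps)
    qed
    have ev2: "M.evolves h g (\<kappa> N + \<kappa> (N - 1)) (\<lambda>n. Dsol N (2 * n + 1) \<otimes>\<^bsub>M\<^esub> Dsol (N - 1) (2 * n + 1))"
      by (intro M.evolves_mult gU ev) simp_all
    have 2: "q_rel h (opposite M) Dsol (of_nat N) N (2 * n + 1) (- of_int n)
        (Dsol N (2 * n + 1) \<otimes>\<^bsub>M\<^esub> Dsol (N - 1) (2 * n + 1))"
    proof (rule q_rel_short_odd_mon[OF gU last_label short C'])
      show "qpow h (\<kappa> N) \<odot>\<^bsub>M\<^esub> (Dsol N 0 \<otimes>\<^bsub>M\<^esub> Dsol N 2) =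
        Dsol N 1 \<otimes>\<^bsub>M\<^esub> Dsol N 1 \<ominus>\<^bsub>M\<^esub> qpow h (- \<kappa> N) \<odot>\<^bsub>M\<^esub> M.conjug (gT 1 \<otimes>\<^bsub>M\<^esub> C')
          (L N \<otimes>\<^bsub>M\<^esub> L N \<otimes>\<^bsub>M\<^esub> (qpow h (1 / 2) \<odot>\<^bsub>M\<^esub> Lam (- \<alpha> N)))"
        using rel(3)[OF last_label] by simp
      show "\<omega> N + \<omega> (N - 1) = \<omega>s N + \<omega>s N - \<alpha> N" unfolding w v ..
      show "\<omega> N + \<omega> (N - 1) = (\<lambda>j. 1 * (\<omega> N + \<omega> (N - 1)) j)" by (simp add: fun_eq_iff)
      have "Dsol (N - 1) 1 = LT (N - 1)"
        using rel(1)[of "N - 1"] Dsol_at_1_0[OF gU] N_pos by (cases "N = 1") auto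
      then have "Dsol N 1 \<otimes>\<^bsub>M\<^esub> Dsol (N - 1) 1 = qpow h (dot N (\<omega> N) (\<omega> (N - 1))) \<odot>\<^bsub>M\<^esub>
          mon (\<omega> N + \<omega> (N - 1)) (\<omega> N + \<omega> (N - 1)) 0"
        using rel(1)[OF last_label] by (simp add: w Lam_Tp mon_mult)
      also have "dot N (\<omega> N) (\<omega> (N - 1)) = of_nat N - 1"
        using N_pos lab[THEN e_sum_labelD(2)] by (simp add: dot_e_sum of_nat_diff)
      finally show "Dsol N (2 * 0 + 1) \<otimes>\<^bsub>M\<^esub> Dsol (N - 1) (2 * 0 + 1) =
          qpow h (of_nat N - 1) \<odot>\<^bsub>M\<^esub> mon (\<omega> N + \<omega> (N - 1)) (\<omega> N + \<omega> (N - 1)) 0"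
        by (simp only: mult_zero_right add_0)
      show "of_nat N = \<kappa> N" by (simp only: k)
      \<comment> \<open>Without the scalar the constant would be (4 N - 3)/2 - N - (N - 1) = -1/2.
        The q^(1/2) in S' cancels it, so even and odd times share the prefactor q^(-n).\<close>
      have "dot N (\<omega> N + \<omega> (N - 1)) (\<omega> N + \<omega> (N - 1)) = 4 * of_nat N - 3"
        using N_pos lab[THEN e_sum_labelD(2)] by (simp add: dot_simps dot_e_sum of_nat_diff)
      then show "- of_int n = 1 * dot N (\<omega> N + \<omega> (N - 1)) (\<omega> N + \<omega> (N - 1)) / 2 + 1 / 2 - \<kappa> N -
          (of_nat N - 1) + of_int n * (\<kappa> N + \<kappa> (N - 1) - 2 * \<kappa> N)"
        unfolding k by (simp add: field_simps)
    qed (rule ev2)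
    have "boundary_rel A2even h N (opposite M) Dsol n"
      using 1 2 by (simp add: Dsol_closed[OF gU])
    then show "boundary_rel ty h N (opposite M) Dsol n" by (simp only: ty)
  qed
  with gU show ?thesis ..
qed

lemma nat_pow_2: "x \<in> carrier M \<Longrightarrow> x [^]\<^bsub>M\<^esub> (2::nat) = x \<otimes>\<^bsub>M\<^esub> x"
  by (simp add: numeral_2_eq_2)

lemma gT_mult_commutes_Tp:
  assumes "twist C u \<one>\<^bsub>M\<^esub>"
  shows "gT y \<otimes>\<^bsub>M\<^esub> C \<otimes>\<^bsub>M\<^esub> Tp u = Tp u \<otimes>\<^bsub>M\<^esub> (gT y \<otimes>\<^bsub>M\<^esub> C)"
proof -
  note [simp] = twistD(2)[OF assms]
  have "gT y \<otimes>\<^bsub>M\<^esub> C \<otimes>\<^bsub>M\<^esub> Tp u = gT y \<otimes>\<^bsub>M\<^esub> Tp u \<otimes>\<^bsub>M\<^esub> C"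
    using twistD(6)[OF assms] by (simp add: M.m_assoc)
  then show ?thesis by (simp add: gT_Tp M.m_assoc)
qed

text \<open>Two Gaussian factors make one step when the ratio of u to z is 2 y. This is the long
  case of the types with two equal steps: y = 1/2 for the labels below N in B1, and y = 1 for label
  N in C1.\<close>

lemma advances_square_mult:
  assumes C: "twist C t \<one>\<^bsub>M\<^esub>" and z: "z \<in> weights" "t = (\<lambda>j. y * z j)"
    and u: "u = t + t" and x: "x \<in> const_elts" and R: "twist R u (\<one>\<^bsub>M\<^esub> \<ominus>\<^bsub>M\<^esub> x)"
  shows "advances ((gT y \<otimes>\<^bsub>M\<^esub> C) \<otimes>\<^bsub>M\<^esub> (gT y \<otimes>\<^bsub>M\<^esub> C) \<otimes>\<^bsub>M\<^esub> R) z u x"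
proof (rule advances_mult[OF _ _ _ z(1) x R])
  let ?S = "gT y \<otimes>\<^bsub>M\<^esub> C"
  have S: "?S \<in> Units M" "?S \<in> carrier M" using twistD(2,3)[OF C] by simp_all
  have comm: "?S \<otimes>\<^bsub>M\<^esub> Tp t = Tp t \<otimes>\<^bsub>M\<^esub> ?S" by (rule gT_mult_commutes_Tp[OF C])
  have SL: "M.conjug ?S (Lam z) = qpow h (y * dot N z z / 2) \<odot>\<^bsub>M\<^esub> (Lam z \<otimes>\<^bsub>M\<^esub> Tp t)"
    using conjug_gT_mult_Lam[OF twistD(1,3)[OF C] z(1)] z by (simp add: Lam_Tp)
  have dot: "dot N z u / 2 = y * dot N z z / 2 + y * dot N z z / 2"
    unfolding u z(2) dot_add_right dot_scale_right by simp
  show "?S \<otimes>\<^bsub>M\<^esub> ?S \<in> Units M" using S by simp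
  show "M.conjug (?S \<otimes>\<^bsub>M\<^esub> ?S) (Lam z) = qpow h (dot N z u / 2) \<odot>\<^bsub>M\<^esub> (Lam z \<otimes>\<^bsub>M\<^esub> Tp u)"
    using M.square_step[OF S(1) _ _ SL comm] z(1) unfolding dot qpow_add by (simp add: Tp_mult u)
  have "M.conjug ?S (Tp t) = Tp t" using S comm by (simp add: M.conjug_eq_iff)
  then have "M.conjug (?S \<otimes>\<^bsub>M\<^esub> ?S) (Tp t \<otimes>\<^bsub>M\<^esub> Tp t) = Tp t \<otimes>\<^bsub>M\<^esub> Tp t"
    using S by (simp add: M.conjug_conjug M.conjug_mult)
  then have "?S \<otimes>\<^bsub>M\<^esub> ?S \<otimes>\<^bsub>M\<^esub> (Tp t \<otimes>\<^bsub>M\<^esub> Tp t) = Tp t \<otimes>\<^bsub>M\<^esub> Tp t \<otimes>\<^bsub>M\<^esub> (?S \<otimes>\<^bsub>M\<^esub> ?S)"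
    using S by (simp add: M.conjug_eq_iff)
  then show "?S \<otimes>\<^bsub>M\<^esub> ?S \<otimes>\<^bsub>M\<^esub> Tp u = Tp u \<otimes>\<^bsub>M\<^esub> (?S \<otimes>\<^bsub>M\<^esub> ?S)"
    by (simp only: Tp_mult u)
qed

text \<open>Label N moves at each factor S, whose half Gaussian matches \<omega> N = (\<omega>s
  N)/2, and does not see \<open>g_Lam\<close>. For the labels below N the two half Gaussians form
  one step, the last Pochhammer factor is invisible, and \<open>g_Lam\<close> supplies the linear
  factor.\<close>

lemma D_bar_solution_B1:
  assumes ty: "ty = B1"
  shows "g \<in> Units M \<and> D_bar_solution ty h N Dsol"
proof -
  have N2: "2 \<le> N" using adm by (simp add: ty)
  have short: "short ty N N" and long: "a < N \<Longrightarrow> \<not> short ty N a" for a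
    by (simp_all add: short_def ty)
  have root: "(\<lambda>j. - 2 * e_vec N j) = - \<alpha> N" "\<alpha> N = (\<lambda>j. 2 * e_vec N j)"
    by (simp_all add: ty fun_eq_iff)
  define C where "C = inv_qpoch N 1 q"
  define S where "S = gT (1 / 2) \<otimes>\<^bsub>M\<^esub> C"
  have C: "C \<in> const_elts" "C \<in> Units M" "C \<in> carrier M"
    using inv_qpoch_N_closed[OF zero_less_one] by (simp_all add: C_def)
  have g: "g = S \<otimes>\<^bsub>M\<^esub> S \<otimes>\<^bsub>M\<^esub> G"
    unfolding g_elt_def Let_def M_def[symmetric] affine_type.case_cong_weak[OF ty] affine_type.case root(1)
      inv_qpoch_one[OF last_label, symmetric] S_def C_def[symmetric]
    using C g_Lam_closed by (simp add: nat_pow_2)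
  have lab: "e_sum_label a" if "a < N" for a using that unfolding e_sum_label_def by (simp add: ty)
  note lw = lab[THEN e_sum_labelD(2)] lab[THEN e_sum_labelD(3)]
  have wN: "\<omega> N = (\<lambda>j. (1 / 2) * e_sum N j)" "\<omega>s N = e_sum N" by (simp_all add: ty fun_eq_iff)
  have kN: "\<kappa> N = of_nat N / 2"
    unfolding Lam_num_def wN dot_simps by (simp add: dot_N)
  have k: "\<kappa> (N - 1) = of_nat N - 1" "\<kappa> (N - 2) = of_nat N - 2"
    using N2 lab[THEN e_sum_labelD(4)] by (simp_all add: of_nat_diff)
  have twist_C: "twist C u \<one>\<^bsub>M\<^esub>" if "u N = 0" for u
    unfolding C_def using that
    by (intro twist_inv_qpoch_trivial[OF last_label norm_qpow_less_1])
      (simp_all add: root(2) dot_scale_right dot_e_vec[OF last_label])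
  have twist_C_N: "twist C (\<omega> N) (\<one>\<^bsub>M\<^esub> \<ominus>\<^bsub>M\<^esub> 1 \<odot>\<^bsub>M\<^esub> Lam (- \<alpha> N))"
    unfolding C_def
    by (rule twist_inv_qpoch[OF last_label norm_qpow_less_1])
      (use N_pos in \<open>simp_all add: root(2) dot_scale_right dot_e_vec[OF last_label] wN e_sum_def\<close>)
  have dots: "dot N (\<omega> b) (\<alpha> a) = (if a = b then 1 else 0)" if "b \<in> {1..N}" "a \<in> {1..<N}" for a b
    unfolding dot_simple_root[OF that(2)] using that by (auto simp: ty e_sum_def split: if_splits)
  have adv: "advances g (\<omega>s a) (\<omega> a) (1 \<odot>\<^bsub>M\<^esub> Lam (- \<alpha> a))" if a: "a \<in> {1..N}" "a < N" for a
    unfolding g S_def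
  proof (rule advances_square_mult)
    show "twist C (\<lambda>j. (1 / 2) * \<omega>s a j) \<one>\<^bsub>M\<^esub>"
      using a by (intro twist_C) (simp add: ty e_sum_def)
    show "\<omega> a = (\<lambda>j. (1 / 2) * \<omega>s a j) + (\<lambda>j. (1 / 2) * \<omega>s a j)"
      using a by (simp add: ty fun_eq_iff)
    show "twist G (\<omega> a) (\<one>\<^bsub>M\<^esub> \<ominus>\<^bsub>M\<^esub> 1 \<odot>\<^bsub>M\<^esub> Lam (- \<alpha> a))"
      using a twist_g_Lam[of "\<omega> a" a] dots[OF a(1)] by simp
  qed (use a in simp_all)
  have S: "advances S (\<omega>s N) (\<omega> N) (1 \<odot>\<^bsub>M\<^esub> Lam (- \<alpha> N))"
    unfolding S_def by (rule advances_gT_mult[OF _ _ _ twist_C_N]) (simp_all add: wN last_label[simplified])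
  have gU: "g \<in> Units M"
    unfolding g using advancesD(1)[OF S] g_Lam_closed by simp
  have G: "twist G (\<omega> N) \<one>\<^bsub>M\<^esub>"
    using dots[OF last_label] by (intro twist_g_Lam_trivial) auto
  note rel = short_relation[OF gU last_label short g S S g_Lam_closed(2,1) twist_trivial_commutes[OF S G]]
  have D1: "Dsol a 1 = LT a" if "a \<in> {1..N}" for a
    using that rel(1) long_relation(1)[OF gU that long adv[OF that]] by (cases "a = N") auto
  note evl = Dsol_evolves_simps(1,2)[OF gU _ disjI1[OF long]]
  note evs = Dsol_evolves_simps(3,4)[OF gU _ disjI1[OF short]]
  have "D_bar_solution ty h N Dsol"
  proof (rule D_bar_solution_Dsol[OF gU D1])
    show "q_rel h (opposite M) Dsol (of_nat a) a n 0 (Dsol (a + 1) n \<otimes>\<^bsub>opposite M\<^esub> Dsol (a - 1) n)"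
      if "a \<in> {1..N_bar ty N}" for a n
      using that by (intro interior_long gU lab disjI1 long adv) (auto simp: ty)
    fix n
    have ev1: "M.evolves h g (\<kappa> N + \<kappa> (N - 2) / 2) (\<lambda>n. Dsol N (2 * n) \<otimes>\<^bsub>M\<^esub> Dsol (N - 2) n)"
      using N2 by (intro M.evolves_mult gU evl evs) simp_all
    have 1: "q_rel h (opposite M) Dsol (of_nat N - 1) (N - 1) n 0 (Dsol N (2 * n) \<otimes>\<^bsub>M\<^esub> Dsol (N - 2) n)"
    proof (rule q_rel_long_Lam[OF gU _ long adv ev1])
      have "\<omega>s N + \<omega>s (N - 2) = \<omega>s (N - 1) + \<omega>s (N - 1) - \<alpha> (N - 1)"
        using N2 by (auto simp: ty fun_eq_iff e_sum_def e_vec_def)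
      then show "Dsol N (2 * 0) \<otimes>\<^bsub>M\<^esub> Dsol (N - 2) 0 = Lam (\<omega>s (N - 1) + \<omega>s (N - 1) - \<alpha> (N - 1))"
        by (simp add: Dsol_at_0[OF gU] Lam_mult)
      show "of_nat N - 1 = \<kappa> (N - 1)" by (simp only: k)
      show "0 = of_int n * (\<kappa> N + \<kappa> (N - 2) / 2 - \<kappa> (N - 1))"
        unfolding k kN by (simp add: field_simps)
    qed (use N2 in auto)
    have v: "e_sum (N - 1) + e_sum (N - 1) = \<omega>s N + \<omega>s N - \<alpha> N"
      using N2 by (auto simp: ty fun_eq_iff e_sum_def e_vec_def)
    have w1: "\<omega>s (N - 1) = e_sum (N - 1)" "\<omega> (N - 1) = e_sum (N - 1)"
      using N2 lw by auto
    have ev2: "M.evolves h g (\<kappa> (N - 1) / 2 + \<kappa> (N - 1) / 2) (\<lambda>n. Dsol (N - 1) n \<otimes>\<^bsub>M\<^esub> Dsol (N - 1) n)"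
      using N2 by (intro M.evolves_mult gU evl) simp_all
    have 2: "q_rel h (opposite M) Dsol (of_nat N / 2) N (2 * n) (- of_int n)
        (Dsol (N - 1) n \<otimes>\<^bsub>M\<^esub> Dsol (N - 1) n)"
    proof (rule q_rel_short_even_Lam[OF gU last_label short rel(2) ev2])
      show "Dsol (N - 1) 0 \<otimes>\<^bsub>M\<^esub> Dsol (N - 1) 0 = Lam (\<omega>s N + \<omega>s N - \<alpha> N)"
        unfolding v[symmetric] by (simp add: Dsol_at_0[OF gU] w1[simplified] Lam_mult)
      show "of_nat N / 2 = \<kappa> N" by (simp only: kN)
      show "- of_int n = of_int n * (\<kappa> (N - 1) / 2 + \<kappa> (N - 1) / 2 - 2 * \<kappa> N)"
        unfolding k kN by (simp add: field_simps)
    qed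
    have ev3: "M.evolves h g (\<kappa> (N - 1) / 2 + \<kappa> (N - 1) / 2) (\<lambda>n. Dsol (N - 1) n \<otimes>\<^bsub>M\<^esub> Dsol (N - 1) (n + 1))"
      using N2 by (intro M.evolves_mult gU evl) simp_all
    let ?v = "e_sum (N - 1) + e_sum (N - 1)"
    have 3: "q_rel h (opposite M) Dsol (of_nat N / 2) N (2 * n + 1) (of_nat N / 2 - of_int n - 1)
        (Dsol (N - 1) n \<otimes>\<^bsub>M\<^esub> Dsol (N - 1) (n + 1))"
    proof (rule q_rel_short_odd_mon[OF gU last_label short C(1,2) _ v _ ev3])
      show "qpow h (\<kappa> N) \<odot>\<^bsub>M\<^esub> (Dsol N 0 \<otimes>\<^bsub>M\<^esub> Dsol N 2) =
        Dsol N 1 \<otimes>\<^bsub>M\<^esub> Dsol N 1 \<ominus>\<^bsub>M\<^esub> qpow h (- \<kappa> N) \<odot>\<^bsub>M\<^esub> M.conjug (gT (1 / 2) \<otimes>\<^bsub>M\<^esub> C)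
          (L N \<otimes>\<^bsub>M\<^esub> L N \<otimes>\<^bsub>M\<^esub> (qpow h 0 \<odot>\<^bsub>M\<^esub> Lam (- \<alpha> N)))"
        using rel(3) unfolding S_def by simp
      show "e_sum (N - 1) = (\<lambda>j. (1 / 2) * ?v j)" by (simp add: fun_eq_iff)
      have "Dsol (N - 1) 1 = LT (N - 1)" using N2 by (intro D1) auto
      then show "Dsol (N - 1) 0 \<otimes>\<^bsub>M\<^esub> Dsol (N - 1) (0 + 1) = qpow h 0 \<odot>\<^bsub>M\<^esub> mon ?v (e_sum (N - 1)) 0"
        using Dsol_at_0[OF gU, of "N - 1"] w1
        by (simp add: Lam_Tp) (simp add: mon_defs(1) mon_mult)
      show "of_nat N / 2 = \<kappa> N" by (simp only: kN)
      \<comment> \<open>The Gaussian with y = 1/2 contributes N - 1; subtracting \<kappa> N = N/2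
        leaves N/2 - 1, the constant part of the odd exponent.\<close>
      have "dot N ?v ?v = 4 * of_nat N - 4"
        unfolding dot_add_left dot_add_right using N2 by (simp add: dot_e_sum of_nat_diff)
      then show "of_nat N / 2 - of_int n - 1 = (1 / 2) * dot N ?v ?v / 2 + 0 - \<kappa> N - 0 +
          of_int n * (\<kappa> (N - 1) / 2 + \<kappa> (N - 1) / 2 - 2 * \<kappa> N)"
        unfolding k kN by (simp add: field_simps)
    qed
    have "boundary_rel B1 h N (opposite M) Dsol n"
      using 1 2 3 by (simp add: Dsol_closed[OF gU])
    then show "boundary_rel ty h N (opposite M) Dsol n" by (simp only: ty)
  qed
  with gU show ?thesis ..
qed

text \<open>The roles of B1 are exchanged. Each factor S is a step for the labels below N, which do
  not see the last Pochhammer factor. As \<omega> N = 2 (\<omega>s N), label N needs both Gaussians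
  for one step and does not see \<open>g_Lam\<close>.\<close>

lemma D_bar_solution_C1:
  assumes ty: "ty = C1"
  shows "g \<in> Units M \<and> D_bar_solution ty h N Dsol"
proof -
  have N2: "2 \<le> N" using adm by (simp add: ty)
  have long: "\<not> short ty N N" and short: "1 \<le> a \<Longrightarrow> a < N \<Longrightarrow> short ty N a" for a
    by (simp_all add: short_def ty)
  have root: "(\<lambda>j. - e_vec N j) = - \<alpha> N" "\<alpha> N = e_vec N"
    by (simp_all add: ty fun_eq_iff)
  define P where "P = inv_qpoch N 1 q"
  define S where "S = gT 1 \<otimes>\<^bsub>M\<^esub> G"
  have P: "P \<in> const_elts" "P \<in> Units M" "P \<in> carrier M"
    using inv_qpoch_N_closed[OF zero_less_one] by (simp_all add: P_def)
  have g: "g = S \<otimes>\<^bsub>M\<^esub> S \<otimes>\<^bsub>M\<^esub> P"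
    unfolding g_elt_def Let_def M_def[symmetric] affine_type.case_cong_weak[OF ty] affine_type.case root(1)
      inv_qpoch_one[OF last_label, symmetric] S_def P_def[symmetric]
    using P g_Lam_closed by (simp add: nat_pow_2)
  have lab: "e_sum_label a" if "a < N" for a using that unfolding e_sum_label_def by (simp add: ty)
  note lw = lab[THEN e_sum_labelD(2)] lab[THEN e_sum_labelD(3)]
  have wN: "\<omega>s N = (\<lambda>j. (1 / 2) * e_sum N j)" "\<omega> N = e_sum N" by (simp_all add: ty fun_eq_iff)
  have kN: "\<kappa> N = of_nat N / 2"
    unfolding Lam_num_def wN dot_simps by (simp add: dot_N)
  have k: "\<kappa> (N - 1) = of_nat N - 1" "\<kappa> (N - 2) = of_nat N - 2"
    using N2 lab[THEN e_sum_labelD(4)] by (simp_all add: of_nat_diff)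
  have twist_P: "twist P u \<one>\<^bsub>M\<^esub>" if "u N = 0" for u
    unfolding P_def using that
    by (intro twist_inv_qpoch_trivial[OF last_label norm_qpow_less_1])
      (simp_all add: root(2) dot_e_vec[OF last_label])
  have twist_P_N: "twist P (\<omega> N) (\<one>\<^bsub>M\<^esub> \<ominus>\<^bsub>M\<^esub> 1 \<odot>\<^bsub>M\<^esub> Lam (- \<alpha> N))"
    unfolding P_def
    by (rule twist_inv_qpoch[OF last_label norm_qpow_less_1])
      (use N_pos in \<open>simp_all add: root(2) dot_e_vec[OF last_label] wN e_sum_def\<close>)
  have dots: "dot N (\<omega> b) (\<alpha> a) = (if a = b then 1 else 0)" if "b \<in> {1..N}" "a \<in> {1..<N}" for a b
    unfolding dot_simple_root[OF that(2)] using that by (auto simp: ty e_sum_def split: if_splits)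
  have adv: "advances g (\<omega>s N) (\<omega> N) (1 \<odot>\<^bsub>M\<^esub> Lam (- \<alpha> N))"
    unfolding g S_def
  proof (rule advances_square_mult[OF _ _ _ _ _ twist_P_N])
    have "dot N (\<lambda>j. 1 * \<omega>s N j) (\<alpha> a) = 0" if "a \<in> {1..<N}" for a
      using dots[OF last_label that] that unfolding wN dot_simps by simp
    then show "twist G (\<lambda>j. 1 * \<omega>s N j) \<one>\<^bsub>M\<^esub>" by (rule twist_g_Lam_trivial)
    show "\<omega> N = (\<lambda>j. 1 * \<omega>s N j) + (\<lambda>j. 1 * \<omega>s N j)"
      by (simp add: ty fun_eq_iff)
  qed (simp_all add: last_label[simplified])
  have S: "advances S (\<omega>s a) (\<omega> a) (1 \<odot>\<^bsub>M\<^esub> Lam (- \<alpha> a))" if a: "a \<in> {1..N}" "a < N" for a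
    unfolding S_def
  proof (rule advances_gT_mult)
    show "twist G (\<omega> a) (\<one>\<^bsub>M\<^esub> \<ominus>\<^bsub>M\<^esub> 1 \<odot>\<^bsub>M\<^esub> Lam (- \<alpha> a))"
      using a twist_g_Lam[of "\<omega> a" a] dots[OF a(1)] by simp
  qed (use a lw in auto)
  have gU: "g \<in> Units M" by (rule advancesD(1)[OF adv])
  have rel: "Dsol a 1 = LT a"
    "qpow h (\<kappa> a) \<odot>\<^bsub>M\<^esub> (Dsol a (-1) \<otimes>\<^bsub>M\<^esub> Dsol a 1) =
      Dsol a 0 \<otimes>\<^bsub>M\<^esub> Dsol a 0 \<ominus>\<^bsub>M\<^esub> L a \<otimes>\<^bsub>M\<^esub> L a \<otimes>\<^bsub>M\<^esub> (1 \<odot>\<^bsub>M\<^esub> Lam (- \<alpha> a))"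
    "qpow h (\<kappa> a) \<odot>\<^bsub>M\<^esub> (Dsol a 0 \<otimes>\<^bsub>M\<^esub> Dsol a 2) =
      Dsol a 1 \<otimes>\<^bsub>M\<^esub> Dsol a 1 \<ominus>\<^bsub>M\<^esub> qpow h (- \<kappa> a) \<odot>\<^bsub>M\<^esub> M.conjug (gT 1 \<otimes>\<^bsub>M\<^esub> G)
        (L a \<otimes>\<^bsub>M\<^esub> L a \<otimes>\<^bsub>M\<^esub> (1 \<odot>\<^bsub>M\<^esub> Lam (- \<alpha> a)))"
    if a: "a \<in> {1..N}" "a < N" for a
  proof -
    have "twist P (\<omega> a) \<one>\<^bsub>M\<^esub>" using a by (intro twist_P) (simp add: ty e_sum_def)
    from short_relation[OF gU a(1) short g S[OF a] S[OF a] P(2,1) twist_trivial_commutes[OF S[OF a] this]]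
    show "Dsol a 1 = LT a"
      "qpow h (\<kappa> a) \<odot>\<^bsub>M\<^esub> (Dsol a (-1) \<otimes>\<^bsub>M\<^esub> Dsol a 1) =
        Dsol a 0 \<otimes>\<^bsub>M\<^esub> Dsol a 0 \<ominus>\<^bsub>M\<^esub> L a \<otimes>\<^bsub>M\<^esub> L a \<otimes>\<^bsub>M\<^esub> (1 \<odot>\<^bsub>M\<^esub> Lam (- \<alpha> a))"
      "qpow h (\<kappa> a) \<odot>\<^bsub>M\<^esub> (Dsol a 0 \<otimes>\<^bsub>M\<^esub> Dsol a 2) =
        Dsol a 1 \<otimes>\<^bsub>M\<^esub> Dsol a 1 \<ominus>\<^bsub>M\<^esub> qpow h (- \<kappa> a) \<odot>\<^bsub>M\<^esub> M.conjug (gT 1 \<otimes>\<^bsub>M\<^esub> G)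
          (L a \<otimes>\<^bsub>M\<^esub> L a \<otimes>\<^bsub>M\<^esub> (1 \<odot>\<^bsub>M\<^esub> Lam (- \<alpha> a)))"
      using a unfolding S_def by auto
  qed
  have D1: "Dsol a 1 = LT a" if "a \<in> {1..N}" for a
    using that rel(1)[OF that] long_relation(1)[OF gU last_label long adv] by (cases "a = N") auto
  note evl = Dsol_evolves_simps(1,2)[OF gU _ disjI1[OF long]]
  \<comment> \<open>Label 0 is not short in this type, yet it occurs as N - 2 when N = 2; its
    constant sequence fits.\<close>
  have evs: "M.evolves h g (\<kappa> a) (\<lambda>n. Dsol a (2 * n))" "M.evolves h g (\<kappa> a) (\<lambda>n. Dsol a (2 * n + 1))"
    if "a < N" for a
    using that Dsol_evolves_simps(3,4)[OF gU, of a] short[of a] by (cases "a = 0"; auto)+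
  have "D_bar_solution ty h N Dsol"
  proof (rule D_bar_solution_Dsol[OF gU D1])
    show "q_rel h (opposite M) Dsol (of_nat a) a n 0 (Dsol (a + 1) n \<otimes>\<^bsub>opposite M\<^esub> Dsol (a - 1) n)"
      if "a \<in> {1..N_bar ty N}" for a n
    proof -
      have a: "1 \<le> a" "a + 1 < N" "a \<in> {1..N}" "a < N" using that by (auto simp: ty)
      have "short ty N (a - 1) \<or> a = 1" using short[of "a - 1"] a by (cases "a = 1") auto
      then show ?thesis
        using a
        by (intro interior_short[OF gU a(1) lab lab lab short _ short rel(2) g_Lam_closed(1,2) rel(3)] rel(1)) auto
    qed
    fix n
    have v: "\<omega>s N + \<omega>s N + \<omega>s (N - 2) = \<omega>s (N - 1) + \<omega>s (N - 1) - \<alpha> (N - 1)"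
      using N2 by (auto simp: ty fun_eq_iff e_sum_def e_vec_def)
    have N1: "N - 1 \<in> {1..N}" "N - 1 < N" "1 \<le> N - 1" using N2 by auto
    have ev1: "M.evolves h g (\<kappa> N / 2 + \<kappa> N / 2 + \<kappa> (N - 2))
        (\<lambda>n. Dsol N n \<otimes>\<^bsub>M\<^esub> Dsol N n \<otimes>\<^bsub>M\<^esub> Dsol (N - 2) (2 * n))"
      using N2 by (intro M.evolves_mult gU evl evs) simp_all
    have 1: "q_rel h (opposite M) Dsol (of_nat N - 1) (N - 1) (2 * n) (- (of_nat N * of_int n / 2))
        (Dsol N n \<otimes>\<^bsub>M\<^esub> Dsol N n \<otimes>\<^bsub>M\<^esub> Dsol (N - 2) (2 * n))"
    proof (rule q_rel_short_even_Lam[OF gU N1(1) short[OF N1(3,2)] rel(2)[OF N1(1,2)] ev1])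
      show "Dsol N 0 \<otimes>\<^bsub>M\<^esub> Dsol N 0 \<otimes>\<^bsub>M\<^esub> Dsol (N - 2) (2 * 0) = Lam (\<omega>s (N - 1) + \<omega>s (N - 1) - \<alpha> (N - 1))"
        unfolding v[symmetric] by (simp add: Dsol_at_0[OF gU] Lam_mult)
      show "of_nat N - 1 = \<kappa> (N - 1)" by (simp only: k)
      show "- (of_nat N * of_int n / 2) =
          of_int n * (\<kappa> N / 2 + \<kappa> N / 2 + \<kappa> (N - 2) - 2 * \<kappa> (N - 1))"
        unfolding k kN by (simp add: field_simps)
    qed
    have ev2: "M.evolves h g (\<kappa> N / 2 + (\<kappa> N / 2 + \<kappa> (N - 2)))
        (\<lambda>n. Dsol N n \<otimes>\<^bsub>M\<^esub> (Dsol N (n + 1) \<otimes>\<^bsub>M\<^esub> Dsol (N - 2) (2 * n + 1)))"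
      using N2 by (intro M.evolves_mult gU evl evs) simp_all
    have w2: "\<omega>s (N - 2) = e_sum (N - 2)" "\<omega> (N - 2) = e_sum (N - 2)"
      using N2 lw by auto
    have half: "\<omega>s N + (\<omega>s N + e_sum (N - 2)) = e_sum N + e_sum (N - 2)"
      by (simp add: wN fun_eq_iff)
    have half2: "2 * \<omega>s N + e_sum (N - 2) = e_sum N + e_sum (N - 2)"
      by (simp add: wN fun_eq_iff)
    let ?v = "e_sum N + e_sum (N - 2)"
    have 2: "q_rel h (opposite M) Dsol (of_nat N - 1) (N - 1) (2 * n + 1) (- (of_nat N * of_int n / 2))
        (Dsol N n \<otimes>\<^bsub>M\<^esub> (Dsol N (n + 1) \<otimes>\<^bsub>M\<^esub> Dsol (N - 2) (2 * n + 1)))"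
    proof (rule q_rel_short_odd_mon[OF gU N1(1) short[OF N1(3,2)] g_Lam_closed(1,2) _ _ _ ev2])
      show "qpow h (\<kappa> (N - 1)) \<odot>\<^bsub>M\<^esub> (Dsol (N - 1) 0 \<otimes>\<^bsub>M\<^esub> Dsol (N - 1) 2) =
        Dsol (N - 1) 1 \<otimes>\<^bsub>M\<^esub> Dsol (N - 1) 1 \<ominus>\<^bsub>M\<^esub> qpow h (- \<kappa> (N - 1)) \<odot>\<^bsub>M\<^esub> M.conjug (gT 1 \<otimes>\<^bsub>M\<^esub> G)
          (L (N - 1) \<otimes>\<^bsub>M\<^esub> L (N - 1) \<otimes>\<^bsub>M\<^esub> (qpow h 0 \<odot>\<^bsub>M\<^esub> Lam (- \<alpha> (N - 1))))"
        using rel(3)[OF N1(1,2)] by simp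
      show "?v = \<omega>s (N - 1) + \<omega>s (N - 1) - \<alpha> (N - 1)"
        unfolding v[symmetric] half[symmetric] w2 by (simp only: add.assoc)
      show "?v = (\<lambda>j. 1 * ?v j)" by (simp add: fun_eq_iff)
      have "Dsol (N - 2) 1 = LT (N - 2)"
        using rel(1)[of "N - 2"] Dsol_at_1_0[OF gU] N2 by (cases "N = 2") auto
      then have "Dsol N 0 \<otimes>\<^bsub>M\<^esub> (Dsol N 1 \<otimes>\<^bsub>M\<^esub> Dsol (N - 2) 1) =
          L N \<otimes>\<^bsub>M\<^esub> (mon (\<omega>s N) (e_sum N) 0 \<otimes>\<^bsub>M\<^esub> mon (e_sum (N - 2)) (e_sum (N - 2)) 0)"
        using D1[OF last_label] Dsol_at_0[OF gU, of N] w2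
        by (simp only: wN(2) Lam_Tp fund_wt_weights e_sum_weights diff_le_self order_refl)
      also have "\<dots> = qpow h (dot N (e_sum N) (e_sum (N - 2))) \<odot>\<^bsub>M\<^esub> mon ?v ?v 0"
        unfolding mon_defs(1) by (simp add: mon_mult M.smult_simps half2)
      also have "dot N (e_sum N) (e_sum (N - 2)) = of_nat N - 2"
        using N2 by (simp add: dot_e_sum of_nat_diff)
      finally show "Dsol N 0 \<otimes>\<^bsub>M\<^esub> (Dsol N (0 + 1) \<otimes>\<^bsub>M\<^esub> Dsol (N - 2) (2 * 0 + 1)) =
          qpow h (of_nat N - 2) \<odot>\<^bsub>M\<^esub> mon ?v ?v 0"
        by (simp only: mult_zero_right add_0)
      show "of_nat N - 1 = \<kappa> (N - 1)" by (simp only: k)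
      \<comment> \<open>The constant part (2 N - 3) - (N - 1) - (N - 2) vanishes, and the rates N +
        N - 2 - 2 (N - 1) with \<kappa> N / 2 counted twice leave - N/2 per period.\<close>
      have "dot N ?v ?v = 4 * of_nat N - 6"
        using N2 by (simp add: dot_simps dot_e_sum of_nat_diff)
      then show "- (of_nat N * of_int n / 2) = 1 * dot N ?v ?v / 2 + 0 - \<kappa> (N - 1) - (of_nat N - 2) +
          of_int n * (\<kappa> N / 2 + (\<kappa> N / 2 + \<kappa> (N - 2)) - 2 * \<kappa> (N - 1))"
        unfolding k kN by (simp add: field_simps)
    qed
    have ev3: "M.evolves h g (\<kappa> (N - 1)) (\<lambda>n. Dsol (N - 1) (2 * n))"
      using N1 by (intro evs)
    have 3: "q_rel h (opposite M) Dsol (of_nat N / 2) N n ((of_nat N - 2) * of_int n / 2) (Dsol (N - 1) (2 * n))"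
    proof (rule q_rel_long_Lam[OF gU last_label long adv ev3])
      have "\<omega>s (N - 1) = \<omega>s N + \<omega>s N - \<alpha> N"
        using N2 by (auto simp: ty fun_eq_iff e_sum_def e_vec_def)
      then show "Dsol (N - 1) (2 * 0) = Lam (\<omega>s N + \<omega>s N - \<alpha> N)"
        by (simp add: Dsol_at_0[OF gU])
      show "of_nat N / 2 = \<kappa> N" by (simp only: kN)
      show "(of_nat N - 2) * of_int n / 2 = of_int n * (\<kappa> (N - 1) - \<kappa> N)"
        unfolding k kN by (simp add: field_simps)
    qed
    have "boundary_rel C1 h N (opposite M) Dsol n"
      using 1 2 3 by (simp add: Dsol_closed[OF gU])
    then show "boundary_rel ty h N (opposite M) Dsol n" by (simp only: ty)
  qed
  with gU show ?thesis ..
qed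

section \<open>Uniqueness of the solution\<close>

context
  fixes Q R :: "nat \<Rightarrow> int \<Rightarrow> qelt"
  assumes sol: "D_bar_solution ty h N Q" "D_bar_solution ty h N R"
    and Q_Units: "\<And>a m. a \<in> {1..N} \<Longrightarrow> Q a m \<in> Units M"
begin

lemma solution_system: "Q_system ty h N (opposite M) Q" "Q_system ty h N (opposite M) R"
  using sol by (simp_all add: D_bar_solution_def M_def)

lemma boundary_Q: "boundary_rel ty h N (opposite M) Q n"
  and boundary_R: "boundary_rel ty h N (opposite M) R n"
  using solution_system unfolding Q_system_def by blast+

lemma solution_label_0: "Q 0 m = \<one>\<^bsub>M\<^esub>" "R 0 m = \<one>\<^bsub>M\<^esub>"
  using solution_system unfolding Q_system_def M.opposite_simps by blast+

lemma solution_closed: "a \<in> {1..N} \<Longrightarrow> R a m \<in> carrier M"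
  using solution_system(2) unfolding Q_system_def M.opposite_simps by blast

lemma solutions_initial:
  assumes "a \<le> N" shows "Q a 0 = R a 0" "Q a 1 = R a 1"
proof -
  have "a \<in> {1..N} \<Longrightarrow> Q a 0 = R a 0 \<and> Q a 1 = R a 1"
    using sol unfolding D_bar_solution_def by metis
  then show "Q a 0 = R a 0" "Q a 1 = R a 1"
    using assms by (cases "a = 0"; simp add: solution_label_0)+
qed

lemma neighbours_agree:
  assumes "q_rel h (opposite M) Q c a m d X" "q_rel h (opposite M) R c a m d Y"
    and "a \<in> {1..N}" "Q a m = R a m" "X = Y"
  shows "Q a (m - 1) = R a (m - 1) \<longleftrightarrow> Q a (m + 1) = R a (m + 1)"
  using assms Q_Units solution_closed[of a]
  by (intro M.q_rel_opposite_determines[of h Q c a m d X R]) auto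

lemma neighbours_agree_interior:
  assumes a: "a \<in> {1..N_bar ty N}" and "Q a m = R a m" "Q (a + 1) m = R (a + 1) m" "Q (a - 1) m = R (a - 1) m"
  shows "Q a (m - 1) = R a (m - 1) \<longleftrightarrow> Q a (m + 1) = R a (m + 1)"
proof (rule neighbours_agree)
  show "q_rel h (opposite M) Q (of_nat a) a m 0 (Q (a + 1) m \<otimes>\<^bsub>opposite M\<^esub> Q (a - 1) m)"
    "q_rel h (opposite M) R (of_nat a) a m 0 (R (a + 1) m \<otimes>\<^bsub>opposite M\<^esub> R (a - 1) m)"
    using solution_system a unfolding Q_system_def by blast+
  show "a \<in> {1..N}" using a by (cases ty) auto
qed (use assms in simp_all)

text \<open>In four types every equation centred at time m has its second term at time m. Agreement
  at two consecutive times therefore spreads in both directions.\<close>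

lemma solutions_agree_homogeneous:
  assumes step: "\<And>a m. a \<in> {1..N} \<Longrightarrow> (\<And>b. b \<le> N \<Longrightarrow> Q b m = R b m) \<Longrightarrow>
      Q a (m - 1) = R a (m - 1) \<longleftrightarrow> Q a (m + 1) = R a (m + 1)"
    and "a \<in> {1..N}"
  shows "Q a n = R a n"
proof -
  have step': "(\<forall>a\<le>N. Q a (m - 1) = R a (m - 1)) \<longleftrightarrow> (\<forall>a\<le>N. Q a (m + 1) = R a (m + 1))"
    if "\<forall>a\<le>N. Q a m = R a m" for m
  proof -
    have "Q a (m - 1) = R a (m - 1) \<longleftrightarrow> Q a (m + 1) = R a (m + 1)" if "a \<le> N" for a
      using step[of a m] that \<open>\<forall>a\<le>N. Q a m = R a m\<close> solution_label_0 by (cases "a = 0") auto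
    then show ?thesis by blast
  qed
  have "(\<forall>a\<le>N. Q a n = R a n) \<and> (\<forall>a\<le>N. Q a (n + 1) = R a (n + 1))" for n
  proof (induction n rule: int_induct[of _ 0])
    case base
    then show ?case using solutions_initial by simp
  next
    case (step1 i)
    then show ?case using step'[of "i + 1"] by (simp add: algebra_simps)
  next
    case (step2 i)
    then show ?case using step'[of i] by (simp add: algebra_simps)
  qed
  then show ?thesis using assms(2) by simp
qed

lemma solutions_agree_D1:
  assumes ty: "ty = D1" and a: "a \<in> {1..N}"
  shows "Q a n = R a n"
proof (rule solutions_agree_homogeneous[OF _ a])
  fix a m assume a: "a \<in> {1..N}" and eq: "\<And>b. b \<le> N \<Longrightarrow> Q b m = R b m"
  have N3: "3 \<le> N" using adm by (simp add: ty)
  have rels: "boundary_rel D1 h N (opposite M) Q m" "boundary_rel D1 h N (opposite M) R m"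
    using boundary_Q boundary_R unfolding ty by auto
  have "a \<in> {1..N_bar ty N} \<or> a = N - 2 \<or> a = N - 1 \<or> a = N"
    using a by (simp add: ty; arith)
  then consider "a \<in> {1..N_bar ty N}" | "a = N - 2" | "a = N - 1 \<or> a = N" by blast
  then show "Q a (m - 1) = R a (m - 1) \<longleftrightarrow> Q a (m + 1) = R a (m + 1)"
  proof cases
    case 1
    then show ?thesis using a eq N3 by (intro neighbours_agree_interior) (auto simp: ty)
  next
    case 2
    note q = rels[unfolded boundary_rel.simps, THEN conjunct1]
    show ?thesis unfolding 2
      by (rule neighbours_agree[OF q]) (use eq N3 in auto)
  next
    case 3
    note q = rels[unfolded boundary_rel.simps, THEN conjunct2, THEN bspec, of a]
    show ?thesis
      by (rule neighbours_agree[OF q]) (use 3 a eq N3 in auto)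
  qed
qed

lemma solutions_agree_A2odd:
  assumes ty: "ty = A2odd" and a: "a \<in> {1..N}"
  shows "Q a n = R a n"
proof (rule solutions_agree_homogeneous[OF _ a])
  fix a m assume a: "a \<in> {1..N}" and eq: "\<And>b. b \<le> N \<Longrightarrow> Q b m = R b m"
  have rels: "boundary_rel A2odd h N (opposite M) Q m" "boundary_rel A2odd h N (opposite M) R m"
    using boundary_Q boundary_R unfolding ty by auto
  have "a \<in> {1..N_bar ty N} \<or> a = N"
    using a by (simp add: ty; arith)
  then consider "a \<in> {1..N_bar ty N}" | "a = N" by blast
  then show "Q a (m - 1) = R a (m - 1) \<longleftrightarrow> Q a (m + 1) = R a (m + 1)"
  proof cases
    case 1
    then show ?thesis using a eq by (intro neighbours_agree_interior) (auto simp: ty)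
  next
    case 2
    note q = rels[unfolded boundary_rel.simps]
    show ?thesis unfolding 2
      by (rule neighbours_agree[OF q]) (use eq N_pos in auto)
  qed
qed

lemma solutions_agree_D2:
  assumes ty: "ty = D2" and a: "a \<in> {1..N}"
  shows "Q a n = R a n"
proof (rule solutions_agree_homogeneous[OF _ a])
  fix a m assume a: "a \<in> {1..N}" and eq: "\<And>b. b \<le> N \<Longrightarrow> Q b m = R b m"
  have N2: "2 \<le> N" using adm by (simp add: ty)
  have rels: "boundary_rel D2 h N (opposite M) Q m" "boundary_rel D2 h N (opposite M) R m"
    using boundary_Q boundary_R unfolding ty by auto
  have "a \<in> {1..N_bar ty N} \<or> a = N - 1 \<or> a = N"
    using a by (simp add: ty; arith)
  then consider "a \<in> {1..N_bar ty N}" | "a = N - 1" | "a = N" by blast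
  then show "Q a (m - 1) = R a (m - 1) \<longleftrightarrow> Q a (m + 1) = R a (m + 1)"
  proof cases
    case 1
    then show ?thesis using a eq by (intro neighbours_agree_interior) (auto simp: ty)
  next
    case 2
    note q = rels[unfolded boundary_rel.simps, THEN conjunct1]
    show ?thesis unfolding 2
      by (rule neighbours_agree[OF q]) (use eq N2 in auto)
  next
    case 3
    note q = rels[unfolded boundary_rel.simps, THEN conjunct2]
    show ?thesis unfolding 3
      by (rule neighbours_agree[OF q]) (use eq N2 in auto)
  qed
qed

lemma solutions_agree_A2even:
  assumes ty: "ty = A2even" and a: "a \<in> {1..N}"
  shows "Q a n = R a n"
proof (rule solutions_agree_homogeneous[OF _ a])
  fix a m assume a: "a \<in> {1..N}" and eq: "\<And>b. b \<le> N \<Longrightarrow> Q b m = R b m"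
  have rels: "boundary_rel A2even h N (opposite M) Q n" "boundary_rel A2even h N (opposite M) R n" for n
    using boundary_Q boundary_R unfolding ty by auto
  consider "a \<in> {1..N_bar ty N}" | (even) n where "a = N" "m = 2 * n" | (odd) n where "a = N" "m = 2 * n + 1"
    using a by (cases "a = N"; cases "even m") (auto simp: ty elim!: evenE oddE)
  then show "Q a (m - 1) = R a (m - 1) \<longleftrightarrow> Q a (m + 1) = R a (m + 1)"
  proof cases
    case 1
    then show ?thesis using a eq by (intro neighbours_agree_interior) (auto simp: ty)
  next
    case even
    note q = rels[unfolded boundary_rel.simps, THEN conjunct1]
    show ?thesis unfolding even
      by (rule neighbours_agree[OF q]) (use eq[unfolded even] N_pos in auto)
  next
    case odd
    note q = rels[unfolded boundary_rel.simps, THEN conjunct2]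
    show ?thesis unfolding odd
      by (rule neighbours_agree[OF q]) (use eq[unfolded odd] N_pos in auto)
  qed
qed

text \<open>Label N runs twice as fast as the others, so the induction carries two consecutive times
  of each clock: n and n + 1 for the labels below N, 2 n and 2 n + 1 for label N.\<close>

lemma solutions_agree_B1:
  assumes ty: "ty = B1" and a: "a \<in> {1..N}"
  shows "Q a n = R a n"
proof -
  have N2: "2 \<le> N" using adm by (simp add: ty)
  have rels: "boundary_rel B1 h N (opposite M) Q n" "boundary_rel B1 h N (opposite M) R n" for n
    using boundary_Q boundary_R unfolding ty by auto
  note q = rels[unfolded boundary_rel.simps]
  define E where "E = (\<lambda>m. \<forall>a<N. Q a m = R a m)"
  define F where "F = (\<lambda>m. Q N m = R N m)"
  have long: "E (m - 1) \<longleftrightarrow> E (m + 1)" if "E m" "F (2 * m)" for m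
  proof -
    have "Q a (m - 1) = R a (m - 1) \<longleftrightarrow> Q a (m + 1) = R a (m + 1)" if "a < N" for a
    proof -
      have "a = 0 \<or> a \<in> {1..N_bar ty N} \<or> a = N - 1"
        using that by (simp add: ty; arith)
      then consider "a = 0" | "a \<in> {1..N_bar ty N}" | "a = N - 1" by blast
      then show ?thesis
      proof cases
        case 2
        then show ?thesis using \<open>E m\<close> by (intro neighbours_agree_interior) (auto simp: ty E_def)
      next
        case 3
        show ?thesis unfolding 3
          by (rule neighbours_agree[OF q[THEN conjunct1]])
            (use \<open>E m\<close> \<open>F (2 * m)\<close> N2 in \<open>auto simp: E_def F_def\<close>)
      qed (simp add: solution_label_0)
    qed
    then show ?thesis unfolding E_def by blast
  qed
  have even: "F (2 * m - 1) \<longleftrightarrow> F (2 * m + 1)" if "F (2 * m)" "E m" for m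
    unfolding F_def
    by (rule neighbours_agree[OF q[THEN conjunct2, THEN conjunct1]])
      (use that N2 in \<open>auto simp: E_def F_def\<close>)
  have odd: "F (2 * m + 1 - 1) \<longleftrightarrow> F (2 * m + 1 + 1)" if "F (2 * m + 1)" "E m" "E (m + 1)" for m
    unfolding F_def
    by (rule neighbours_agree[OF q[THEN conjunct2, THEN conjunct2]])
      (use that N2 in \<open>auto simp: E_def F_def\<close>)
  have agree: "E n \<and> E (n + 1) \<and> F (2 * n) \<and> F (2 * n + 1)" for n
  proof (induction n rule: int_induct[of _ 0])
    case base
    then show ?case using solutions_initial by (simp add: E_def F_def)
  next
    case (step1 i)
    \<comment> \<open>The order matters: the slow labels reach time i + 2 only after label N is
      known at 2 i + 2, and \<open>even\<close> then gives label N at 2 i + 3.\<close>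
    then have "F (2 * (i + 1))" using odd[of i] by (simp add: algebra_simps)
    with step1 show ?case
      using long[of "i + 1"] even[of "i + 1"] by (simp add: algebra_simps)
  next
    case (step2 i)
    then have "E (i - 1)" "F (2 * i - 1)" using long[of i] even[of i] by simp_all
    with step2 show ?case
      using odd[of "i - 1"] by (simp add: algebra_simps)
  qed
  show ?thesis
  proof (cases "a = N")
    case True
    have "F n" using agree[of "n div 2"] by (cases "even n") (simp_all add: odd_two_times_div_two_succ)
    then show ?thesis by (simp add: True F_def)
  next
    case False
    then show ?thesis using agree[of n] a by (simp add: E_def)
  qed
qed

text \<open>Here the labels below N are the fast ones. Among them only N - 1 has an equation that
  depends on parity, so \<open>short\<close> takes its two-way propagation as a hypothesis and
  treats the rest uniformly.\<close>

lemma solutions_agree_C1: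
  assumes ty: "ty = C1" and a: "a \<in> {1..N}"
  shows "Q a n = R a n"
proof -
  have N2: "2 \<le> N" using adm by (simp add: ty)
  have rels: "boundary_rel C1 h N (opposite M) Q n" "boundary_rel C1 h N (opposite M) R n" for n
    using boundary_Q boundary_R unfolding ty by auto
  note q = rels[unfolded boundary_rel.simps]
  define E where "E = (\<lambda>m. \<forall>a<N. Q a m = R a m)"
  define F where "F = (\<lambda>m. Q N m = R N m)"
  have short: "E (m - 1) \<longleftrightarrow> E (m + 1)"
    if "E m" and last: "Q (N - 1) (m - 1) = R (N - 1) (m - 1) \<longleftrightarrow> Q (N - 1) (m + 1) = R (N - 1) (m + 1)" for m
  proof -
    have "Q a (m - 1) = R a (m - 1) \<longleftrightarrow> Q a (m + 1) = R a (m + 1)" if "a < N" for a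
    proof -
      have "a = 0 \<or> a \<in> {1..N_bar ty N} \<or> a = N - 1"
        using that by (simp add: ty; arith)
      then consider "a = 0" | "a \<in> {1..N_bar ty N}" | "a = N - 1" by blast
      then show ?thesis
      proof cases
        case 2
        then show ?thesis using \<open>E m\<close> by (intro neighbours_agree_interior) (auto simp: ty E_def)
      next
        case 3
        then show ?thesis using last by (simp only:)
      qed (simp add: solution_label_0)
    qed
    then show ?thesis unfolding E_def by blast
  qed
  have even: "E (2 * m - 1) \<longleftrightarrow> E (2 * m + 1)" if "E (2 * m)" "F m" for m
    by (rule short[OF that(1)], rule neighbours_agree[OF q[THEN conjunct1]])
      (use that N2 in \<open>auto simp: E_def F_def\<close>)
  have odd: "E (2 * m + 1 - 1) \<longleftrightarrow> E (2 * m + 1 + 1)" if "E (2 * m + 1)" "F m" "F (m + 1)" for m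
    by (rule short[OF that(1)], rule neighbours_agree[OF q[THEN conjunct2, THEN conjunct1]])
      (use that N2 in \<open>auto simp: E_def F_def\<close>)
  have long: "F (m - 1) \<longleftrightarrow> F (m + 1)" if "F m" "E (2 * m)" for m
    unfolding F_def
    by (rule neighbours_agree[OF q[THEN conjunct2, THEN conjunct2]])
      (use that N2 in \<open>auto simp: E_def F_def\<close>)
  have agree: "F n \<and> F (n + 1) \<and> E (2 * n) \<and> E (2 * n + 1)" for n
  proof (induction n rule: int_induct[of _ 0])
    case base
    then show ?case using solutions_initial by (simp add: E_def F_def)
  next
    case (step1 i)
    then have "E (2 * (i + 1))" using odd[of i] by (simp add: algebra_simps)
    with step1 show ?case
      using long[of "i + 1"] even[of "i + 1"] by (simp add: algebra_simps)
  next
    case (step2 i)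
    then have "F (i - 1)" "E (2 * i - 1)" using long[of i] even[of i] by simp_all
    with step2 show ?case
      using odd[of "i - 1"] by (simp add: algebra_simps)
  qed
  show ?thesis
  proof (cases "a = N")
    case True
    then show ?thesis using agree[of n] by (simp add: F_def)
  next
    case False
    have "E n" using agree[of "n div 2"] by (cases "even n") (simp_all add: odd_two_times_div_two_succ)
    then show ?thesis using False a by (simp add: E_def)
  qed
qed

lemma solutions_agree: "a \<in> {1..N} \<Longrightarrow> Q a n = R a n"
  by (cases ty) (rule solutions_agree_D1 solutions_agree_B1 solutions_agree_C1 solutions_agree_A2odd
      solutions_agree_D2 solutions_agree_A2even; assumption)+

end

lemma D_bar_solution_Dsol_all: "g \<in> Units M" "D_bar_solution ty h N Dsol"
  using D_bar_solution_D1 D_bar_solution_B1 D_bar_solution_C1 D_bar_solution_A2odd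
    D_bar_solution_D2 D_bar_solution_A2even by (cases ty; blast)+

end

theorem theorem4p9:
  fixes ty :: affine_type and N :: nat and h :: complex
  assumes "admissible_rank ty N" and "Re h < 0"
  shows "let M = qtorus h ty N; g = g_elt ty h N in
    g \<in> Units M \<and>
    (\<exists>D. D_bar_solution ty h N D) \<and>
    (\<forall>D. D_bar_solution ty h N D \<longrightarrow>
      (\<forall>a\<in>{1..N}. \<forall>n::int.
        (\<not> short ty N a \<longrightarrow>
           D a n = qpow h (- (of_int n / 2) * Lam_num ty N a a) \<odot>\<^bsub>M\<^esub>
                     (g [^]\<^bsub>M\<^esub> n \<otimes>\<^bsub>M\<^esub> D a 0 \<otimes>\<^bsub>M\<^esub> g [^]\<^bsub>M\<^esub> (- n))) \<and>
        (short ty N a \<longrightarrow> (\<forall>i\<in>{0, 1}.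
           D a (2 * n + i) = qpow h (- of_int n * Lam_num ty N a a) \<odot>\<^bsub>M\<^esub>
                     (g [^]\<^bsub>M\<^esub> n \<otimes>\<^bsub>M\<^esub> D a i \<otimes>\<^bsub>M\<^esub> g [^]\<^bsub>M\<^esub> (- n))))))"
proof -
  interpret quantum_torus ty N h by unfold_locales (fact assms)+
  note gU = D_bar_solution_Dsol_all(1) and sol = D_bar_solution_Dsol_all(2)
  \<comment> \<open>Invertibility of all values of \<open>Dsol\<close> is what allows uniqueness to
    be applied against an arbitrary solution, about which only membership in the carrier is
    known.\<close>
  have agree: "Dsol a n = D a n" if "D_bar_solution ty h N D" "a \<in> {1..N}" for D a n
    by (rule solutions_agree[OF sol that(1) _ that(2)]) (simp add: Dsol_Units[OF gU])
  show ?thesis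
    unfolding Let_def M_def[symmetric]
  proof (intro conjI allI impI ballI)
    show "g \<in> Units M" by (rule gU)
    show "\<exists>D. D_bar_solution ty h N D" using sol by blast
    fix D a and n :: int assume D: "D_bar_solution ty h N D" and a: "a \<in> {1..N}"
    note agree = agree[OF D a, symmetric]
    show "D a n = qpow h (- (of_int n / 2) * Lam_num ty N a a) \<odot>\<^bsub>M\<^esub>
        (g [^]\<^bsub>M\<^esub> n \<otimes>\<^bsub>M\<^esub> D a 0 \<otimes>\<^bsub>M\<^esub> g [^]\<^bsub>M\<^esub> (- n))" if "\<not> short ty N a"
      unfolding agree using a that by (intro Dsol_formula_long gU) auto
    show "D a (2 * n + i) = qpow h (- of_int n * Lam_num ty N a a) \<odot>\<^bsub>M\<^esub>
        (g [^]\<^bsub>M\<^esub> n \<otimes>\<^bsub>M\<^esub> D a i \<otimes>\<^bsub>M\<^esub> g [^]\<^bsub>M\<^esub> (- n))" if "short ty N a" for i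
      unfolding agree using a that by (intro Dsol_formula_short gU) auto
  qed
qed

end
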